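(* For every fixed $\varepsilon>0$ and every $k=k(n)\ge \varepsilon\sqrt{n}$ there is an explicitly described algorithm, running in time $n^{O(\log(1/\varepsilon))}$, such that for every adversarial planting strategy, when $G\sim AG(n,\tfrac12,k)$ is generated with that strategy, the algorithm outputs a maximum clique of $G$ with probability tending to $1$ as $n\to\infty$ (the probability being over the choice of $G'\sim G(n,\tfrac12)$).
   Context: $G(n,p)$ is the Erdős–Rényi random graph on $n$ vertices in which each pair is an edge independently with probability $p$. The adversarial planted clique model $AG(n,p,k)$: first $G'\sim G(n,p)$ is sampled; then a computationally unbounded adversary inspects $G'$ and selects a set $K$ of $k$ vertices (an adversarial planting strategy is an arbitrary map from $G'$ to such a $K$); finally all missing edges between pairs of vertices of $K$ are added, giving $G$. Thus $AG(n,p,k)$ is a family of distributions, one per strategy. *)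

theory Defs
  imports "HOL-Probability.Probability"
begin

text \<open>A graph on vertices 0..n-1 is a set of pairs (i,j) with i < j < n.\<close>

definition vpairs :: "nat \<Rightarrow> (nat \<times> nat) set" where
  "vpairs n = {(i, j). i < j \<and> j < n}"

definition adj :: "(nat \<times> nat) set \<Rightarrow> nat \<Rightarrow> nat \<Rightarrow> bool" where
  "adj E u v \<longleftrightarrow> u \<noteq> v \<and> (min u v, max u v) \<in> E"

definition gnp :: "nat \<Rightarrow> real \<Rightarrow> (nat \<times> nat) set pmf" where
  "gnp n p = map_pmf (\<lambda>f. {e \<in> vpairs n. f e})
              (Pi_pmf (vpairs n) False (\<lambda>_. bernoulli_pmf p))"

definition plant :: "(nat \<times> nat) set \<Rightarrow> nat set \<Rightarrow> (nat \<times> nat) set" where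
  "plant E K = E \<union> {(i, j). i \<in> K \<and> j \<in> K \<and> i < j}"

definition planting_strategy :: "nat \<Rightarrow> nat \<Rightarrow> ((nat \<times> nat) set \<Rightarrow> nat set) \<Rightarrow> bool" where
  "planting_strategy n k s \<longleftrightarrow>
     (\<forall>E. E \<subseteq> vpairs n \<longrightarrow> s E \<subseteq> {..<n} \<and> card (s E) = k)"

definition is_clique :: "nat \<Rightarrow> (nat \<times> nat) set \<Rightarrow> nat set \<Rightarrow> bool" where
  "is_clique n E C \<longleftrightarrow> C \<subseteq> {..<n} \<and> (\<forall>u\<in>C. \<forall>v\<in>C. u \<noteq> v \<longrightarrow> adj E u v)"

definition is_max_clique :: "nat \<Rightarrow> (nat \<times> nat) set \<Rightarrow> nat set \<Rightarrow> bool" where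
  "is_max_clique n E C \<longleftrightarrow> is_clique n E C \<and> (\<forall>D. is_clique n E D \<longrightarrow> card D \<le> card C)"

section \<open>Machine model: a RAM with logarithmic cost and edge-query access to the input graph\<close>

datatype instr =
    Const nat nat
  | Add nat nat nat
  | Sub nat nat nat
  | Mul nat nat nat
  | Div nat nat nat
  | Jz nat nat
  | Jmp nat
  | LoadI nat nat
  | StoreI nat nat
  | Edge nat nat nat
  | Out nat
  | Halt

fun nbits :: "nat \<Rightarrow> nat" where
  "nbits x = (if x < 2 then 1 else Suc (nbits (x div 2)))"

datatype config = Cfg (pc: nat) (regs: "nat \<Rightarrow> nat") (outp: "nat set") (cost: nat)

fun step :: "instr list \<Rightarrow> (nat \<times> nat) set \<Rightarrow> config \<Rightarrow> config" where
  "step P E (Cfg i R Os c) =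
    (if length P \<le> i then Cfg i R Os c else
     (case P ! i of
        Const r v \<Rightarrow> Cfg (Suc i) (R(r := v)) Os (c + 1 + nbits v)
      | Add r a b \<Rightarrow> Cfg (Suc i) (R(r := R a + R b)) Os (c + 1 + nbits (R a) + nbits (R b))
      | Sub r a b \<Rightarrow> Cfg (Suc i) (R(r := R a - R b)) Os (c + 1 + nbits (R a) + nbits (R b))
      | Mul r a b \<Rightarrow> Cfg (Suc i) (R(r := R a * R b)) Os (c + 1 + nbits (R a) + nbits (R b))
      | Div r a b \<Rightarrow> Cfg (Suc i) (R(r := R a div R b)) Os (c + 1 + nbits (R a) + nbits (R b))
      | Jz r l \<Rightarrow> Cfg (if R r = 0 then l else Suc i) R Os (c + 1 + nbits (R r))
      | Jmp l \<Rightarrow> Cfg l R Os (c + 1)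
      | LoadI r a \<Rightarrow> Cfg (Suc i) (R(r := R (R a))) Os (c + 1 + nbits (R a) + nbits (R (R a)))
      | StoreI a b \<Rightarrow> Cfg (Suc i) (R(R a := R b)) Os (c + 1 + nbits (R a) + nbits (R b))
      | Edge r a b \<Rightarrow> Cfg (Suc i) (R(r := (if adj E (R a) (R b) then 1 else 0))) Os
                        (c + 1 + nbits (R a) + nbits (R b))
      | Out a \<Rightarrow> Cfg (Suc i) R (insert (R a) Os) (c + 1 + nbits (R a))
      | Halt \<Rightarrow> Cfg i R Os c))"

definition halted :: "instr list \<Rightarrow> config \<Rightarrow> bool" where
  "halted P cf \<longleftrightarrow> length P \<le> pc cf \<or> P ! pc cf = Halt"

definition init :: "nat \<Rightarrow> nat \<Rightarrow> config" where
  "init n k = Cfg 0 ((\<lambda>_. 0)(0 := n, 1 := k)) {} 0"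

definition runs_within ::
  "instr list \<Rightarrow> (nat \<times> nat) set \<Rightarrow> nat \<Rightarrow> nat \<Rightarrow> real \<Rightarrow> nat set \<Rightarrow> bool" where
  "runs_within P E n k T Y \<longleftrightarrow>
     (\<exists>m. let cf = (step P E ^^ m) (init n k)
          in halted P cf \<and> real (cost cf) \<le> T \<and> outp cf = Y)"

end

theory Submission
  imports Defs "HOL-Library.Discrete_Functions" "HOL-Real_Asymp.Real_Asymp"
begin

text \<open>
  Write \<open>G'\<close> for the random graph, \<open>G\<close> for the planted one, and use +1/-1 adjacency matrices.
  With high probability every principal submatrix of the matrix of \<open>G'\<close> on at most \<open>\<delta> n\<close> vertices
  has operator norm of order \<open>\<delta>\<^sup>1\<^sup>/\<^sup>4\<close> times the square root of \<open>n\<close>: this is a union bound over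
  a lattice net whose points are counted with a generating function. Hence, whatever \<open>K\<close> the adversary picks, the matrix of \<open>G\<close>
  on a small vertex set \<open>U \<supseteq> K\<close> is the all-ones block on \<open>K\<close> plus noise of norm much less than \<open>k\<close>.
  Guessing \<open>O(log (1/\<epsilon>))\<close> suitable members of \<open>K\<close> and taking their common neighbourhood produces such
  a \<open>U\<close>; a power iteration started at a suitable vertex of \<open>K\<close> then gives a vector close to a multiple
  of the indicator of \<open>K\<close>, and thresholding it gives a set \<open>M\<close> that nearly equals \<open>K\<close>.

  The vertices adjacent to at least three quarters of \<open>M\<close> contain \<open>K\<close> and every maximum clique, and a
  second union bound shows that only \<open>O(log n)\<close> of them lie outside \<open>K\<close>. A maximum clique is thus
  obtained by deleting \<open>O(log n)\<close> vertices, and a vertex-cover branching with \<open>O(log n)\<close> guessed bits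
  finds it in polynomial time. All guesses are enumerated and the best clique found is returned.

  The program never multiplies and all its loops run over \<open>0..<n\<close>. After \<open>m\<close> steps its registers are
  at most \<open>2\<^sup>m\<close> times the initial bound, so the logarithmic cost is quadratic in the number of steps.
\<close>

section \<open>Structured programs and their compilation\<close>

text \<open>\<open>K\<close> is chosen after the random graph is seen, so nothing about it is
  random. All probability therefore goes into properties of \<open>E\<close> that quantify over all
  vertex sets at once (\<open>opb\<close>, \<open>disc\<close>); the rest is deterministic. The
  small parameter is \<open>d\<close>, small sets having at most d^4 n vertices. A net for such
  sparse vectors has exp(O(d^2 n)) points once the logarithm of 1/d^4 is bounded by a multiple of
  1/d^2, which gives noise of norm O(d sqrt n). With \<open>d\<close> proportional to epsilon this
  is a small fraction of \<open>k\<close>, and shrinking the vertex set from n to about d^4 n by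
  factors 3/5 costs O(log(1/epsilon)) seeds. If \<open>k\<close> is itself linear in n, no small
  \<open>U\<close> contains \<open>K\<close>, but then the norm bound for the whole graph suffices.
  Every guess must fit into a loop counter below \<open>n\<close>. So the real threshold is replaced
  by a vertex at which it is attained, and the O(log n) branching bits are split into 40 codes of
  \<open>floor_log n - 1\<close> bits. The number of guesses is then the fixed number t +
  42.\<close>

declare nbits.simps [simp del]

text \<open>Scalars and array cells are separate constructors, so aliasing cannot occur when
  reasoning about programs; only \<open>rel\<close> has to know that the memory layout keeps them
  apart.\<close>

datatype loc = V nat | A nat nat

datatype com =
    CConst nat nat
  | CAdd nat nat nat
  | CSub nat nat nat
  | CDiv nat nat nat
  | CEdge nat nat nat
  | CLoad nat nat nat
  | CStore nat nat nat
  | COut nat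
  | CSeq com com (infixr \<open>;;\<close> 60)
  | CIf nat com com
  | CFor nat com

text \<open>The last update in the \<open>CFor\<close> case is what the compiled loop leaves behind:
  on exit the counter register holds \<open>n\<close>.\<close>

fun exec :: "(nat \<times> nat) set \<Rightarrow> com \<Rightarrow> (loc \<Rightarrow> nat) \<Rightarrow> (loc \<Rightarrow> nat)" where
  "exec E (CConst r v) s = s(V r := v)"
| "exec E (CAdd r a b) s = s(V r := s (V a) + s (V b))"
| "exec E (CSub r a b) s = s(V r := s (V a) - s (V b))"
| "exec E (CDiv r a b) s = s(V r := s (V a) div s (V b))"
| "exec E (CEdge r a b) s = s(V r := (if adj E (s (V a)) (s (V b)) then 1 else 0))"
| "exec E (CLoad r a i) s = s(V r := s (A a (s (V i))))"
| "exec E (CStore a i r) s = s(A a (s (V i)) := s (V r))"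
| "exec E (COut r) s = s"
| "exec E (c ;; d) s = exec E d (exec E c s)"
| "exec E (CIf r c d) s = (if s (V r) \<noteq> 0 then exec E c s else exec E d s)"
| "exec E (CFor v c) s = (fold (\<lambda>i s. exec E c (s(V v := i))) [0..<s (V 0)] s)(V v := s (V 0))"

fun outs :: "(nat \<times> nat) set \<Rightarrow> com \<Rightarrow> (loc \<Rightarrow> nat) \<Rightarrow> nat set" where
  "outs E (COut r) s = {s (V r)}"
| "outs E (c ;; d) s = outs E c s \<union> outs E d (exec E c s)"
| "outs E (CIf r c d) s = (if s (V r) \<noteq> 0 then outs E c s else outs E d s)"
| "outs E (CFor v c) s = (\<Union>j<s (V 0).
     outs E c ((fold (\<lambda>i s. exec E c (s(V v := i))) [0..<j] s)(V v := j)))"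
| "outs E _ s = {}"

primrec wvars :: "com \<Rightarrow> nat set" where
  "wvars (CConst r v) = {r}"
| "wvars (CAdd r a b) = {r}"
| "wvars (CSub r a b) = {r}"
| "wvars (CDiv r a b) = {r}"
| "wvars (CEdge r a b) = {r}"
| "wvars (CLoad r a i) = {r}"
| "wvars (CStore a i r) = {}"
| "wvars (COut r) = {}"
| "wvars (c ;; d) = wvars c \<union> wvars d"
| "wvars (CIf r c d) = wvars c \<union> wvars d"
| "wvars (CFor v c) = insert v (wvars c)"

fun warrs :: "com \<Rightarrow> nat set" where
  "warrs (CStore a i r) = {a}"
| "warrs (c ;; d) = warrs c \<union> warrs d"
| "warrs (CIf r c d) = warrs c \<union> warrs d"
| "warrs (CFor v c) = warrs c"
| "warrs _ = {}"

text \<open>Registers 2 and 3 are scratch registers of the compiled code, register 0 holds \<open>n\<close>;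
  the array cell \<open>A a i\<close> lives in register \<open>b + 8 * i + a\<close>.\<close>

definition vok :: "nat \<Rightarrow> nat \<Rightarrow> bool" where
  "vok b x \<longleftrightarrow> x < b \<and> x \<noteq> 2 \<and> x \<noteq> 3"

text \<open>Writable registers. Protecting register 0 makes \<open>n\<close> invariant, so that all
  loops share one fixed bound.\<close>

definition wok :: "nat \<Rightarrow> nat \<Rightarrow> bool" where
  "wok b x \<longleftrightarrow> vok b x \<and> x \<noteq> 0"

primrec wfc :: "nat \<Rightarrow> com \<Rightarrow> bool" where
  "wfc b (CConst r v) \<longleftrightarrow> wok b r"
| "wfc b (CAdd r x y) \<longleftrightarrow> wok b r \<and> vok b x \<and> vok b y"
| "wfc b (CSub r x y) \<longleftrightarrow> wok b r \<and> vok b x \<and> vok b y"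
| "wfc b (CDiv r x y) \<longleftrightarrow> wok b r \<and> vok b x \<and> vok b y"
| "wfc b (CEdge r x y) \<longleftrightarrow> wok b r \<and> vok b x \<and> vok b y"
| "wfc b (CLoad r a i) \<longleftrightarrow> wok b r \<and> a < 8 \<and> vok b i"
| "wfc b (CStore a i r) \<longleftrightarrow> vok b r \<and> a < 8 \<and> vok b i"
| "wfc b (COut r) \<longleftrightarrow> vok b r"
| "wfc b (c ;; d) \<longleftrightarrow> wfc b c \<and> wfc b d"
| "wfc b (CIf r c d) \<longleftrightarrow> vok b r \<and> wfc b c \<and> wfc b d"
| "wfc b (CFor v c) \<longleftrightarrow> wok b v \<and> v \<notin> wvars c \<and> wfc b c"

fun clen :: "com \<Rightarrow> nat" where
  "clen (CLoad r a i) = 6"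
| "clen (CStore a i r) = 6"
| "clen (c ;; d) = clen c + clen d"
| "clen (CIf r c d) = clen c + clen d + 2"
| "clen (CFor v c) = clen c + 6"
| "clen _ = 1"

text \<open>The factor 8 comes from three doublings: \<open>Mul\<close> is avoided because it could
  square a register in one step.\<close>

definition addr :: "nat \<Rightarrow> nat \<Rightarrow> nat \<Rightarrow> instr list" where
  "addr b a i = [Add 2 i i, Add 2 2 2, Add 2 2 2, Const 3 (b + a), Add 2 2 3]"

primrec code :: "nat \<Rightarrow> com \<Rightarrow> nat \<Rightarrow> instr list" where
  "code b (CConst r v) = (\<lambda>p. [Const r v])"
| "code b (CAdd r x y) = (\<lambda>p. [Add r x y])"
| "code b (CSub r x y) = (\<lambda>p. [Sub r x y])"
| "code b (CDiv r x y) = (\<lambda>p. [Div r x y])"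
| "code b (CEdge r x y) = (\<lambda>p. [Edge r x y])"
| "code b (CLoad r a i) = (\<lambda>p. addr b a i @ [LoadI r 2])"
| "code b (CStore a i r) = (\<lambda>p. addr b a i @ [StoreI 2 r])"
| "code b (COut r) = (\<lambda>p. [Out r])"
| "code b (c ;; d) = (\<lambda>p. code b c p @ code b d (p + clen c))"
| "code b (CIf r c d) = (\<lambda>p. Jz r (p + clen c + 2) # code b c (p + 1)
     @ Jmp (p + clen c + clen d + 2) # code b d (p + clen c + 2))"
| "code b (CFor v c) = (\<lambda>p. [Const v 0, Sub 2 0 v, Jz 2 (p + clen c + 6)] @ code b c (p + 3)
     @ [Const 2 1, Add v v 2, Jmp (p + 1)])"

lemma length_addr [simp]: "length (addr b a i) = 5"
  by (simp add: addr_def)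

lemma length_code [simp]: "length (code b c p) = clen c"
  by (induction c arbitrary: p) (auto simp: addr_def)

lemma exec_var_frame: "x \<notin> wvars c \<Longrightarrow> exec E c s (V x) = s (V x)"
proof (induction c arbitrary: s)
  case (CFor v c)
  have "fold (\<lambda>i s. exec E c (s(V v := i))) is s (V x) = s (V x)" for "is" s
    using CFor by (induction "is" arbitrary: s) auto
  then show ?case using CFor by simp
qed auto

lemma exec_arr_frame: "a \<notin> warrs c \<Longrightarrow> exec E c s (A a i) = s (A a i)"
proof (induction c arbitrary: s)
  case (CFor v c)
  have "fold (\<lambda>i s. exec E c (s(V v := i))) is s (A a i) = s (A a i)" for "is" s
    using CFor by (induction "is" arbitrary: s) auto
  then show ?case by simp
qed auto

lemma wfc_wvars: "wfc b c \<Longrightarrow> x \<in> wvars c \<Longrightarrow> wok b x"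
  by (induction c) auto

text \<open>Counts machine steps. A loop round adds 5 instructions (test, jump, increment in two
  steps, jump back); the final 3 are the initialisation and the failing test. A conditional is
  charged for both branches.\<close>

fun bnd :: "com \<Rightarrow> nat \<Rightarrow> nat" where
  "bnd (CLoad r a i) n = 6"
| "bnd (CStore a i r) n = 6"
| "bnd (c ;; d) n = bnd c n + bnd d n"
| "bnd (CIf r c d) n = bnd c n + bnd d n + 2"
| "bnd (CFor v c) n = n * (bnd c n + 5) + 3"
| "bnd _ n = 1"

fun depth :: "com \<Rightarrow> nat" where
  "depth (c ;; d) = max (depth c) (depth d)"
| "depth (CIf r c d) = max (depth c) (depth d)"
| "depth (CFor v c) = Suc (depth c)"
| "depth _ = 0"

lemma bnd_poly: "\<exists>W. \<forall>n\<ge>1. bnd c n \<le> W * n ^ depth c"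
proof (induction c)
  case (CSeq c d)
  then obtain W1 W2 where W: "\<forall>n\<ge>1. bnd c n \<le> W1 * n ^ depth c" "\<forall>n\<ge>1. bnd d n \<le> W2 * n ^ depth d"
    by blast
  have "bnd (c ;; d) n \<le> (W1 + W2) * n ^ depth (c ;; d)" if "n \<ge> 1" for n
  proof -
    have "bnd c n \<le> W1 * n ^ max (depth c) (depth d)"
      using W(1) that by (meson le_trans max.cobounded1 mult_le_mono2 power_increasing)
    moreover have "bnd d n \<le> W2 * n ^ max (depth c) (depth d)"
      using W(2) that by (meson le_trans max.cobounded2 mult_le_mono2 power_increasing)
    ultimately show ?thesis by (simp add: algebra_simps)
  qed
  then show ?case by blast
next
  case (CIf r c d)
  then obtain W1 W2 where W: "\<forall>n\<ge>1. bnd c n \<le> W1 * n ^ depth c" "\<forall>n\<ge>1. bnd d n \<le> W2 * n ^ depth d"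
    by blast
  have "bnd (CIf r c d) n \<le> (W1 + W2 + 2) * n ^ depth (CIf r c d)" if "n \<ge> 1" for n
  proof -
    have "bnd c n \<le> W1 * n ^ max (depth c) (depth d)"
      using W(1) that by (meson le_trans max.cobounded1 mult_le_mono2 power_increasing)
    moreover have "bnd d n \<le> W2 * n ^ max (depth c) (depth d)"
      using W(2) that by (meson le_trans max.cobounded2 mult_le_mono2 power_increasing)
    moreover have "1 \<le> n ^ max (depth c) (depth d)" using that by simp
    ultimately show ?thesis by (simp add: algebra_simps)
  qed
  then show ?case by blast
next
  case (CFor v c)
  then obtain W where W: "\<forall>n\<ge>1. bnd c n \<le> W * n ^ depth c"
    by blast
  have "bnd (CFor v c) n \<le> (W + 8) * n ^ depth (CFor v c)" if "n \<ge> 1" for n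
  proof -
    have 1: "1 \<le> n ^ depth c" using that by simp
    then have "bnd c n + 5 \<le> (W + 5) * n ^ depth c"
      using W[rule_format, OF that] mult_le_mono2[OF 1, of 5] by (simp add: algebra_simps)
    then have "n * (bnd c n + 5) \<le> (W + 5) * (n * n ^ depth c)"
      by (metis mult.left_commute mult_le_mono2)
    moreover have "3 \<le> 3 * (n * n ^ depth c)" using that 1 by simp
    ultimately have "n * (bnd c n + 5) + 3 \<le> (W + 5) * (n * n ^ depth c) + 3 * (n * n ^ depth c)"
      by (rule add_mono)
    then show ?thesis by (simp add: algebra_simps)
  qed
  then show ?case by blast
qed (auto intro: exI[of _ 6])

section \<open>Simulation of structured programs by the machine\<close>

definition seg :: "instr list \<Rightarrow> nat \<Rightarrow> instr list \<Rightarrow> bool" where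
  "seg P p xs \<longleftrightarrow> (\<exists>pre post. P = pre @ xs @ post \<and> length pre = p)"

lemma seg_Cons: "seg P p (x # xs) \<Longrightarrow> p < length P \<and> P ! p = x \<and> seg P (Suc p) xs"
proof -
  assume "seg P p (x # xs)"
  then obtain pre post where P: "P = pre @ (x # xs) @ post" "length pre = p"
    unfolding seg_def by blast
  have "P = (pre @ [x]) @ xs @ post" "length (pre @ [x]) = Suc p" using P by auto
  then have "seg P (Suc p) xs" unfolding seg_def by blast
  then show ?thesis using P by auto
qed

lemma seg_append: "seg P p (xs @ ys) \<Longrightarrow> seg P p xs \<and> seg P (p + length xs) ys"
  unfolding seg_def by (metis append.assoc length_append)

definition rel :: "nat \<Rightarrow> (nat \<Rightarrow> nat) \<Rightarrow> (loc \<Rightarrow> nat) \<Rightarrow> bool" where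
  "rel b R s \<longleftrightarrow> (\<forall>x. vok b x \<longrightarrow> R x = s (V x)) \<and> (\<forall>a<8. \<forall>i. R (b + 8 * i + a) = s (A a i))"

lemma rel_var: "rel b R s \<Longrightarrow> vok b x \<Longrightarrow> R x = s (V x)"
  by (simp add: rel_def)

lemma rel_upd: "rel b R s \<Longrightarrow> wok b x \<Longrightarrow> rel b (R(x := v)) (s(V x := v))"
  by (auto simp: rel_def wok_def vok_def)

lemma rel_tmp: "rel b R s \<Longrightarrow> 4 \<le> b \<Longrightarrow> x = 2 \<or> x = 3 \<Longrightarrow> rel b (R(x := v)) s"
  by (auto simp: rel_def vok_def)

lemma cell_inj: "a < 8 \<Longrightarrow> a' < 8 \<Longrightarrow> 8 * i + a = 8 * i' + a' \<Longrightarrow> i = i' \<and> a = (a'::nat)"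
  by presburger

lemma rel_arr: 
  assumes "rel b R s" "a < 8" shows "rel b (R(b + 8 * i + a := v)) (s(A a i := v))"
proof -
  have "i' = i \<and> a' = a" if "a' < 8" "b + 8 * i' + a' = b + 8 * i + a" for i' a'
    using that assms(2) cell_inj[of a' a i' i] by simp
  then show ?thesis
    using assms unfolding rel_def vok_def by (auto simp: fun_upd_apply)
qed

definition reach :: "instr list \<Rightarrow> (nat \<times> nat) set \<Rightarrow> config \<Rightarrow> nat \<Rightarrow> config \<Rightarrow> bool" where
  "reach P E cf m cf' \<longleftrightarrow> (\<exists>m'\<le>m. (step P E ^^ m') cf = cf')"

lemma reach_refl: "reach P E cf 0 cf"
  by (simp add: reach_def)

lemma reach_trans:
  assumes "reach P E cf m cf'" "reach P E cf' m' cf''" shows "reach P E cf (m + m') cf''"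
proof -
  obtain a b where "a \<le> m" "(step P E ^^ a) cf = cf'" "b \<le> m'" "(step P E ^^ b) cf' = cf''"
    using assms by (auto simp: reach_def)
  then show ?thesis
    unfolding reach_def by (intro exI[of _ "b + a"]) (auto simp: funpow_add)
qed

lemma reach_mono: "reach P E cf m cf' \<Longrightarrow> m \<le> m' \<Longrightarrow> reach P E cf m' cf'"
  unfolding reach_def using le_trans by blast

lemma reach_step: "step P E cf = cf1 \<Longrightarrow> reach P E cf1 m cf' \<Longrightarrow> reach P E cf (Suc m) cf'"
  unfolding reach_def by (metis Suc_le_mono comp_apply funpow_Suc_right)

text \<open>The cost component is left unconstrained: cost is bounded later from the number of steps
  alone, so the simulation only counts steps.\<close>

definition sim :: "nat \<Rightarrow> instr list \<Rightarrow> (nat \<times> nat) set \<Rightarrow> nat \<Rightarrow> (nat \<Rightarrow> nat) \<Rightarrow> nat set \<Rightarrow> nat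
    \<Rightarrow> nat \<Rightarrow> nat \<Rightarrow> (loc \<Rightarrow> nat) \<Rightarrow> nat set \<Rightarrow> bool" where
  "sim b P E p R Y q m p' s' Y' \<longleftrightarrow>
     (\<exists>R' q'. reach P E (Cfg p R Y q) m (Cfg p' R' Y' q') \<and> rel b R' s')"

lemma sim_refl: "rel b R s \<Longrightarrow> sim b P E p R Y q 0 p s Y"
  unfolding sim_def using reach_refl by blast

lemma sim_step:
  "step P E (Cfg p R Y q) = Cfg p1 R1 Y1 q1 \<Longrightarrow> sim b P E p1 R1 Y1 q1 m p' s' Y'
    \<Longrightarrow> sim b P E p R Y q (Suc m) p' s' Y'"
  unfolding sim_def using reach_step by blast

lemma sim_step1:
  "step P E (Cfg p R Y q) = Cfg p1 R1 Y1 q1 \<Longrightarrow> rel b R1 s1 \<Longrightarrow> sim b P E p R Y q (Suc 0) p1 s1 Y1"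
  by (rule sim_step[OF _ sim_refl])

lemma sim_mono: "sim b P E p R Y q m p' s' Y' \<Longrightarrow> m \<le> m' \<Longrightarrow> sim b P E p R Y q m' p' s' Y'"
  unfolding sim_def using reach_mono by blast

lemma sim_trans:
  "sim b P E p R Y q m p1 s1 Y1 \<Longrightarrow> (\<And>R1 q1. rel b R1 s1 \<Longrightarrow> sim b P E p1 R1 Y1 q1 m' p' s' Y')
    \<Longrightarrow> sim b P E p R Y q (m + m') p' s' Y'"
  unfolding sim_def using reach_trans by meson

lemma sim_addr:
  assumes "seg P p (addr b a i)" "rel b R s" "4 \<le> b" "vok b i" "a < 8"
  shows "\<exists>R' q'. reach P E (Cfg p R Y q) 5 (Cfg (p + 5) R' Y q') \<and> rel b R' s
            \<and> R' 2 = b + 8 * s (V i) + a"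
proof -
  have c: "p < length P \<and> P ! p = Add 2 i i"
    "Suc p < length P \<and> P ! Suc p = Add 2 2 2"
    "Suc (Suc p) < length P \<and> P ! Suc (Suc p) = Add 2 2 2"
    "Suc (Suc (Suc p)) < length P \<and> P ! Suc (Suc (Suc p)) = Const 3 (b + a)"
    "Suc (Suc (Suc (Suc p))) < length P \<and> P ! Suc (Suc (Suc (Suc p))) = Add 2 2 3"
    using assms(1) unfolding addr_def by (auto dest!: seg_Cons)
  have i: "R i = s (V i)" "i \<noteq> 2" "i \<noteq> 3" using assms by (auto simp: rel_def vok_def)
  define R' where "R' = R(3 := b + a, 2 := b + 8 * s (V i) + a)"
  have "rel b R' s" unfolding R'_def using assms by (intro rel_tmp) auto
  moreover have "\<exists>q'. (step P E ^^ 5) (Cfg p R Y q) = Cfg (p + 5) R' Y q'"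
    using c i by (simp add: eval_nat_numeral R'_def fun_eq_iff)
  moreover have "R' 2 = b + 8 * s (V i) + a" by (simp add: R'_def)
  ultimately show ?thesis unfolding reach_def by blast
qed

text \<open>Induction on the command. No command writes register 0, so the step bound can be stated
  with the initial \<open>s (V 0)\<close>; the loop case needs an inner induction on the number of
  remaining rounds.\<close>

lemma compile_correct:
  assumes "seg P p (code b c p)" "wfc b c" "rel b R s" "4 \<le> b"
  shows "sim b P E p R Y q (bnd c (s (V 0))) (p + clen c) (exec E c s) (Y \<union> outs E c s)"
  using assms
proof (induction c arbitrary: p R s Y q)
  case (CConst r v)
  then have *: "p < length P" "P ! p = Const r v"
    using seg_Cons[of P p "Const r v" "[]"] rel_var[of b R s] by simp_all
  have "rel b (R(r := v)) (s(V r := v))"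
    using CConst.prems by (auto intro: rel_upd)
  moreover have "step P E (Cfg p R Y q) = Cfg (Suc p) (R(r := v)) Y (q + 1 + nbits v)"
    using * by simp
  ultimately show ?case
    unfolding exec.simps outs.simps bnd.simps clen.simps Un_empty_right One_nat_def add_Suc_right add_0_right
    by (rule sim_step1[rotated])
next
  case (CAdd r x y)
  then have *: "p < length P" "P ! p = Add r x y" "R x = s (V x)" "R y = s (V y)"
    using seg_Cons[of P p "Add r x y" "[]"] rel_var[of b R s] by simp_all
  have "rel b (R(r := s (V x) + s (V y))) (s(V r := s (V x) + s (V y)))"
    using CAdd.prems by (auto intro: rel_upd)
  moreover have "step P E (Cfg p R Y q) = Cfg (Suc p) (R(r := s (V x) + s (V y))) Y (q + 1 + nbits (s (V x)) + nbits (s (V y)))"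
    using * by simp
  ultimately show ?case
    unfolding exec.simps outs.simps bnd.simps clen.simps Un_empty_right One_nat_def add_Suc_right add_0_right
    by (rule sim_step1[rotated])
next
  case (CSub r x y)
  then have *: "p < length P" "P ! p = Sub r x y" "R x = s (V x)" "R y = s (V y)"
    using seg_Cons[of P p "Sub r x y" "[]"] rel_var[of b R s] by simp_all
  have "rel b (R(r := s (V x) - s (V y))) (s(V r := s (V x) - s (V y)))"
    using CSub.prems by (auto intro: rel_upd)
  moreover have "step P E (Cfg p R Y q) = Cfg (Suc p) (R(r := s (V x) - s (V y))) Y (q + 1 + nbits (s (V x)) + nbits (s (V y)))"
    using * by simp
  ultimately show ?case
    unfolding exec.simps outs.simps bnd.simps clen.simps Un_empty_right One_nat_def add_Suc_right add_0_right
    by (rule sim_step1[rotated])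
next
  case (CDiv r x y)
  then have *: "p < length P" "P ! p = Div r x y" "R x = s (V x)" "R y = s (V y)"
    using seg_Cons[of P p "Div r x y" "[]"] rel_var[of b R s] by simp_all
  have "rel b (R(r := s (V x) div s (V y))) (s(V r := s (V x) div s (V y)))"
    using CDiv.prems by (auto intro: rel_upd)
  moreover have "step P E (Cfg p R Y q) = Cfg (Suc p) (R(r := s (V x) div s (V y))) Y (q + 1 + nbits (s (V x)) + nbits (s (V y)))"
    using * by simp
  ultimately show ?case
    unfolding exec.simps outs.simps bnd.simps clen.simps Un_empty_right One_nat_def add_Suc_right add_0_right
    by (rule sim_step1[rotated])
next
  case (CEdge r x y)
  then have *: "p < length P" "P ! p = Edge r x y" "R x = s (V x)" "R y = s (V y)"
    using seg_Cons[of P p "Edge r x y" "[]"] rel_var[of b R s] by simp_all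
  have "rel b (R(r := if adj E (s (V x)) (s (V y)) then 1 else 0)) (s(V r := if adj E (s (V x)) (s (V y)) then 1 else 0))"
    using CEdge.prems by (auto intro: rel_upd)
  moreover have "step P E (Cfg p R Y q) = Cfg (Suc p) (R(r := if adj E (s (V x)) (s (V y)) then 1 else 0)) Y (q + 1 + nbits (s (V x)) + nbits (s (V y)))"
    using * by simp
  ultimately show ?case
    unfolding exec.simps outs.simps bnd.simps clen.simps Un_empty_right One_nat_def add_Suc_right add_0_right
    by (rule sim_step1[rotated])
next
  case (COut r)
  then have *: "p < length P" "P ! p = Out r" "R r = s (V r)"
    using seg_Cons[of P p "Out r" "[]"] rel_var[of b R s] by simp_all
  with COut.prems show ?case by (auto intro!: sim_step1)
next
  case (CLoad r a i)
  have sg: "seg P p (addr b a i)" "seg P (p + 5) [LoadI r 2]"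
    using seg_append[of P p "addr b a i" "[LoadI r 2]"] CLoad.prems(1) by simp_all
  obtain R' q' where R': "reach P E (Cfg p R Y q) 5 (Cfg (p + 5) R' Y q')" "rel b R' s"
      "R' 2 = b + 8 * s (V i) + a"
    using sim_addr[OF sg(1)] CLoad.prems by fastforce
  have cell: "R' (b + 8 * s (V i) + a) = s (A a (s (V i)))" using R' CLoad.prems by (auto simp: rel_def)
  have r1: "rel b (R'(r := s (A a (s (V i))))) (s(V r := s (A a (s (V i)))))"
    using rel_upd CLoad.prems R'(2) by simp
  have "step P E (Cfg (p + 5) R' Y q') = Cfg (p + 6) (R'(r := s (A a (s (V i))))) Y (q' + 1 + nbits (R' 2) + nbits (R' (R' 2)))"
    using seg_Cons[OF sg(2)] R'(3) cell by simp
  then have "sim b P E (p + 5) R' Y q' (Suc 0) (p + 6) (s(V r := s (A a (s (V i))))) Y"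
    using r1 by (rule sim_step1)
  then obtain R'' q'' where R'': "reach P E (Cfg (p + 5) R' Y q') (Suc 0) (Cfg (p + 6) R'' Y q'')"
      "rel b R'' (s(V r := s (A a (s (V i)))))"
    unfolding sim_def by blast
  show ?case
    using reach_trans[OF R'(1) R''(1)] R''(2)
    unfolding sim_def exec.simps outs.simps bnd.simps clen.simps Un_empty_right by auto
next
  case (CStore a i r)
  have sg: "seg P p (addr b a i)" "seg P (p + 5) [StoreI 2 r]"
    using seg_append[of P p "addr b a i" "[StoreI 2 r]"] CStore.prems(1) by simp_all
  obtain R' q' where R': "reach P E (Cfg p R Y q) 5 (Cfg (p + 5) R' Y q')" "rel b R' s"
      "R' 2 = b + 8 * s (V i) + a"
    using sim_addr[OF sg(1)] CStore.prems by fastforce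
  have cell: "R' r = s (V r)" using R' CStore.prems by (auto simp: rel_def)
  have r1: "rel b (R'(b + 8 * s (V i) + a := s (V r))) (s(A a (s (V i)) := s (V r)))"
    using rel_arr CStore.prems R'(2) by simp
  have "step P E (Cfg (p + 5) R' Y q') = Cfg (p + 6) (R'(b + 8 * s (V i) + a := s (V r))) Y (q' + 1 + nbits (R' 2) + nbits (R' r))"
    using seg_Cons[OF sg(2)] R'(3) cell by simp
  then have "sim b P E (p + 5) R' Y q' (Suc 0) (p + 6) (s(A a (s (V i)) := s (V r))) Y"
    using r1 by (rule sim_step1)
  then obtain R'' q'' where R'': "reach P E (Cfg (p + 5) R' Y q') (Suc 0) (Cfg (p + 6) R'' Y q'')"
      "rel b R'' (s(A a (s (V i)) := s (V r)))"
    unfolding sim_def by blast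
  show ?case
    using reach_trans[OF R'(1) R''(1)] R''(2)
    unfolding sim_def exec.simps outs.simps bnd.simps clen.simps Un_empty_right by auto
next
  case (CSeq c d)
  have sg: "seg P p (code b c p)" "seg P (p + clen c) (code b d (p + clen c))"
    using seg_append[of P p "code b c p"] CSeq.prems(1) by auto
  have w: "wfc b c" "wfc b d" using CSeq.prems by auto
  have n: "exec E c s (V 0) = s (V 0)"
    using wfc_wvars[OF w(1), of 0] by (intro exec_var_frame) (auto simp: wok_def)
  have d: "sim b P E (p + clen c) R1 (Y \<union> outs E c s) q1 (bnd d (s (V 0))) (p + clen c + clen d)
      (exec E d (exec E c s)) (Y \<union> outs E c s \<union> outs E d (exec E c s))"
    if "rel b R1 (exec E c s)" for R1 q1
    using CSeq.IH(2)[OF sg(2) w(2) that CSeq.prems(4)] by (simp add: n)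
  show ?case
    using sim_trans[OF CSeq.IH(1)[OF sg(1) w(1) CSeq.prems(3,4)] d]
    by (simp add: add.assoc Un_assoc)
next
  case (CIf r c d)
  have sg0: "p < length P \<and> P ! p = Jz r (p + clen c + 2)"
    "seg P (Suc p) (code b c (p + 1) @ Jmp (p + clen c + clen d + 2) # code b d (p + clen c + 2))"
    using CIf.prems(1) by (auto dest!: seg_Cons)
  have sg: "seg P (p + 1) (code b c (p + 1))"
    "seg P (p + clen c + 1) (Jmp (p + clen c + clen d + 2) # code b d (p + clen c + 2))"
    using seg_append[OF sg0(2)] by (auto simp: add_ac)
  have sg2: "p + clen c + 1 < length P" "P ! (p + clen c + 1) = Jmp (p + clen c + clen d + 2)"
    "seg P (p + clen c + 2) (code b d (p + clen c + 2))"
    using seg_Cons[OF sg(2)] by auto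
  have w: "wfc b c" "wfc b d" and r: "R r = s (V r)" using CIf.prems by (auto simp: rel_def)
  show ?case
  proof (cases "s (V r) = 0")
    case True
    have "step P E (Cfg p R Y q) = Cfg (p + clen c + 2) R Y (q + 1 + nbits (s (V r)))"
      using sg0(1) r True by simp
    from sim_step[OF this CIf.IH(2)[OF sg2(3) w(2) CIf.prems(3,4)]]
    have "sim b P E p R Y q (Suc (bnd d (s (V 0)))) (p + clen c + 2 + clen d) (exec E d s) (Y \<union> outs E d s)" .
    then show ?thesis using True by (auto elim!: sim_mono simp: add_ac)
  next
    case False
    have st: "step P E (Cfg p R Y q) = Cfg (p + 1) R Y (q + 1 + nbits (s (V r)))"
      using sg0(1) r False by simp
    have j: "sim b P E (p + 1 + clen c) R1 Y1 q1 1 (p + clen c + clen d + 2) (exec E c s) Y1"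
      if "rel b R1 (exec E c s)" for R1 Y1 q1
    proof -
      have "step P E (Cfg (p + 1 + clen c) R1 Y1 q1) = Cfg (p + clen c + clen d + 2) R1 Y1 (q1 + 1)"
        using sg2(1,2) by (simp add: add_ac)
      from sim_step1[OF this that] show ?thesis by simp
    qed
    have "sim b P E p R Y q (Suc (bnd c (s (V 0)) + 1)) (p + clen c + clen d + 2) (exec E c s) (Y \<union> outs E c s)"
      by (rule sim_step[OF st sim_trans[OF CIf.IH(1)[OF sg(1) w(1) CIf.prems(3,4)] j]])
    then show ?thesis using False by (auto elim!: sim_mono simp: add_ac)
  qed
next
  case (CFor v c)
  define f where "f = (\<lambda>i s. exec E c (s(V v := i)))"
  define n where "n = s (V 0)"
  define e where "e = p + clen c + 6"
  have sg0: "p < length P \<and> P ! p = Const v 0" "Suc p < length P \<and> P ! Suc p = Sub 2 0 v"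
    "Suc (Suc p) < length P \<and> P ! Suc (Suc p) = Jz 2 e"
    "seg P (Suc (Suc (Suc p))) (code b c (p + 3) @ [Const 2 1, Add v v 2, Jmp (p + 1)])"
    using CFor.prems(1) by (auto dest!: seg_Cons simp: e_def)
  have sg: "seg P (p + 3) (code b c (p + 3))" "seg P (p + 3 + clen c) [Const 2 1, Add v v 2, Jmp (p + 1)]"
    using seg_append[OF sg0(4)] by (auto simp: eval_nat_numeral)
  have sg1: "p + 3 + clen c < length P \<and> P ! (p + 3 + clen c) = Const 2 1"
    "Suc (p + 3 + clen c) < length P \<and> P ! Suc (p + 3 + clen c) = Add v v 2"
    "Suc (Suc (p + 3 + clen c)) < length P \<and> P ! Suc (Suc (p + 3 + clen c)) = Jmp (p + 1)"
    using sg(2) by (auto dest!: seg_Cons)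
  have w: "wfc b c" "wok b v" "v \<notin> wvars c" and b: "4 \<le> b" using CFor.prems by auto
  have v: "v \<noteq> 0" "v \<noteq> 2" "v \<noteq> 3" "vok b v" "vok b 0" using w b by (auto simp: wok_def vok_def)
  have n0: "0 \<notin> wvars c" using wfc_wvars[OF w(1), of 0] by (auto simp: wok_def)
  have fn: "f i s (V 0) = s (V 0)" "f i s (V v) = i" for i s
    unfolding f_def using n0 w v by (auto simp: exec_var_frame)
  define S where "S i = fold f [0..<i] s" for i
  have S0: "S i (V 0) = n" for i
    by (induction i) (auto simp: S_def n_def fn)
  have SS: "S (Suc i) = exec E c ((S i)(V v := i))" for i by (simp add: S_def f_def)
  \<comment> \<open>Entry is at the loop test, just after the initialisation. The bound counts the
    remaining rounds plus the two instructions of the failing test.\<close>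
  have loop: "sim b P E (p + 1) R Y q (n * (bnd c n + 5) - i * (bnd c n + 5) + 2) e ((S n)(V v := n)) Y'"
    if "i \<le> n" "rel b R ((S i)(V v := i))" "Y' = Y \<union> (\<Union>j\<in>{i..<n}. outs E c ((S j)(V v := j)))" for i R Y q Y'
    using that
  proof (induction "n - i" arbitrary: i R Y q Y')
    case 0
    then have "i = n" by simp
    have R: "R 0 = n" "R v = n" using 0 v \<open>i = n\<close> S0 by (auto simp: rel_def)
    have A: "sim b P E (p + 1) R Y q 2 e ((S n)(V v := n)) Y"
    proof -
      have s1: "step P E (Cfg (p + 1) R Y q) = Cfg (Suc (Suc p)) (R(2 := 0)) Y (q + 1 + nbits n + nbits n)"
        using R sg0 by simp
      have s2: "step P E (Cfg (Suc (Suc p)) (R(2 := 0)) Y q1) = Cfg e (R(2 := 0)) Y (q1 + 1 + nbits 0)" for q1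
        using sg0 by simp
      have "rel b (R(2 := 0)) ((S n)(V v := n))" using rel_tmp[OF 0(3) b] \<open>i = n\<close> by blast
      from sim_step[OF s1 sim_step1[OF s2 this]] show ?thesis by (simp add: eval_nat_numeral)
    qed
    have "Y' = Y" using 0 \<open>i = n\<close> by simp
    show ?case unfolding \<open>Y' = Y\<close> by (rule sim_mono[OF A]) simp
  next
    case (Suc d)
    then have "i < n" by simp
    have R: "R 0 = n" "R v = i" using Suc.prems v S0 by (auto simp: rel_def)
    have st: "step P E (Cfg (p + 1) R Y q) = Cfg (p + 2) (R(2 := n - i)) Y (q + 1 + nbits n + nbits i)"
      using R sg0 by (simp add: eval_nat_numeral)
    have st2: "step P E (Cfg (p + 2) (R(2 := n - i)) Y (q + 1 + nbits n + nbits i))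
       = Cfg (p + 3) (R(2 := n - i)) Y (q + 1 + nbits n + nbits i + 1 + nbits (n - i))"
      using R sg0 \<open>i < n\<close> by (simp add: eval_nat_numeral)
    have r1: "rel b (R(2 := n - i)) ((S i)(V v := i))" using rel_tmp[OF Suc.prems(2) b] by blast
    define Y1 where "Y1 = Y \<union> outs E c ((S i)(V v := i))"
    have b0: "((S i)(V v := i)) (V 0) = n" using S0 v by simp
    have body: "sim b P E (p + 3) (R(2 := n - i)) Y q' (bnd c n) (p + 3 + clen c) (S (Suc i)) Y1" for q'
      using CFor.IH[OF sg(1) w(1) r1 b, of Y q'] by (simp only: SS Y1_def b0)
    have tl: "sim b P E (p + 3 + clen c) R1 Y1 q1 (3 + (n * (bnd c n + 5) - Suc i * (bnd c n + 5) + 2)) e ((S n)(V v := n)) Y'"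
      if "rel b R1 (S (Suc i))" for R1 q1
    proof -
      have "R1 v = S (Suc i) (V v)" using that v by (auto simp: rel_def)
      also have "\<dots> = i" using fn(2) by (simp add: S_def)
      finally have Rv: "R1 v = i" .
      have r2: "rel b (R1(2 := 1, v := Suc i)) ((S (Suc i))(V v := Suc i))"
        using that w b by (intro rel_upd rel_tmp) auto
      have Y': "Y' = Y1 \<union> (\<Union>j\<in>{Suc i..<n}. outs E c ((S j)(V v := j)))"
      proof -
        have "{i..<n} = insert i {Suc i..<n}" using \<open>i < n\<close> by auto
        then show ?thesis unfolding Suc.prems(3) Y1_def by (simp add: Un_assoc)
      qed
      have "sim b P E (p + 1) (R1(2 := 1, v := Suc i)) Y1 q' (n * (bnd c n + 5) - Suc i * (bnd c n + 5) + 2) e ((S n)(V v := n)) Y'" for q'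
        by (rule Suc.hyps(1)[OF _ _ r2 Y']) (use Suc.hyps(2) \<open>i < n\<close> in auto)
      note it = this
      have s1: "step P E (Cfg (p + 3 + clen c) R1 Y1 q1) = Cfg (Suc (p + 3 + clen c)) (R1(2 := 1)) Y1 (q1 + 1 + nbits 1)"
        using sg1 by simp
      have s2: "step P E (Cfg (Suc (p + 3 + clen c)) (R1(2 := 1)) Y1 q2) = Cfg (Suc (Suc (p + 3 + clen c))) (R1(2 := 1, v := Suc i)) Y1 (q2 + 1 + nbits i + nbits 1)" for q2
        using sg1 v Rv by simp
      have s3: "step P E (Cfg (Suc (Suc (p + 3 + clen c))) (R1(2 := 1, v := Suc i)) Y1 q2) = Cfg (p + 1) (R1(2 := 1, v := Suc i)) Y1 (q2 + 1)" for q2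
        using sg1 by simp
      show ?thesis
        using sim_step[OF s1 sim_step[OF s2 sim_step[OF s3 it]]]
        by (simp add: eval_nat_numeral)
    qed
    have "sim b P E (p + 1) R Y q (Suc (Suc (bnd c n + (3 + (n * (bnd c n + 5) - Suc i * (bnd c n + 5) + 2))))) e ((S n)(V v := n)) Y'"
      by (rule sim_step[OF st sim_step[OF st2 sim_trans[OF body tl]]])
    moreover have "Suc (Suc (bnd c n + (3 + (n * (bnd c n + 5) - Suc i * (bnd c n + 5) + 2))))
       \<le> n * (bnd c n + 5) - i * (bnd c n + 5) + 2"
    proof -
      have "Suc i * (bnd c n + 5) \<le> n * (bnd c n + 5)" using \<open>i < n\<close> by (intro mult_le_mono1) auto
      then show ?thesis by simp
    qed
    ultimately show ?case by (rule sim_mono)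
  qed
  have r0: "rel b (R(v := 0)) ((S 0)(V v := 0))"
    using rel_upd[OF CFor.prems(3) w(2), of 0] unfolding S_def by simp
  have "sim b P E p R Y q (Suc (n * (bnd c n + 5) - 0 * (bnd c n + 5) + 2)) e ((S n)(V v := n)) (Y \<union> (\<Union>j\<in>{0..<n}. outs E c ((S j)(V v := j))))"
    by (rule sim_step[OF _ loop[OF _ r0]]) (use sg0 in auto)
  then show ?case
    unfolding exec.simps outs.simps bnd.simps clen.simps e_def S_def f_def n_def lessThan_atLeast0 add.assoc
    by (rule sim_mono) simp
qed

section \<open>Cost of compiled programs\<close>

text \<open>\<open>m\<close> caps the literals of the code. With \<open>Mul\<close> excluded, a
  common bound \<open>B\<close> on all registers, at least \<open>m\<close> and 1, becomes at most
  \<open>2 * B\<close> after one step.\<close>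

fun tame :: "nat \<Rightarrow> instr \<Rightarrow> bool" where
  "tame m (Const r v) \<longleftrightarrow> v \<le> m"
| "tame m (Mul r a b) \<longleftrightarrow> False"
| "tame m _ \<longleftrightarrow> True"

lemma nbits_mono: "x \<le> y \<Longrightarrow> nbits x \<le> nbits y"
proof (induction y arbitrary: x rule: less_induct)
  case (less y)
  show ?case
  proof (cases "x < 2")
    case True
    then have "nbits x = 1" by (simp add: nbits.simps)
    moreover have "1 \<le> nbits y" by (subst nbits.simps) simp
    ultimately show ?thesis by simp
  next
    case False
    then have "nbits (x div 2) \<le> nbits (y div 2)" using less by (intro less.IH) auto
    moreover have "nbits x = Suc (nbits (x div 2))" "nbits y = Suc (nbits (y div 2))"
      using False less.prems by (subst nbits.simps; simp)+
    ultimately show ?thesis by simp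
  qed
qed

lemma nbits_double: "nbits (2 * x) \<le> Suc (nbits x)"
  by (cases "x = 0") (simp_all add: nbits.simps[of 0] nbits.simps[of "2 * x"])

lemma nbits_shift: "nbits (x * 2 ^ m) \<le> nbits x + m"
proof (induction m)
  case (Suc m)
  have "nbits (x * 2 ^ Suc m) = nbits (2 * (x * 2 ^ m))" by (simp add: mult_ac)
  also have "\<dots> \<le> Suc (nbits (x * 2 ^ m))" by (rule nbits_double)
  finally show ?case using Suc by simp
qed simp

lemma nbits_le: "nbits x \<le> Suc x"
proof (induction x rule: less_induct)
  case (less x)
  show ?case
  proof (cases "x < 2")
    case False
    then have "nbits (x div 2) \<le> Suc (x div 2)" by (intro less.IH) auto
    then show ?thesis using False by (subst nbits.simps) auto
  qed (simp add: nbits.simps)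
qed

lemma step_tame:
  assumes P: "\<forall>ins\<in>set P. tame m ins" and m: "1 \<le> m" "m \<le> B" and R: "\<And>r. R r \<le> B"
    and st: "step P E (Cfg p R Y q) = Cfg p' R' Y' q'"
  shows "R' r \<le> 2 * B \<and> q' \<le> q + 1 + 2 * nbits B"
proof (cases "length P \<le> p")
  case True
  then show ?thesis using st R[of r] by simp
next
  case False
  then have t: "tame m (P ! p)" using P by simp
  have nb: "nbits (R x) \<le> nbits B" for x using R by (rule nbits_mono)
  have nm: "v \<le> m \<Longrightarrow> nbits v \<le> nbits B" for v using m by (intro nbits_mono) simp
  have R2: "R x \<le> 2 * B" for x using R[of x] by simp
  have Rs: "R x + R y \<le> 2 * B" for x y using R[of x] R[of y] by simp
  have Rd: "R x - R y \<le> 2 * B" "R x div R y \<le> 2 * B" for x y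
    using R2[of x] div_le_dividend[of "R x" "R y"] by linarith+
  have c2: "nbits (R x) + nbits (R y) \<le> 2 * nbits B" for x y using nb[of x] nb[of y] by simp
  have c1: "nbits (R x) \<le> 2 * nbits B" for x using nb[of x] by simp
  show ?thesis
  proof (cases "P ! p")
    case (Const a v)
    then have "v \<le> m" using t by simp
    then have "nbits v \<le> nbits B" "v \<le> 2 * B" using nm m by auto
    then show ?thesis using st False Const R2[of r] by (auto simp: fun_upd_apply split: if_splits)
  next
    case (Add a x y)
    then show ?thesis using st False R2[of r] Rs[of x y] c2[of x y] by (auto simp: fun_upd_apply)
  next
    case (Sub a x y)
    then show ?thesis using st False R2[of r] Rd[of x y] c2[of x y] by (auto simp: fun_upd_apply)
  next
    case (Mul a x y)
    then show ?thesis using t by simp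
  next
    case (Div a x y)
    then show ?thesis using st False R2[of r] Rd[of x y] c2[of x y] by (auto simp: fun_upd_apply)
  next
    case (Jz a l)
    then show ?thesis using st False R2[of r] c1[of a] by auto
  next
    case (Jmp l)
    then show ?thesis using st False R2[of r] by auto
  next
    case (LoadI a x)
    then show ?thesis using st False R2[of r] R2[of "R x"] c2[of x "R x"] by (auto simp: fun_upd_apply)
  next
    case (StoreI x y)
    then show ?thesis using st False R2[of r] R2[of y] c2[of x y] by (auto simp: fun_upd_apply)
  next
    case (Edge a x y)
    then show ?thesis using st False R2[of r] c2[of x y] m by (auto simp: fun_upd_apply)
  next
    case (Out a)
    then show ?thesis using st False R2[of r] c1[of a] by auto
  next
    case Halt
    then show ?thesis using st False R2[of r] by auto
  qed
qed

lemma run_tame: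
  assumes P: "\<forall>ins\<in>set P. tame m ins" and m: "1 \<le> m" and R: "\<And>r. R r \<le> m"
    and st: "(step P E ^^ t) (Cfg p R Y 0) = Cfg p' R' Y' q'"
  shows "(\<forall>r. R' r \<le> m * 2 ^ t) \<and> q' \<le> t * (1 + 2 * (nbits m + t))"
  using st
proof (induction t arbitrary: p' R' Y' q')
  case 0
  then show ?case using R by simp
next
  case (Suc t)
  obtain p1 R1 Y1 q1 where c1: "(step P E ^^ t) (Cfg p R Y 0) = Cfg p1 R1 Y1 q1"
    by (metis config.exhaust)
  note IH = Suc.IH[OF c1]
  have st: "step P E (Cfg p1 R1 Y1 q1) = Cfg p' R' Y' q'" using Suc.prems c1 by simp
  have mB: "m \<le> m * 2 ^ t" by simp
  have "R' r \<le> 2 * (m * 2 ^ t) \<and> q' \<le> q1 + 1 + 2 * nbits (m * 2 ^ t)" for r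
    by (rule step_tame[OF P m mB _ st]) (use IH in simp)
  then have a: "R' r \<le> 2 * (m * 2 ^ t)" "q' \<le> q1 + 1 + 2 * nbits (m * 2 ^ t)" for r by blast+
  have "q' \<le> t * (1 + 2 * (nbits m + t)) + (1 + 2 * (nbits m + t))"
  proof -
    have "q' \<le> q1 + (1 + 2 * (nbits m + t))" using a(2) nbits_shift[of m t] by simp
    also have "\<dots> \<le> t * (1 + 2 * (nbits m + t)) + (1 + 2 * (nbits m + t))"
      using IH by (intro add_right_mono) blast
    finally show ?thesis .
  qed
  also have "\<dots> = Suc t * (1 + 2 * (nbits m + t))" by simp
  also have "\<dots> \<le> Suc t * (1 + 2 * (nbits m + Suc t))" by (intro mult_le_mono2) simp
  finally show ?case using a(1) by (simp add: mult_ac)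
qed

fun nomul :: "instr \<Rightarrow> bool" where
  "nomul (Mul r a b) \<longleftrightarrow> False"
| "nomul _ \<longleftrightarrow> True"

lemma nomul_code: "ins \<in> set (code b c p) \<Longrightarrow> nomul ins"
  by (induction c arbitrary: p) (auto simp: addr_def)

lemma tame_mono: "tame m ins \<Longrightarrow> m \<le> m' \<Longrightarrow> tame m' ins"
  by (cases ins) auto

lemma exists_tame:
  assumes "\<forall>ins\<in>set P. nomul ins" shows "\<exists>m. \<forall>ins\<in>set P. tame m ins"
  using assms
proof (induction P)
  case (Cons ins P)
  then obtain m where m: "\<forall>ins\<in>set P. tame m ins" by auto
  have "\<exists>m'. tame m' ins" using Cons.prems by (cases ins) auto
  then obtain m' where "tame m' ins" by blast
  then have "\<forall>x\<in>set (ins # P). tame (max m m') x" using m tame_mono by (auto simp: max_def)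
  then show ?case by blast
qed simp

definition start :: "nat \<Rightarrow> nat \<Rightarrow> loc \<Rightarrow> nat" where
  "start n k = (\<lambda>_. 0)(V 0 := n, V 1 := k)"

theorem compiled_run:
  assumes wf: "wfc b c" and b: "4 \<le> b"
  shows "\<exists>W. \<forall>n k E. 1 \<le> n \<longrightarrow> k \<le> n \<longrightarrow>
    runs_within (code b c 0) E n k (real (W * n ^ (2 * depth c + 1))) (outs E c (start n k))"
proof -
  define P where "P = code b c 0"
  obtain m0 where m0: "\<forall>ins\<in>set P. tame m0 ins"
    using exists_tame[of P] nomul_code unfolding P_def by blast
  obtain W where W: "\<forall>n\<ge>1. bnd c n \<le> W * n ^ depth c" using bnd_poly by blast
  define W' where "W' = W * (5 + 2 * m0 + 2 * W)"
  have "runs_within P E n k (real (W' * n ^ (2 * depth c + 1))) (outs E c (start n k))"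
    if n: "1 \<le> n" and k: "k \<le> n" for n k E
  proof -
    define R where "R = ((\<lambda>_. 0)(0 := n, 1 := k) :: nat \<Rightarrow> nat)"
    have seg: "seg P 0 (code b c 0)" unfolding seg_def P_def by (intro exI[of _ "[]"]) simp
    have rel: "rel b R (start n k)" using b by (auto simp: rel_def R_def start_def vok_def)
    have s0: "start n k (V 0) = n" by (simp add: start_def)
    from compile_correct[OF seg wf rel b, of E "{}" 0] s0
    have "sim b P E 0 R {} 0 (bnd c n) (clen c) (exec E c (start n k)) (outs E c (start n k))" by simp
    then obtain t R' q where t: "t \<le> bnd c n"
      and run: "(step P E ^^ t) (Cfg 0 R {} 0) = Cfg (clen c) R' (outs E c (start n k)) q"
      unfolding sim_def reach_def by blast
    define m where "m = m0 + n"
    have tm: "\<forall>ins\<in>set P. tame m ins" using m0 tame_mono unfolding m_def by (meson le_add1)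
    have "q \<le> t * (1 + 2 * (nbits m + t))"
      using run_tame[OF tm _ _ run] n k by (auto simp: m_def R_def)
    \<comment> \<open>\<open>nbits m\<close> is estimated crudely by \<open>Suc m\<close>; this
      costs the one factor \<open>n\<close> beyond the square of the step bound.\<close>
    also have "\<dots> \<le> (W * n ^ depth c) * (1 + 2 * (Suc m + W * n ^ depth c))"
    proof -
      have "t \<le> W * n ^ depth c" using t W[rule_format, OF n] by (rule le_trans)
      then show ?thesis using nbits_le[of m] by (intro mult_le_mono add_mono) auto
    qed
    also have "\<dots> \<le> (W * n ^ depth c) * ((5 + 2 * m0 + 2 * W) * (n * n ^ depth c))"
    proof (rule mult_le_mono2)
      have p: "1 \<le> n ^ depth c" using n by simp
      define N where "N = n * n ^ depth c"
      have N: "1 \<le> N" "n \<le> N" "n ^ depth c \<le> N" using n p by (auto simp: N_def)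
      have "1 + 2 * (Suc m + W * n ^ depth c) = 3 + 2 * m0 + 2 * n + 2 * W * n ^ depth c"
        by (simp add: m_def)
      also have "\<dots> \<le> 3 * N + 2 * m0 * N + 2 * N + 2 * W * N"
      proof (intro add_mono)
        show "3 \<le> 3 * N" "2 * n \<le> 2 * N" using N by simp_all
        show "2 * m0 \<le> 2 * m0 * N" using N by simp
        show "2 * W * n ^ depth c \<le> 2 * W * N" using N(3) by (rule mult_le_mono2)
      qed
      also have "\<dots> = (5 + 2 * m0 + 2 * W) * N" by (simp add: algebra_simps)
      finally show "1 + 2 * (Suc m + W * n ^ depth c) \<le> (5 + 2 * m0 + 2 * W) * (n * n ^ depth c)"
        unfolding N_def .
    qed
    also have "\<dots> = W' * n ^ (2 * depth c + 1)"
    proof -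
      have "n ^ (2 * depth c + 1) = n * n ^ depth c * n ^ depth c" by (simp add: mult_2 power_add)
      then show ?thesis unfolding W'_def by (simp only: mult_ac)
    qed
    finally have q: "q \<le> W' * n ^ (2 * depth c + 1)" .
    have len: "length P = clen c" by (simp add: P_def)
    show ?thesis
      unfolding runs_within_def
    proof (intro exI[of _ t])
      have "init n k = Cfg 0 R {} 0" by (simp add: init_def R_def)
      then have e: "(step P E ^^ t) (init n k) = Cfg (clen c) R' (outs E c (start n k)) q" using run by simp
      have "real q \<le> real (W' * n ^ (2 * depth c + 1))" using q by (rule of_nat_mono)
      then show "let cf = (step P E ^^ t) (init n k) in halted P cf
          \<and> real (cost cf) \<le> real (W' * n ^ (2 * depth c + 1)) \<and> outp cf = outs E c (start n k)"
        unfolding e Let_def halted_def using len by simp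
    qed
  qed
  then show ?thesis unfolding P_def by blast
qed

section \<open>Random sign matrices\<close>

lemma sinh_le_mult_cosh:
  fixes x :: real assumes "0 \<le> x" shows "sinh x \<le> x * cosh x"
proof -
  have "(\<lambda>x::real. x * cosh x - sinh x) 0 \<le> (\<lambda>x. x * cosh x - sinh x) x"
  proof (rule DERIV_nonneg_imp_nondecreasing[OF assms])
    fix t :: real assume t: "0 \<le> t"
    have "((\<lambda>x. x * cosh x - sinh x) has_real_derivative t * sinh t) (at t)"
      by (auto intro!: derivative_eq_intros)
    moreover have "0 \<le> t * sinh t" using t by simp
    ultimately show "\<exists>y. ((\<lambda>x. x * cosh x - sinh x) has_real_derivative y) (at t) \<and> 0 \<le> y" by blast
  qed
  then show ?thesis by simp
qed

text \<open>Moment generating function of a random sign. The function x^2/2 - ln (cosh x) vanishes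
  at 0 and has derivative x - tanh x, nonnegative for x \<ge> 0; negative x follows by
  evenness.\<close>

lemma cosh_le_exp_square: "cosh (x::real) \<le> exp (x\<^sup>2 / 2)"
proof -
  have *: "cosh x \<le> exp (x\<^sup>2 / 2)" if x: "0 \<le> x" for x :: real
  proof -
    have "(\<lambda>x::real. x\<^sup>2 / 2 - ln (cosh x)) 0 \<le> (\<lambda>x. x\<^sup>2 / 2 - ln (cosh x)) x"
    proof (rule DERIV_nonneg_imp_nondecreasing[OF x])
      fix t :: real assume t: "0 \<le> t"
      have c: "cosh t > 0" by (rule cosh_real_pos)
      have "((\<lambda>x. x\<^sup>2 / 2 - ln (cosh x)) has_real_derivative t - sinh t / cosh t) (at t)"
        using c by (auto intro!: derivative_eq_intros)
      moreover have "0 \<le> t - sinh t / cosh t"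
        using sinh_le_mult_cosh[OF t] c by (simp add: field_simps)
      ultimately show "\<exists>y. ((\<lambda>x. x\<^sup>2 / 2 - ln (cosh x)) has_real_derivative y) (at t) \<and> 0 \<le> y" by blast
    qed
    then have "ln (cosh x) \<le> x\<^sup>2 / 2" by simp
    then show ?thesis using cosh_real_pos[of x] by (metis exp_le_cancel_iff exp_ln)
  qed
  show ?thesis using *[of x] *[of "-x"] by (cases "0 \<le> x") auto
qed

lemma finite_vpairs [simp]: "finite (vpairs n)"
  by (rule finite_subset[of _ "{..<n} \<times> {..<n}"]) (auto simp: vpairs_def)

lemma set_pmf_gnp: "set_pmf (gnp n p) \<subseteq> Pow (vpairs n)"
  by (auto simp: gnp_def)

lemma finite_set_pmf_gnp: "finite (set_pmf (gnp n p))"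
  by (rule finite_subset[OF set_pmf_gnp]) simp

lemma gnp_expectation_prod:
  fixes f :: "nat \<times> nat \<Rightarrow> bool \<Rightarrow> real"
  assumes "\<And>e b. 0 \<le> f e b"
  shows "measure_pmf.expectation (gnp n (1/2)) (\<lambda>E. \<Prod>e\<in>vpairs n. f e (e \<in> E))
    = (\<Prod>e\<in>vpairs n. (f e True + f e False) / 2)"
proof -
  have "measure_pmf.expectation (gnp n (1/2)) (\<lambda>E. \<Prod>e\<in>vpairs n. f e (e \<in> E))
    = measure_pmf.expectation (Pi_pmf (vpairs n) False (\<lambda>_. bernoulli_pmf (1/2))) (\<lambda>y. \<Prod>e\<in>vpairs n. f e (y e))"
    unfolding gnp_def integral_map_pmf by (intro Bochner_Integration.integral_cong prod.cong) auto
  also have "\<dots> = (\<Prod>e\<in>vpairs n. measure_pmf.expectation (bernoulli_pmf (1/2)) (f e))"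
    using assms by (intro expectation_prod_Pi_pmf) (auto intro: integrable_measure_pmf_finite)
  also have "\<dots> = (\<Prod>e\<in>vpairs n. (f e True + f e False) / 2)"
    by (intro prod.cong) (auto simp: field_simps)
  finally show ?thesis .
qed

lemma gnp_subgaussian:
  fixes c :: "nat \<times> nat \<Rightarrow> real"
  assumes s: "(\<Sum>e\<in>vpairs n. (c e)\<^sup>2) \<le> s" "0 < s" and t: "0 \<le> t"
  shows "measure_pmf.prob (gnp n (1/2)) {E. t \<le> (\<Sum>e\<in>vpairs n. (if e \<in> E then 1 else -1) * c e)}
    \<le> exp (- (t\<^sup>2 / (2 * s)))"
proof -
  \<comment> \<open>The Chernoff exponent l^2 s / 2 - l t is minimal here.\<close>
  define l where "l = t / s"
  have l: "0 \<le> l" using assms by (simp add: l_def)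
  define Z where "Z E = (\<Sum>e\<in>vpairs n. (if e \<in> E then 1 else -1) * c e)" for E
  define f where "f e b = exp (l * ((if b then 1 else -1) * c e))" for e b
  have expZ: "exp (l * Z E) = (\<Prod>e\<in>vpairs n. f e (e \<in> E))" for E
    unfolding Z_def f_def by (simp add: exp_sum sum_distrib_left)
  have "measure_pmf.expectation (gnp n (1/2)) (\<lambda>E. exp (l * Z E)) = (\<Prod>e\<in>vpairs n. (f e True + f e False) / 2)"
    unfolding expZ by (rule gnp_expectation_prod) (simp add: f_def)
  also have "\<dots> = (\<Prod>e\<in>vpairs n. cosh (l * c e))"
    by (simp add: f_def cosh_field_def)
  also have "\<dots> \<le> (\<Prod>e\<in>vpairs n. exp ((l * c e)\<^sup>2 / 2))"
    by (intro prod_mono) (auto intro: cosh_le_exp_square cosh_real_nonneg)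
  also have "\<dots> = exp (l\<^sup>2 / 2 * (\<Sum>e\<in>vpairs n. (c e)\<^sup>2))"
    by (simp add: exp_sum[symmetric] sum_distrib_left power_mult_distrib)
  also have "\<dots> \<le> exp (l\<^sup>2 / 2 * s)"
    using s by (simp add: mult_left_mono)
  finally have mgf: "measure_pmf.expectation (gnp n (1/2)) (\<lambda>E. exp (l * Z E)) \<le> exp (l\<^sup>2 / 2 * s)" .
  have "measure_pmf.prob (gnp n (1/2)) {E. t \<le> Z E}
      \<le> measure_pmf.prob (gnp n (1/2)) {E \<in> space (gnp n (1/2)). exp (l * t) \<le> exp (l * Z E)}"
    using l by (intro measure_pmf.finite_measure_mono) (auto simp: mult_left_mono)
  also have "\<dots> \<le> measure_pmf.expectation (gnp n (1/2)) (\<lambda>E. exp (l * Z E)) / exp (l * t)"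
    by (rule integral_Markov_inequality_measure[where A = "{}"])
       (auto intro: integrable_measure_pmf_finite finite_set_pmf_gnp)
  also have "\<dots> \<le> exp (l\<^sup>2 / 2 * s) / exp (l * t)"
    using mgf by (simp add: divide_right_mono)
  also have "\<dots> = exp (- (t\<^sup>2 / (2 * s)))"
    using s by (simp add: exp_diff[symmetric] l_def field_simps power2_eq_square)
  finally show ?thesis unfolding Z_def .
qed

definition sg :: "(nat \<times> nat) set \<Rightarrow> nat \<Rightarrow> nat \<Rightarrow> real" where
  "sg E i j = (if i = j then 0 else if adj E i j then 1 else -1)"

definition bil :: "nat \<Rightarrow> (nat \<times> nat) set \<Rightarrow> (nat \<Rightarrow> real) \<Rightarrow> (nat \<Rightarrow> real) \<Rightarrow> real" where
  "bil n E x y = (\<Sum>i<n. \<Sum>j<n. sg E i j * x i * y j)"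

definition nsq :: "nat \<Rightarrow> (nat \<Rightarrow> real) \<Rightarrow> real" where
  "nsq n x = (\<Sum>i<n. (x i)\<^sup>2)"

lemma nsq_nonneg [simp]: "0 \<le> nsq n x"
  by (simp add: nsq_def sum_nonneg)

lemma vpairs_Suc: "vpairs (Suc n) = vpairs n \<union> (\<lambda>i. (i, n)) ` {..<n}"
  by (auto simp: vpairs_def less_Suc_eq)

lemma sum_square_vpairs:
  fixes g :: "nat \<Rightarrow> nat \<Rightarrow> real"
  shows "(\<Sum>i<n. \<Sum>j<n. g i j) = (\<Sum>i<n. g i i) + (\<Sum>(i, j)\<in>vpairs n. g i j + g j i)"
proof (induction n)
  case 0
  then show ?case by (simp add: vpairs_def)
next
  case (Suc n)
  have "(\<Sum>(i, j)\<in>vpairs (Suc n). g i j + g j i)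
     = (\<Sum>(i, j)\<in>vpairs n. g i j + g j i) + (\<Sum>(i, j)\<in>(\<lambda>i. (i, n)) ` {..<n}. g i j + g j i)"
    unfolding vpairs_Suc by (rule sum.union_disjoint) (simp_all, auto simp: vpairs_def)
  also have "(\<Sum>(i, j)\<in>(\<lambda>i. (i, n)) ` {..<n}. g i j + g j i) = (\<Sum>i<n. g i n + g n i)"
    by (subst sum.reindex) (auto simp: inj_on_def)
  finally show ?case using Suc by (simp add: sum.distrib)
qed

lemma bil_vpairs:
  "bil n E x y = (\<Sum>e\<in>vpairs n. (if e \<in> E then 1 else -1) * (x (fst e) * y (snd e) + x (snd e) * y (fst e)))"
  unfolding bil_def sum_square_vpairs
  by (auto simp: sg_def adj_def vpairs_def algebra_simps intro!: sum.cong)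

text \<open>Each unordered pair carries the coefficient x_i y_j + x_j y_i. By (a+b)^2 \<le> 2 (a^2 +
  b^2) the squares sum to at most 2 X Y, whence the 4 in the exponent.\<close>

lemma bil_tail:
  assumes "nsq n x \<le> X" "nsq n y \<le> Y" "0 < X" "0 < Y" "0 \<le> t"
  shows "measure_pmf.prob (gnp n (1/2)) {E. t \<le> bil n E x y} \<le> exp (- (t\<^sup>2 / (4 * (X * Y))))"
proof -
  have "(\<Sum>e\<in>vpairs n. (x (fst e) * y (snd e) + x (snd e) * y (fst e))\<^sup>2)
     \<le> (\<Sum>e\<in>vpairs n. 2 * ((x (fst e))\<^sup>2 * (y (snd e))\<^sup>2 + (x (snd e))\<^sup>2 * (y (fst e))\<^sup>2))"
  proof (rule sum_mono)
    fix e
    have "(a + b)\<^sup>2 \<le> 2 * (a\<^sup>2 + b\<^sup>2)" for a b :: real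
      using sum_squares_bound[of a b] by (simp add: power2_sum)
    from this[of "x (fst e) * y (snd e)" "x (snd e) * y (fst e)"]
    show "(x (fst e) * y (snd e) + x (snd e) * y (fst e))\<^sup>2
       \<le> 2 * ((x (fst e))\<^sup>2 * (y (snd e))\<^sup>2 + (x (snd e))\<^sup>2 * (y (fst e))\<^sup>2)"
      by (simp only: power_mult_distrib)
  qed
  also have "\<dots> = 2 * (\<Sum>(i, j)\<in>vpairs n. (x i)\<^sup>2 * (y j)\<^sup>2 + (x j)\<^sup>2 * (y i)\<^sup>2)"
    by (simp add: sum_distrib_left case_prod_beta)
  also have "\<dots> \<le> 2 * (\<Sum>i<n. \<Sum>j<n. (x i)\<^sup>2 * (y j)\<^sup>2)"
    unfolding sum_square_vpairs[of "\<lambda>i j. (x i)\<^sup>2 * (y j)\<^sup>2"] by (simp add: sum_nonneg)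
  also have "(\<Sum>i<n. \<Sum>j<n. (x i)\<^sup>2 * (y j)\<^sup>2) = nsq n x * nsq n y"
    by (simp add: nsq_def sum_product)
  also have "2 * (nsq n x * nsq n y) \<le> 2 * (X * Y)"
    using assms by (simp add: mult_mono)
  finally have "measure_pmf.prob (gnp n (1/2)) {E. t \<le> bil n E x y} \<le> exp (- (t\<^sup>2 / (2 * (2 * (X * Y)))))"
    unfolding bil_vpairs using assms by (intro gnp_subgaussian) auto
  then show ?thesis by simp
qed

section \<open>Counting integer points of bounded l1 norm\<close>

lemma sum_power_abs_le:
  fixes q :: real assumes "0 < q" "q < 1"
  shows "(\<Sum>a\<in>{- int b..int b}. q ^ nat \<bar>a\<bar>) \<le> (1 + q) / (1 - q) - 2 * q ^ Suc b / (1 - q)"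
proof (induction b)
  case 0
  then show ?case using assms by (simp add: diff_divide_distrib[symmetric])
next
  case (Suc b)
  have "{- int (Suc b)..int (Suc b)} = insert (- int (Suc b)) (insert (int (Suc b)) {- int b..int b})"
    by auto
  then have "(\<Sum>a\<in>{- int (Suc b)..int (Suc b)}. q ^ nat \<bar>a\<bar>)
     = 2 * q ^ Suc b + (\<Sum>a\<in>{- int b..int b}. q ^ nat \<bar>a\<bar>)"
    by (simp add: nat_add_distrib)
  also have "\<dots> \<le> 2 * q ^ Suc b + ((1 + q) / (1 - q) - 2 * q ^ Suc b / (1 - q))" using Suc by simp
  also have "\<dots> = (1 + q) / (1 - q) - 2 * q ^ Suc (Suc b) / (1 - q)"
  proof -
    have "2 * q ^ Suc b = (2 * q ^ Suc b - 2 * q ^ Suc (Suc b)) / (1 - q)"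
      using assms by (simp add: field_simps)
    then show ?thesis by (simp add: diff_divide_distrib)
  qed
  finally show ?case .
qed

text \<open>The explicit coordinate box places the set inside a finite product, over which the
  generating function factorises.\<close>

definition lattice :: "nat \<Rightarrow> real \<Rightarrow> (nat \<Rightarrow> int) set" where
  "lattice n m = {z \<in> {..<n} \<rightarrow>\<^sub>E {- int (nat \<lceil>m\<rceil>)..int (nat \<lceil>m\<rceil>)}. (\<Sum>i<n. real (nat \<bar>z i\<bar>)) \<le> m}"

lemma finite_lattice [simp]: "finite (lattice n m)"
proof (rule finite_subset)
  show "lattice n m \<subseteq> {..<n} \<rightarrow>\<^sub>E {- int (nat \<lceil>m\<rceil>)..int (nat \<lceil>m\<rceil>)}"
    unfolding lattice_def by blast
  show "finite ({..<n} \<rightarrow>\<^sub>E {- int (nat \<lceil>m\<rceil>)..int (nat \<lceil>m\<rceil>)})"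
    by (intro finite_PiE) simp_all
qed

text \<open>Every point has weight q^(l1 norm - m) \<ge> 1, and the total weight over the box is a
  product of geometric series in the coordinates.\<close>

lemma card_lattice_le:
  fixes q :: real assumes q: "0 < q" "q < 1"
  shows "real (card (lattice n m)) \<le> q powr (- m) * ((1 + q) / (1 - q)) ^ n"
proof -
  define B where "B = {- int (nat \<lceil>m\<rceil>)..int (nat \<lceil>m\<rceil>)}"
  have "real (card (lattice n m)) = (\<Sum>z\<in>lattice n m. 1)" by simp
  also have "\<dots> \<le> (\<Sum>z\<in>lattice n m. q powr (- m) * (\<Prod>i<n. q ^ nat \<bar>z i\<bar>))"
  proof (rule sum_mono)
    fix z assume "z \<in> lattice n m"
    then have "(\<Sum>i<n. real (nat \<bar>z i\<bar>)) \<le> m" by (simp add: lattice_def)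
    then have "1 \<le> q powr ((\<Sum>i<n. real (nat \<bar>z i\<bar>)) - m)"
      using powr_mono'[of "(\<Sum>i<n. real (nat \<bar>z i\<bar>)) - m" 0 q] q by simp
    also have "\<dots> = q powr (- m) * q powr (real (\<Sum>i<n. nat \<bar>z i\<bar>))"
      unfolding powr_add[symmetric] of_nat_sum by (rule arg_cong) simp
    also have "q powr (real (\<Sum>i<n. nat \<bar>z i\<bar>)) = (\<Prod>i<n. q ^ nat \<bar>z i\<bar>)"
      unfolding power_sum[symmetric] using q by (intro powr_realpow) simp
    finally show "1 \<le> q powr (- m) * (\<Prod>i<n. q ^ nat \<bar>z i\<bar>)" .
  qed
  also have "\<dots> \<le> (\<Sum>z\<in>{..<n} \<rightarrow>\<^sub>E B. q powr (- m) * (\<Prod>i<n. q ^ nat \<bar>z i\<bar>))"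
  proof (rule sum_mono2)
    show "finite ({..<n} \<rightarrow>\<^sub>E B)" unfolding B_def by (intro finite_PiE) simp_all
    show "lattice n m \<subseteq> {..<n} \<rightarrow>\<^sub>E B" unfolding B_def lattice_def by blast
    show "0 \<le> q powr (- m) * (\<Prod>i<n. q ^ nat \<bar>z i\<bar>)" for z :: "nat \<Rightarrow> int"
      using q by (intro mult_nonneg_nonneg prod_nonneg) simp_all
  qed
  also have "\<dots> = q powr (- m) * (\<Prod>i<n. \<Sum>a\<in>B. q ^ nat \<bar>a\<bar>)"
  proof -
    have "(\<Prod>i<n. \<Sum>a\<in>B. q ^ nat \<bar>a\<bar>) = (\<Sum>z\<in>{..<n} \<rightarrow>\<^sub>E B. \<Prod>i<n. q ^ nat \<bar>z i\<bar>)"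
      by (rule prod_sum_PiE) (simp_all add: B_def)
    then show ?thesis by (simp only: sum_distrib_left)
  qed
  also have "\<dots> \<le> q powr (- m) * ((1 + q) / (1 - q)) ^ n"
  proof -
    have "(\<Sum>a\<in>B. q ^ nat \<bar>a\<bar>) \<le> (1 + q) / (1 - q) - 2 * q ^ Suc (nat \<lceil>m\<rceil>) / (1 - q)"
      unfolding B_def by (rule sum_power_abs_le[OF q])
    also have "\<dots> \<le> (1 + q) / (1 - q)" using q by simp
    finally have "(\<Sum>a\<in>B. q ^ nat \<bar>a\<bar>) ^ n \<le> ((1 + q) / (1 - q)) ^ n"
      using q by (intro power_mono) (auto intro: sum_nonneg)
    then show ?thesis by (simp add: mult_left_mono)
  qed
  finally show ?thesis .
qed

section \<open>Norm of the sign matrix on sparse vectors\<close>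

lemma bil_add_left: "bil n E (\<lambda>i. x i + x' i) y = bil n E x y + bil n E x' y"
  by (simp add: bil_def algebra_simps sum.distrib)

lemma bil_add_right: "bil n E x (\<lambda>i. y i + y' i) = bil n E x y + bil n E x y'"
  by (simp add: bil_def algebra_simps sum.distrib)

lemma bil_scale_left: "bil n E (\<lambda>i. a * x i) y = a * bil n E x y"
  by (simp add: bil_def sum_distrib_left mult_ac)

lemma bil_scale_right: "bil n E x (\<lambda>i. a * y i) = a * bil n E x y"
  by (simp add: bil_def sum_distrib_left mult_ac)

lemma bil_cong:
  "(\<And>i. i < n \<Longrightarrow> x i = x' i) \<Longrightarrow> (\<And>i. i < n \<Longrightarrow> y i = y' i) \<Longrightarrow> bil n E x y = bil n E x' y'"
  by (simp add: bil_def)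

lemma nsq_scale: "nsq n (\<lambda>i. a * x i) = a\<^sup>2 * nsq n x"
  by (simp add: nsq_def power_mult_distrib sum_distrib_left)

lemma nsq_mono: "(\<And>i. i < n \<Longrightarrow> \<bar>x i\<bar> \<le> \<bar>y i\<bar>) \<Longrightarrow> nsq n x \<le> nsq n y"
  unfolding nsq_def by (intro sum_mono) (simp add: abs_le_square_iff)

lemma nsq_entry: "i < n \<Longrightarrow> (x i)\<^sup>2 \<le> nsq n x"
  unfolding nsq_def by (rule member_le_sum) auto

definition supp :: "nat \<Rightarrow> (nat \<Rightarrow> real) \<Rightarrow> nat set" where
  "supp n x = {i. i < n \<and> x i \<noteq> 0}"

lemma finite_supp [simp]: "finite (supp n x)"
  by (simp add: supp_def)

text \<open>Two independent vectors instead of a quadratic form: later uses pair a noise vector with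
  an iterate, and \<open>K\<close> with a set disjoint from it.\<close>

definition opb :: "nat \<Rightarrow> (nat \<times> nat) set \<Rightarrow> real \<Rightarrow> real \<Rightarrow> bool" where
  "opb n E m L \<longleftrightarrow> (\<forall>x y. real (card (supp n x)) \<le> m \<longrightarrow> real (card (supp n y)) \<le> m \<longrightarrow>
      bil n E x y \<le> L * sqrt (nsq n x) * sqrt (nsq n y))"

text \<open>Rounding towards zero to a multiple of \<open>h\<close>, so that no norm or support grows.\<close>

definition rnd :: "real \<Rightarrow> real \<Rightarrow> int" where
  "rnd h r = (if 0 \<le> r then \<lfloor>r / h\<rfloor> else - \<lfloor>- r / h\<rfloor>)"

lemma rnd_0 [simp]: "rnd h 0 = 0"
  by (simp add: rnd_def)

lemma rnd_le: assumes "0 < h" shows "\<bar>h * real_of_int (rnd h r)\<bar> \<le> \<bar>r\<bar>"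
proof -
  have *: "\<bar>h * real_of_int \<lfloor>r / h\<rfloor>\<bar> \<le> r" if "0 \<le> r" for r
  proof -
    have "h * real_of_int \<lfloor>r / h\<rfloor> \<le> h * (r / h)" using assms by (intro mult_left_mono) auto
    moreover have "0 \<le> h * real_of_int \<lfloor>r / h\<rfloor>" using assms that by simp
    ultimately show ?thesis using assms by simp
  qed
  show ?thesis using *[of r] *[of "-r"] by (cases "0 \<le> r") (auto simp: rnd_def)
qed

lemma rnd_diff: assumes "0 < h" shows "\<bar>r - h * real_of_int (rnd h r)\<bar> \<le> h"
proof -
  have *: "\<bar>r - h * real_of_int \<lfloor>r / h\<rfloor>\<bar> \<le> h" for r
  proof -
    have "h * real_of_int \<lfloor>r / h\<rfloor> \<le> h * (r / h)" using assms by (intro mult_left_mono) auto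
    moreover have "h * (r / h) \<le> h * (real_of_int \<lfloor>r / h\<rfloor> + 1)"
      using assms by (intro mult_left_mono) linarith+
    ultimately show ?thesis using assms by (simp add: algebra_simps)
  qed
  show ?thesis using *[of r] *[of "-r"] by (cases "0 \<le> r") (auto simp: rnd_def abs_minus_commute)
qed

lemma bil_le_square:
  assumes "nsq n x \<le> 1" "nsq n y \<le> 1" shows "bil n E x y \<le> real n * real n"
proof -
  have 1: "\<bar>x i\<bar> \<le> 1" "\<bar>y i\<bar> \<le> 1" if "i < n" for i
    using nsq_entry[OF that, of x] nsq_entry[OF that, of y] assms
    by (auto simp: abs_square_le_1[symmetric])
  have "sg E i j * x i * y j \<le> 1" if "i < n" "j < n" for i j
  proof -
    have "\<bar>sg E i j * x i * y j\<bar> \<le> 1 * 1 * 1"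
      unfolding abs_mult using 1[OF that(1)] 1[OF that(2)]
      by (intro mult_mono) (auto simp: sg_def)
    then show ?thesis by linarith
  qed
  then have "bil n E x y \<le> (\<Sum>i<n. \<Sum>j<n. 1)"
    unfolding bil_def by (intro sum_mono) auto
  then show ?thesis by simp
qed

text \<open>The supremum \<open>S\<close> of the form over unit vectors of small support satisfies \<open>S \<le> t + S / 2\<close>, because
  four times a rounding error is again such a vector.\<close>

lemma opb_of_lattice:
  fixes m t h :: real
  assumes m: "0 < m" and h: "h = 1 / (4 * sqrt m)" and t: "0 \<le> t"
    and net: "\<And>z w. \<lbrakk>z \<in> lattice n (16 * m); w \<in> lattice n (16 * m);
      nsq n (\<lambda>i. h * real_of_int (z i)) \<le> 1; nsq n (\<lambda>i. h * real_of_int (w i)) \<le> 1\<rbrakk>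
      \<Longrightarrow> bil n E (\<lambda>i. h * real_of_int (z i)) (\<lambda>i. h * real_of_int (w i)) \<le> t"
  shows "opb n E m (2 * t)"
proof -
  have h0: "0 < h" using m h by simp
  \<comment> \<open>The mesh does two jobs: a rounding error lives on at most \<open>m\<close>
    coordinates of size at most \<open>h\<close>, so four times it still has norm at most 1; and
    unit vectors round to integer points of l1 norm at most \<open>16 * m\<close>.\<close>
  have hm: "h\<^sup>2 * (16 * m) = 1" using m by (simp add: h power_mult_distrib power_divide)
  define T where "T = {x. real (card (supp n x)) \<le> m \<and> nsq n x \<le> 1}"
  define BB where "BB = {bil n E x y | x y. x \<in> T \<and> y \<in> T}"
  \<comment> \<open>Finiteness of the supremum is what allows S \<le> t + S/2 to be solved for S;
    the crude bound n^2 is enough.\<close>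
  have bdd: "bdd_above BB"
    unfolding BB_def T_def by (rule bdd_aboveI[of _ "real n * real n"]) (auto intro: bil_le_square)
  have "(\<lambda>_. 0) \<in> T" using m by (simp add: T_def supp_def nsq_def)
  then have ne: "BB \<noteq> {}" by (auto simp: BB_def)
  have upper: "bil n E x y \<le> Sup BB" if "x \<in> T" "y \<in> T" for x y
    using that by (intro cSup_upper bdd) (auto simp: BB_def)
  define r where "r x = (\<lambda>i. h * real_of_int (rnd h (x i)))" for x :: "nat \<Rightarrow> real"
  have supp_r: "supp n (r x) \<subseteq> supp n x" for x by (auto simp: supp_def r_def)
  have nsq_r: "nsq n (r x) \<le> nsq n x" for x by (rule nsq_mono) (simp add: r_def rnd_le[OF h0])
  have rT: "r x \<in> T" if "x \<in> T" for x
    using that nsq_r[of x] card_mono[OF finite_supp supp_r[of x]] by (auto simp: T_def)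
  have dT: "(\<lambda>i. 4 * (x i - r x i)) \<in> T" if "x \<in> T" for x
  proof -
    have s: "supp n (\<lambda>i. 4 * (x i - r x i)) \<subseteq> supp n x" by (auto simp: supp_def r_def)
    have "nsq n (\<lambda>i. 4 * (x i - r x i)) = (\<Sum>i\<in>supp n x. (4 * (x i - r x i))\<^sup>2)"
      unfolding nsq_def by (rule sum.mono_neutral_right) (auto simp: supp_def r_def)
    also have "\<dots> \<le> (\<Sum>i\<in>supp n x. 16 * h\<^sup>2)"
    proof (rule sum_mono)
      fix i
      have "\<bar>x i - r x i\<bar> \<le> \<bar>h\<bar>" using rnd_diff[OF h0, of "x i"] h0 by (simp add: r_def)
      then have "(x i - r x i)\<^sup>2 \<le> h\<^sup>2" by (simp only: abs_le_square_iff)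
      then show "(4 * (x i - r x i))\<^sup>2 \<le> 16 * h\<^sup>2"
        by (simp only: power_mult_distrib) simp
    qed
    also have "\<dots> = real (card (supp n x)) * (16 * h\<^sup>2)" by simp
    also have "\<dots> \<le> m * (16 * h\<^sup>2)" using that by (intro mult_right_mono) (auto simp: T_def)
    also have "\<dots> = 1" using hm by (simp add: mult_ac)
    finally show ?thesis using that card_mono[OF finite_supp s] by (auto simp: T_def)
  qed
  have net_r: "bil n E (r x) (r y) \<le> t" if "x \<in> T" "y \<in> T" for x y
  proof -
    define z where "z x = restrict (\<lambda>i. rnd h (x i)) {..<n}" for x
    have zr: "h * real_of_int (z x i) = r x i" if "i < n" for x i using that by (simp add: z_def r_def)
    have nz: "nsq n (\<lambda>i. h * real_of_int (z x i)) = nsq n (r x)" for x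
      unfolding nsq_def using zr by (intro sum.cong) auto
    have zl: "z x \<in> lattice n (16 * m)" if x: "x \<in> T" for x
    proof -
      \<comment> \<open>For integers the absolute value is at most the square, which converts the l2
        bound into the l1 bound of the lattice.\<close>
      have "(\<Sum>i<n. real (nat \<bar>z x i\<bar>)) \<le> (\<Sum>i<n. (real_of_int (z x i))\<^sup>2)"
      proof (rule sum_mono)
        fix i
        have "\<bar>z x i\<bar> \<le> (z x i)\<^sup>2"
        proof (cases "z x i = 0")
          case False
          then have "1 * \<bar>z x i\<bar> \<le> \<bar>z x i\<bar> * \<bar>z x i\<bar>" by (intro mult_right_mono) auto
          then show ?thesis by (simp add: power2_eq_square)
        qed simp
        then have "real_of_int \<bar>z x i\<bar> \<le> real_of_int ((z x i)\<^sup>2)" by (simp only: of_int_le_iff)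
        then show "real (nat \<bar>z x i\<bar>) \<le> (real_of_int (z x i))\<^sup>2" by simp
      qed
      also have "\<dots> = (16 * m) * nsq n (\<lambda>i. h * real_of_int (z x i))"
        unfolding nsq_scale using hm by (simp add: nsq_def algebra_simps)
      also have "\<dots> \<le> 16 * m * 1"
        unfolding nz using m nsq_r[of x] x by (intro mult_left_mono) (auto simp: T_def)
      finally have s: "(\<Sum>i<n. real (nat \<bar>z x i\<bar>)) \<le> 16 * m" by simp
      have "z x i \<in> {- int (nat \<lceil>16 * m\<rceil>)..int (nat \<lceil>16 * m\<rceil>)}" if "i < n" for i
      proof -
        have "real (nat \<bar>z x i\<bar>) \<le> (\<Sum>i<n. real (nat \<bar>z x i\<bar>))"
          using that by (intro member_le_sum) auto
        then have "real_of_int \<bar>z x i\<bar> \<le> 16 * m" using s by simp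
        then have "\<bar>z x i\<bar> \<le> \<lceil>16 * m\<rceil>" by linarith
        then show ?thesis using m by auto
      qed
      then show ?thesis using s unfolding lattice_def by (auto simp: z_def)
    qed
    have "bil n E (r x) (r y) = bil n E (\<lambda>i. h * real_of_int (z x i)) (\<lambda>i. h * real_of_int (z y i))"
      using zr by (intro bil_cong) auto
    also have "\<dots> \<le> t"
      using rT that by (intro net zl) (auto simp: nz T_def)
    finally show ?thesis .
  qed
  have step: "bil n E x y \<le> t + Sup BB / 2" if x: "x \<in> T" and y: "y \<in> T" for x y
  proof -
    have "bil n E x y = bil n E (\<lambda>i. r x i + (x i - r x i)) y" by simp
    also have "\<dots> = bil n E (r x) (\<lambda>i. r y i + (y i - r y i)) + bil n E (\<lambda>i. x i - r x i) y"
      by (subst bil_add_left) simp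
    also have "\<dots> = bil n E (r x) (r y) + bil n E (r x) (\<lambda>i. y i - r y i) + bil n E (\<lambda>i. x i - r x i) y"
      by (subst bil_add_right) simp
    finally have e: "bil n E x y = \<dots>" .
    have "4 * bil n E (r x) (\<lambda>i. y i - r y i) \<le> Sup BB"
      using upper[OF rT[OF x] dT[OF y]] by (simp only: bil_scale_right)
    moreover have "4 * bil n E (\<lambda>i. x i - r x i) y \<le> Sup BB"
      using upper[OF dT[OF x] y] by (simp only: bil_scale_left)
    ultimately show ?thesis using e net_r[OF x y] by linarith
  qed
  have "Sup BB \<le> t + Sup BB / 2"
    using step by (intro cSup_least ne) (auto simp: BB_def)
  then have sup: "Sup BB \<le> 2 * t" by simp
  show ?thesis
    unfolding opb_def
  proof (intro allI impI)
    fix x y :: "nat \<Rightarrow> real"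
    assume c: "real (card (supp n x)) \<le> m" "real (card (supp n y)) \<le> m"
    show "bil n E x y \<le> 2 * t * sqrt (nsq n x) * sqrt (nsq n y)"
    proof (cases "nsq n x = 0 \<or> nsq n y = 0")
      case True
      then have "(\<forall>i<n. x i = 0) \<or> (\<forall>i<n. y i = 0)"
        by (auto simp: nsq_def sum_nonneg_eq_0_iff)
      then have "bil n E x y = 0" by (auto simp: bil_def)
      then show ?thesis using t by simp
    next
      case False
      define a where "a = sqrt (nsq n x)"
      define b where "b = sqrt (nsq n y)"
      have ab: "0 < a" "0 < b" using False by (auto simp: a_def b_def less_le)
      have a2: "a\<^sup>2 = nsq n x" "b\<^sup>2 = nsq n y" by (auto simp: a_def b_def)
      have "supp n (\<lambda>i. 1 / a * x i) = supp n x" "supp n (\<lambda>i. 1 / b * y i) = supp n y"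
        using ab by (auto simp: supp_def)
      moreover have "nsq n (\<lambda>i. 1 / a * x i) = 1" "nsq n (\<lambda>i. 1 / b * y i) = 1"
        unfolding nsq_scale a2[symmetric] using ab by (simp_all add: power_divide)
      ultimately have "(\<lambda>i. 1 / a * x i) \<in> T" "(\<lambda>i. 1 / b * y i) \<in> T"
        using c by (simp_all add: T_def)
      from upper[OF this] sup have "1 / a * (1 / b * bil n E x y) \<le> 2 * t"
        unfolding bil_scale_left bil_scale_right by linarith
      then have "bil n E x y \<le> 2 * t * a * b" using ab by (simp add: field_simps)
      then show ?thesis by (simp add: a_def b_def)
    qed
  qed
qed

lemma prob_union_le:
  assumes "finite I" "\<And>i. i \<in> I \<Longrightarrow> measure_pmf.prob p (B i) \<le> c" "X \<subseteq> (\<Union>i\<in>I. B i)"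
  shows "measure_pmf.prob p X \<le> real (card I) * c"
proof -
  have "measure_pmf.prob p X \<le> measure_pmf.prob p (\<Union>i\<in>I. B i)"
    using assms by (intro measure_pmf.finite_measure_mono) auto
  also have "\<dots> \<le> (\<Sum>i\<in>I. measure_pmf.prob p (B i))"
    using assms by (intro measure_pmf.finite_measure_subadditive_finite) auto
  also have "\<dots> \<le> (\<Sum>i\<in>I. c)" using assms by (intro sum_mono) auto
  finally show ?thesis by simp
qed

text \<open>The 48 is 46 + 2: the factor \<open>q powr (- m)\<close> contributes 16 * 23/8 = 46, and
  the n geometric series contribute 2.\<close>

lemma card_lattice_exp_le:
  fixes d :: real assumes d: "0 < d" "d \<le> 1" and m: "m = 16 * (d ^ 4 * real n)"
  shows "real (card (lattice n m)) \<le> exp (48 * d\<^sup>2 * real n)"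
proof -
  \<comment> \<open>Of the order of m/n, which roughly balances the two factors of
    \<open>card_lattice_le\<close>.\<close>
  define q where "q = d ^ 4 / 2"
  have d4: "0 < d ^ 4" "d ^ 4 \<le> 1" "d ^ 4 \<le> d\<^sup>2"
    using d by (auto simp: power_le_one intro: power_decreasing)
  have q: "0 < q" "q < 1" "q \<le> 1 / 2" using d4 by (auto simp: q_def)
  \<comment> \<open>Taking the square root of 1/q before using ln u \<le> u gives 1/d^2 instead of
    1/d^4; multiplied by \<open>m\<close> this is of order d^2 n. It avoids logarithms, at the price
    of the exponent 1/4 in the norm bound.\<close>
  have ln_q: "- ln q \<le> 23 / 8 / d\<^sup>2"
  proof -
    define u where "u = sqrt 2 / d\<^sup>2"
    have u: "0 < u" using d by (simp add: u_def)
    have "u\<^sup>2 = 1 / q" by (simp add: u_def q_def power_divide power_mult[symmetric])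
    then have "- ln q = ln (u\<^sup>2)" using q by (simp add: ln_div)
    also have "\<dots> = 2 * ln u" using u by (simp add: ln_realpow)
    also have "\<dots> \<le> 2 * u" using ln_le_minus_one[OF u] by simp
    also have "2 * u \<le> 2 * (23 / 16 / d\<^sup>2)"
    proof -
      have "sqrt 2 \<le> 23 / 16" by (rule real_le_lsqrt) (auto simp: power_divide)
      then have "sqrt 2 / d\<^sup>2 \<le> 23 / 16 / d\<^sup>2" by (intro divide_right_mono) auto
      then show ?thesis by (simp add: u_def)
    qed
    finally show ?thesis by simp
  qed
  have "q powr (- m) = exp (m * (- ln q))" using q by (simp add: powr_def)
  also have "\<dots> \<le> exp (m * (23 / 8 / d\<^sup>2))"
  proof -
    have "0 \<le> m" using d4 by (simp add: m)
    from mult_left_mono[OF ln_q this] show ?thesis by simp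
  qed
  also have "m * (23 / 8 / d\<^sup>2) = 46 * d\<^sup>2 * real n"
  proof -
    have "m * (23 / 8 / d\<^sup>2) = 46 * real n * (d ^ 4 / d\<^sup>2)" by (simp add: m)
    also have "d ^ 4 / d\<^sup>2 = d\<^sup>2" using d by (simp add: eval_nat_numeral)
    finally show ?thesis by simp
  qed
  finally have 1: "q powr (- m) \<le> exp (46 * d\<^sup>2 * real n)" .
  have "(1 + q) / (1 - q) \<le> 1 + 4 * q"
  proof -
    have "1 + q \<le> (1 + 4 * q) * (1 - q)" using q mult_left_mono[of q "1/2" q] by (simp add: algebra_simps)
    then show ?thesis using q by (simp add: field_simps)
  qed
  also have "\<dots> \<le> 1 + 2 * d\<^sup>2" using d4 by (simp add: q_def)
  also have "\<dots> \<le> exp (2 * d\<^sup>2)" by (rule exp_ge_add_one_self)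
  finally have "((1 + q) / (1 - q)) ^ n \<le> exp (2 * d\<^sup>2) ^ n"
    using q by (intro power_mono) auto
  also have "\<dots> = exp (2 * d\<^sup>2 * real n)" by (simp add: exp_of_nat_mult[symmetric] mult_ac)
  finally have 2: "((1 + q) / (1 - q)) ^ n \<le> exp (2 * d\<^sup>2 * real n)" .
  have "real (card (lattice n m)) \<le> q powr (- m) * ((1 + q) / (1 - q)) ^ n"
    by (rule card_lattice_le[OF q(1,2)])
  also have "\<dots> \<le> exp (46 * d\<^sup>2 * real n) * exp (2 * d\<^sup>2 * real n)"
    using 1 2 q by (intro mult_mono) auto
  also have "\<dots> = exp (48 * d\<^sup>2 * real n)" by (simp add: exp_add[symmetric] algebra_simps)
  finally show ?thesis .
qed

text \<open>Pairs of net points number at most exp(96 d^2 n), and each violates the bound t = 20 d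
  sqrt n with probability at most exp(-100 d^2 n). The net argument doubles t to 40 d sqrt n. The
  case \<open>d = 1\<close> controls the whole matrix.\<close>

lemma prob_not_opb:
  fixes d :: real assumes d: "0 < d" "d \<le> 1" and n: "0 < n"
  shows "measure_pmf.prob (gnp n (1/2)) {E. \<not> opb n E (d ^ 4 * real n) (40 * d * sqrt (real n))}
    \<le> exp (- (4 * d\<^sup>2 * real n))"
proof -
  define m where "m = d ^ 4 * real n"
  define h where "h = 1 / (4 * sqrt m)"
  define t where "t = 20 * d * sqrt (real n)"
  have m: "0 < m" using d n by (simp add: m_def)
  have t: "0 < t" using d n by (simp add: t_def)
  define f where "f z = (\<lambda>i. h * real_of_int (z i))" for z :: "nat \<Rightarrow> int"
  define L where "L = {z \<in> lattice n (16 * m). nsq n (f z) \<le> 1}"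
  have fL: "finite L" unfolding L_def by simp
  have sub: "{E. \<not> opb n E m (40 * d * sqrt (real n))} \<subseteq> (\<Union>zw\<in>L \<times> L. {E. t \<le> bil n E (f (fst zw)) (f (snd zw))})"
  proof
    fix E assume "E \<in> {E. \<not> opb n E m (40 * d * sqrt (real n))}"
    then have "\<not> opb n E m (2 * t)" by (simp add: t_def mult.assoc)
    moreover have "opb n E m (2 * t)" if "\<forall>z\<in>L. \<forall>w\<in>L. bil n E (f z) (f w) \<le> t"
      by (rule opb_of_lattice[OF m h_def]) (use t that in \<open>auto simp: L_def f_def\<close>)
    ultimately obtain z w where "z \<in> L" "w \<in> L" "\<not> bil n E (f z) (f w) \<le> t" by blast
    then have "(z, w) \<in> L \<times> L" "E \<in> {E. t \<le> bil n E (f (fst (z, w))) (f (snd (z, w)))}" by auto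
    then show "E \<in> (\<Union>zw\<in>L \<times> L. {E. t \<le> bil n E (f (fst zw)) (f (snd zw))})" by blast
  qed
  have tail: "measure_pmf.prob (gnp n (1/2)) {E. t \<le> bil n E (f (fst zw)) (f (snd zw))}
     \<le> exp (- (100 * d\<^sup>2 * real n))" if "zw \<in> L \<times> L" for zw
  proof -
    have "measure_pmf.prob (gnp n (1/2)) {E. t \<le> bil n E (f (fst zw)) (f (snd zw))} \<le> exp (- (t\<^sup>2 / (4 * (1 * 1))))"
      using that t by (intro bil_tail) (auto simp: L_def)
    also have "t\<^sup>2 / (4 * (1 * 1)) = 100 * d\<^sup>2 * real n" using n by (simp add: t_def power_mult_distrib)
    finally show ?thesis .
  qed
  have "card L \<le> card (lattice n (16 * m))" unfolding L_def by (intro card_mono) auto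
  then have cL: "real (card L) \<le> exp (48 * d\<^sup>2 * real n)"
    using card_lattice_exp_le[OF d refl, of n] unfolding m_def by linarith
  have "measure_pmf.prob (gnp n (1/2)) {E. \<not> opb n E m (40 * d * sqrt (real n))}
     \<le> real (card (L \<times> L)) * exp (- (100 * d\<^sup>2 * real n))"
    using fL tail sub by (intro prob_union_le) auto
  also have "\<dots> \<le> (exp (48 * d\<^sup>2 * real n) * exp (48 * d\<^sup>2 * real n)) * exp (- (100 * d\<^sup>2 * real n))"
    unfolding card_cartesian_product of_nat_mult using cL by (intro mult_right_mono mult_mono) auto
  also have "\<dots> = exp (- (4 * d\<^sup>2 * real n))" by (simp add: exp_add[symmetric] algebra_simps)
  finally show ?thesis unfolding m_def .
qed

text \<open>The constant is 2 * 0.74 - 1: vertices adjacent to at least 74 percent of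
  \<open>K\<close> would reach it. Fixing the size \<open>s\<close> exactly suffices, since from a
  larger set of such vertices one can pick \<open>s\<close>.\<close>

definition disc :: "nat \<Rightarrow> nat \<Rightarrow> nat \<Rightarrow> (nat \<times> nat) set \<Rightarrow> bool" where
  "disc n k s E \<longleftrightarrow> (\<forall>S K. S \<subseteq> {..<n} \<longrightarrow> K \<subseteq> {..<n} \<longrightarrow> card S = s \<longrightarrow> card K = k \<longrightarrow>
     bil n E (indicator S) (indicator K) < 12 / 25 * (real s * real k))"

lemma nsq_indicator: "S \<subseteq> {..<n} \<Longrightarrow> nsq n (indicator S) = real (card S)"
proof -
  assume S: "S \<subseteq> {..<n}"
  have "nsq n (indicator S) = (\<Sum>i\<in>S. 1)"
    unfolding nsq_def using S by (intro sum.mono_neutral_cong_right) auto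
  then show ?thesis by simp
qed

lemma card_subsets_le: "card {S. S \<subseteq> {..<n} \<and> card S = s} \<le> n ^ s"
proof (cases "s \<le> n")
  case True
  then show ?thesis by (simp add: n_subsets binomial_le_pow)
next
  case False
  then show ?thesis by (simp add: n_subsets binomial_eq_0)
qed

text \<open>Union bound over at most n^(s+k) pairs of sets; 36/625 is (12/25)^2 / 4. The exponential
  wins when \<open>s\<close> is a large enough multiple of log n and k \<ge> s.\<close>

lemma prob_not_disc:
  assumes "0 < s" "0 < k"
  shows "measure_pmf.prob (gnp n (1/2)) {E. \<not> disc n k s E}
    \<le> real n ^ (s + k) * exp (- (36 / 625 * (real s * real k)))"
proof -
  define I where "I = {S. S \<subseteq> {..<n} \<and> card S = s} \<times> {K. K \<subseteq> {..<n} \<and> card K = k}"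
  define t where "t = 12 / 25 * (real s * real k)"
  have fI: "finite I" by (simp add: I_def)
  have tail: "measure_pmf.prob (gnp n (1/2)) {E. t \<le> bil n E (indicator (fst SK)) (indicator (snd SK))}
      \<le> exp (- (36 / 625 * (real s * real k)))" if "SK \<in> I" for SK
  proof -
    have "measure_pmf.prob (gnp n (1/2)) {E. t \<le> bil n E (indicator (fst SK)) (indicator (snd SK))}
       \<le> exp (- (t\<^sup>2 / (4 * (real s * real k))))"
      using that assms by (intro bil_tail) (auto simp: I_def nsq_indicator t_def)
    also have "t\<^sup>2 / (4 * (real s * real k)) = 36 / 625 * (real s * real k)"
      using assms by (simp add: t_def power2_eq_square)
    finally show ?thesis .
  qed
  have "measure_pmf.prob (gnp n (1/2)) {E. \<not> disc n k s E} \<le> real (card I) * exp (- (36 / 625 * (real s * real k)))"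
  proof (rule prob_union_le[OF fI tail])
    show "{E. \<not> disc n k s E} \<subseteq> (\<Union>SK\<in>I. {E. t \<le> bil n E (indicator (fst SK)) (indicator (snd SK))})"
    proof
      fix E assume "E \<in> {E. \<not> disc n k s E}"
      then obtain S K where "(S, K) \<in> I" "t \<le> bil n E (indicator S) (indicator K)"
        unfolding disc_def I_def t_def by (auto simp: not_less)
      then show "E \<in> (\<Union>SK\<in>I. {E. t \<le> bil n E (indicator (fst SK)) (indicator (snd SK))})"
        by (intro UN_I[of "(S, K)"]) auto
    qed
  qed
  also have "\<dots> \<le> real (n ^ s * n ^ k) * exp (- (36 / 625 * (real s * real k)))"
    unfolding I_def card_cartesian_product
    by (intro mult_right_mono of_nat_mono mult_le_mono card_subsets_le) simp
  finally show ?thesis by (simp add: power_add)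
qed

section \<open>Power iteration on the planted graph\<close>

abbreviation nrm :: "nat \<Rightarrow> (nat \<Rightarrow> real) \<Rightarrow> real" where
  "nrm n x \<equiv> L2_set x {..<n}"

lemma nrm_nsq: "nrm n x = sqrt (nsq n x)"
  by (simp add: L2_set_def nsq_def)

lemma nrm_mono: "(\<And>i. i < n \<Longrightarrow> \<bar>x i\<bar> \<le> \<bar>y i\<bar>) \<Longrightarrow> nrm n x \<le> nrm n y"
  unfolding nrm_nsq using nsq_mono by simp

lemma nrm_scale: "nrm n (\<lambda>i. a * x i) = \<bar>a\<bar> * nrm n x"
  unfolding nrm_nsq nsq_scale by (simp add: real_sqrt_mult)

lemma nrm_indicator: "S \<subseteq> {..<n} \<Longrightarrow> nrm n (indicator S) = sqrt (real (card S))"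
  by (simp add: nrm_nsq nsq_indicator)

lemma Cauchy_nrm: "\<bar>\<Sum>i<n. x i * y i\<bar> \<le> nrm n x * nrm n y"
proof -
  have "\<bar>\<Sum>i<n. x i * y i\<bar> \<le> (\<Sum>i<n. \<bar>x i\<bar> * \<bar>y i\<bar>)"
    using sum_abs[of "\<lambda>i. x i * y i" "{..<n}"] by (simp add: abs_mult)
  also have "\<dots> \<le> nrm n x * nrm n y" by (rule L2_set_mult_ineq)
  finally show ?thesis .
qed

lemma sum_indicator_restrict:
  fixes x :: "nat \<Rightarrow> real"
  assumes "K \<subseteq> {..<n}" shows "(\<Sum>i<n. indicator K i * x i) = (\<Sum>i\<in>K. x i)"
  using assms by (intro sum.mono_neutral_cong_right) auto

lemma Cauchy_subset:
  assumes "K \<subseteq> {..<n}" shows "\<bar>\<Sum>i\<in>K. x i\<bar> \<le> sqrt (real (card K)) * nrm n x"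
  using Cauchy_nrm[of "indicator K" x n] unfolding sum_indicator_restrict[OF assms] nrm_indicator[OF assms] .

text \<open>Reflexive, so that the block of \<open>Bm\<close> on a planted clique is all ones
  including the diagonal.\<close>

definition nb :: "(nat \<times> nat) set \<Rightarrow> nat \<Rightarrow> nat \<Rightarrow> bool" where
  "nb G i j \<longleftrightarrow> i = j \<or> adj G i j"

lemma adj_commute: "adj G i j = adj G j i"
  by (auto simp: adj_def min.commute max.commute)

lemma adj_plant: "adj (plant E K) i j \<longleftrightarrow> adj E i j \<or> (i \<noteq> j \<and> i \<in> K \<and> j \<in> K)"
  by (auto simp: adj_def plant_def min_def max_def split: if_splits)

definition Bm :: "(nat \<times> nat) set \<Rightarrow> nat \<Rightarrow> nat \<Rightarrow> real" where
  "Bm G i j = (if nb G i j then 1 else -1)"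

text \<open>Only the rows are cut down to \<open>U\<close>. The iterates started inside
  \<open>U\<close> vanish outside it, so on them this is multiplication by the principal submatrix
  on \<open>U\<close>.\<close>

definition mstep :: "nat \<Rightarrow> (nat \<times> nat) set \<Rightarrow> nat set \<Rightarrow> (nat \<Rightarrow> real) \<Rightarrow> nat \<Rightarrow> real" where
  "mstep n G U x i = (if i \<in> U then \<Sum>h<n. Bm G i h * x h else 0)"

definition iter :: "nat \<Rightarrow> (nat \<times> nat) set \<Rightarrow> nat set \<Rightarrow> nat \<Rightarrow> nat \<Rightarrow> nat \<Rightarrow> real" where
  "iter n G U v t = (mstep n G U ^^ t) (indicator {v})"

lemma mstep_sum: "mstep n G U (\<lambda>h. \<Sum>a\<in>K. f a h) = (\<lambda>i. \<Sum>a\<in>K. mstep n G U (f a) i)"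
proof
  fix i
  have "(\<Sum>h<n. Bm G i h * (\<Sum>a\<in>K. f a h)) = (\<Sum>a\<in>K. \<Sum>h<n. Bm G i h * f a h)"
    unfolding sum_distrib_left by (rule sum.swap)
  then show "mstep n G U (\<lambda>h. \<Sum>a\<in>K. f a h) i = (\<Sum>a\<in>K. mstep n G U (f a) i)"
    by (simp add: mstep_def)
qed

lemma mstep_power_sum: "(mstep n G U ^^ t) (\<lambda>h. \<Sum>a\<in>K. f a h) = (\<lambda>i. \<Sum>a\<in>K. (mstep n G U ^^ t) (f a) i)"
  by (induction t) (simp_all add: mstep_sum)

text \<open>The error vector e is tested against itself: its squared norm is a bilinear form in e
  and x, at most (2L+1) times the product of their norms, and one factor cancels. One
  \<open>L\<close> pays for the sign matrix, one for removing its block on \<open>K\<close>, and 1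
  for the diagonal outside \<open>K\<close>.\<close>

lemma mstep_noise:
  assumes K: "K \<subseteq> U" and U: "U \<subseteq> {..<n}" and op: "opb n E m L" and m: "real (card U) \<le> m" and L: "0 \<le> L"
    and x: "\<And>i. i \<notin> U \<Longrightarrow> x i = 0"
  shows "nrm n (\<lambda>i. mstep n (plant E K) U x i - (\<Sum>h\<in>K. x h) * indicator K i) \<le> (2 * L + 1) * nrm n x"
proof -
  let ?G = "plant E K"
  define s where "s = (\<Sum>h\<in>K. x h)"
  define e where "e i = mstep n ?G U x i - s * indicator K i" for i
  have Kn: "K \<subseteq> {..<n}" using K U by blast
  have e0: "e i = 0" if "i \<notin> U" for i using that K by (auto simp: e_def mstep_def indicator_def)
  define c where "c i = (indicator K i :: real)" for i
  have op': "bil n E a b \<le> L * nrm n a * nrm n b" if "\<And>i. i \<notin> U \<Longrightarrow> a i = 0" "\<And>i. i \<notin> U \<Longrightarrow> b i = 0" for a b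
  proof -
    have "supp n a \<subseteq> U" "supp n b \<subseteq> U" using that by (auto simp: supp_def)
    then have "card (supp n a) \<le> card U" "card (supp n b) \<le> card U"
      using U by (auto intro!: card_mono intro: finite_subset)
    then show ?thesis using op m unfolding opb_def nrm_nsq by auto
  qed
  \<comment> \<open>Entrywise decomposition: sign matrix of \<open>E\<close>, minus its block on
    \<open>K\<close>, plus the diagonal outside \<open>K\<close>, plus the all-ones block on
    \<open>K\<close>.\<close>
  have pt: "Bm ?G i h * e i * x h = sg E i h * e i * x h + sg E i h * (- c i * e i) * (c h * x h)
      + (if i = h then (1 - c i) * e i * x h else 0) + (c i * e i) * (c h * x h)" for i h
    by (auto simp: Bm_def nb_def sg_def c_def indicator_def adj_plant)
  have "nsq n e = (\<Sum>i<n. e i * mstep n ?G U x i) - (\<Sum>i<n. s * (c i * e i))"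
    unfolding nsq_def sum_subtractf[symmetric] by (intro sum.cong) (auto simp: e_def c_def power2_eq_square algebra_simps)
  also have "(\<Sum>i<n. e i * mstep n ?G U x i) = (\<Sum>i<n. \<Sum>h<n. Bm ?G i h * e i * x h)"
  proof (rule sum.cong[OF refl])
    fix i
    show "e i * mstep n ?G U x i = (\<Sum>h<n. Bm ?G i h * e i * x h)"
      using e0[of i] by (cases "i \<in> U") (auto simp: mstep_def sum_distrib_left mult_ac)
  qed
  also have "\<dots> = bil n E e x + bil n E (\<lambda>i. - c i * e i) (\<lambda>h. c h * x h) + (\<Sum>i<n. (1 - c i) * e i * x i)
      + (\<Sum>i<n. c i * e i) * (\<Sum>h<n. c h * x h)"
    unfolding pt bil_def by (simp add: sum.distrib sum_product sum_subtractf sum_negf)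
  also have "(\<Sum>h<n. c h * x h) = s" unfolding c_def s_def by (rule sum_indicator_restrict[OF Kn])
  finally have ne: "nsq n e = bil n E e x + bil n E (\<lambda>i. - c i * e i) (\<lambda>h. c h * x h) + (\<Sum>i<n. (1 - c i) * e i * x i)"
    by (simp add: sum_distrib_left mult_ac)
  have 1: "bil n E e x \<le> L * nrm n e * nrm n x" by (rule op') (auto simp: e0 x)
  have "bil n E (\<lambda>i. - c i * e i) (\<lambda>h. c h * x h) \<le> L * nrm n (\<lambda>i. - c i * e i) * nrm n (\<lambda>h. c h * x h)"
    by (rule op') (auto simp: e0 x)
  also have "\<dots> \<le> L * nrm n e * nrm n x"
    using L by (intro mult_mono mult_left_mono nrm_mono) (auto simp: c_def indicator_def L2_set_nonneg)
  finally have 2: "bil n E (\<lambda>i. - c i * e i) (\<lambda>h. c h * x h) \<le> L * nrm n e * nrm n x" .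
  have "(\<Sum>i<n. (1 - c i) * e i * x i) \<le> nrm n (\<lambda>i. (1 - c i) * e i) * nrm n x"
    using Cauchy_nrm[where x = "\<lambda>i. (1 - c i) * e i" and y = x and n = n] by linarith
  also have "\<dots> \<le> nrm n e * nrm n x"
    by (intro mult_right_mono nrm_mono) (auto simp: c_def indicator_def L2_set_nonneg)
  finally have 3: "(\<Sum>i<n. (1 - c i) * e i * x i) \<le> nrm n e * nrm n x" .
  have "nrm n e * nrm n e \<le> nrm n e * ((2 * L + 1) * nrm n x)"
  proof -
    have "nrm n e * nrm n e = nsq n e" by (simp add: nrm_nsq)
    moreover have "nrm n e * ((2 * L + 1) * nrm n x) = L * nrm n e * nrm n x + L * nrm n e * nrm n x + nrm n e * nrm n x"
      by (simp add: algebra_simps)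
    ultimately show ?thesis using ne 1 2 3 by linarith
  qed
  then have "nrm n e \<le> (2 * L + 1) * nrm n x"
  proof (cases "nrm n e = 0")
    case False
    then have "0 < nrm n e" using L2_set_nonneg[of e "{..<n}"] by linarith
    then show ?thesis using \<open>nrm n e * nrm n e \<le> _\<close> by simp
  qed (use L in \<open>auto simp: L2_set_nonneg\<close>)
  then show ?thesis unfolding e_def s_def .
qed

locale power_iteration =
  fixes n k :: nat and E :: "(nat \<times> nat) set" and K U :: "nat set" and nu :: real
  assumes K: "K \<subseteq> U" and U: "U \<subseteq> {..<n}" and k: "card K = k" "0 < k" and nu: "0 \<le> nu" "80 * nu \<le> real k"
    and noise: "\<And>x. (\<And>i. i \<notin> U \<Longrightarrow> x i = 0) \<Longrightarrow>
      nrm n (\<lambda>i. mstep n (plant E K) U x i - (\<Sum>h\<in>K. x h) * indicator K i) \<le> nu * nrm n x"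
begin

abbreviation "M \<equiv> mstep n (plant E K) U"

definition onU :: "(nat \<Rightarrow> real) \<Rightarrow> bool" where "onU x \<longleftrightarrow> (\<forall>i. i \<notin> U \<longrightarrow> x i = 0)"

abbreviation ss :: "(nat \<Rightarrow> real) \<Rightarrow> real" where "ss x \<equiv> (\<Sum>h\<in>K. x h)"

text \<open>A double cone around the indicator of \<open>K\<close>: the cosine of the angle has
  absolute value at least 1/4.\<close>

definition good :: "(nat \<Rightarrow> real) \<Rightarrow> bool" where
  "good x \<longleftrightarrow> ss x \<noteq> 0 \<and> sqrt (real k) * nrm n x \<le> 4 * \<bar>ss x\<bar>"

definition err :: "(nat \<Rightarrow> real) \<Rightarrow> nat \<Rightarrow> real" where
  "err x i = M x i - ss x * indicator K i"

lemma Kn: "K \<subseteq> {..<n}" using K U by blast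

lemma kn: "k \<le> n" using card_mono[OF _ Kn] k by simp

lemma onU_M: "onU (M x)" by (simp add: onU_def mstep_def)

lemma nrm_err: "onU x \<Longrightarrow> nrm n (err x) \<le> nu * nrm n x"
  unfolding err_def onU_def by (rule noise) auto

lemma M_err: "M x = (\<lambda>i. ss x * indicator K i + err x i)"
  by (simp add: err_def)

lemma nrm_sK: "nrm n (\<lambda>i. a * indicator K i) = \<bar>a\<bar> * sqrt (real k)"
  unfolding nrm_scale nrm_indicator[OF Kn] by (simp add: k)

lemma nrm_M: "onU x \<Longrightarrow> nrm n (M x) \<le> \<bar>ss x\<bar> * sqrt (real k) + nu * nrm n x"
proof -
  assume x: "onU x"
  have "nrm n (M x) \<le> nrm n (\<lambda>i. ss x * indicator K i) + nrm n (err x)"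
    unfolding M_err by (rule L2_set_triangle_ineq)
  then show ?thesis using nrm_err[OF x] unfolding nrm_sK by linarith
qed

lemma sqrt_k: "sqrt (real k) * sqrt (real k) = real k" "0 < sqrt (real k)"
  using k by auto

lemma ss_M: "ss (M x) = real k * ss x + ss (err x)"
proof -
  have "ss (M x) = (\<Sum>i\<in>K. ss x + err x i)" by (intro sum.cong) (auto simp: err_def)
  then show ?thesis using k by (simp add: sum.distrib)
qed

text \<open>On the cone the noise is at most k/80 * 4 = k/20 relative to \<open>ss x\<close>. So
  \<open>ss\<close> grows by a factor of at least 9k/10 while the norm, times sqrt k, is at most
  21k/20 times the old \<open>ss\<close>: the image lies well inside the cone.\<close>

lemma good_step:
  assumes "onU x" "good x"
  shows "good (M x)" "\<bar>ss (M x)\<bar> \<ge> 9 / 10 * real k * \<bar>ss x\<bar>" "sqrt (real k) * nrm n (err x) \<le> real k / 20 * \<bar>ss x\<bar>"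
proof -
  have g: "ss x \<noteq> 0" "sqrt (real k) * nrm n x \<le> 4 * \<bar>ss x\<bar>" using assms by (auto simp: good_def)
  have "sqrt (real k) * nrm n (err x) \<le> sqrt (real k) * (nu * nrm n x)"
    using nrm_err[OF assms(1)] by (intro mult_left_mono) auto
  also have "\<dots> = nu * (sqrt (real k) * nrm n x)" by simp
  also have "\<dots> \<le> real k / 80 * (4 * \<bar>ss x\<bar>)"
    using g nu by (intro mult_mono[of nu]) (auto simp: L2_set_nonneg)
  finally show e: "sqrt (real k) * nrm n (err x) \<le> real k / 20 * \<bar>ss x\<bar>" by simp
  have se: "\<bar>ss (err x)\<bar> \<le> real k / 20 * \<bar>ss x\<bar>"
    using Cauchy_subset[OF Kn, of "err x"] e k by simp
  have ks: "\<bar>real k * ss x\<bar> = real k * \<bar>ss x\<bar>" by (simp add: abs_mult)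
  have low: "\<bar>ss (M x)\<bar> \<ge> real k * \<bar>ss x\<bar> - real k / 20 * \<bar>ss x\<bar>"
    unfolding ss_M using se ks by linarith
  have kp: "0 < real k * \<bar>ss x\<bar>" using g k by simp
  show low': "\<bar>ss (M x)\<bar> \<ge> 9 / 10 * real k * \<bar>ss x\<bar>" using low kp by simp
  have "sqrt (real k) * nrm n (M x) \<le> sqrt (real k) * (\<bar>ss x\<bar> * sqrt (real k) + nrm n (err x))"
  proof (intro mult_left_mono)
    have "nrm n (M x) \<le> nrm n (\<lambda>i. ss x * indicator K i) + nrm n (err x)"
      unfolding M_err by (rule L2_set_triangle_ineq)
    then show "nrm n (M x) \<le> \<bar>ss x\<bar> * sqrt (real k) + nrm n (err x)" unfolding nrm_sK .
  qed simp
  also have "\<dots> = real k * \<bar>ss x\<bar> + sqrt (real k) * nrm n (err x)"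
    using sqrt_k(1) by (simp add: algebra_simps)
  also have "\<dots> \<le> real k * \<bar>ss x\<bar> + real k / 20 * \<bar>ss x\<bar>" using e by simp
  also have "\<dots> \<le> 4 * \<bar>ss (M x)\<bar>" using low' kp by simp
  finally show "good (M x)" unfolding good_def using low' kp by auto
qed

text \<open>Outside the cone the all-ones block contributes at most k/4 times the norm and the noise
  at most k/80.\<close>

lemma not_good_step:
  assumes "onU x" "\<not> good x" shows "nrm n (M x) \<le> real k / 2 * nrm n x"
proof -
  have "4 * \<bar>ss x\<bar> \<le> sqrt (real k) * nrm n x"
    using assms sqrt_k by (auto simp: good_def L2_set_nonneg)
  then have "sqrt (real k) * (4 * \<bar>ss x\<bar>) \<le> sqrt (real k) * (sqrt (real k) * nrm n x)"
    by (intro mult_left_mono) auto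
  then have "4 * (\<bar>ss x\<bar> * sqrt (real k)) \<le> real k * nrm n x"
    using sqrt_k(1) by (simp add: mult.assoc[symmetric]) (simp add: mult_ac)
  moreover have "nu * nrm n x \<le> real k / 80 * nrm n x"
    using nu by (intro mult_right_mono) (auto simp: L2_set_nonneg)
  moreover have "0 \<le> real k * nrm n x" by (simp add: L2_set_nonneg)
  ultimately show ?thesis using nrm_M[OF assms(1)] by linarith
qed

abbreviation "xs v t \<equiv> iter n (plant E K) U v t"

lemma xs_Suc: "xs v (Suc t) = M (xs v t)" by (simp add: iter_def)

lemma onU_xs: "v \<in> K \<Longrightarrow> onU (xs v t)"
  using K by (cases t) (auto simp: xs_Suc onU_M, auto simp: iter_def onU_def indicator_def)

lemma good_mono: "v \<in> K \<Longrightarrow> good (xs v t) \<Longrightarrow> t \<le> t' \<Longrightarrow> good (xs v t')"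
proof (induction t' rule: nat_induct)
  case 0 then show ?case by simp
next
  case (Suc t')
  then show ?case using good_step(1)[OF onU_xs, of v t'] by (cases "t = Suc t'") (auto simp: xs_Suc)
qed

text \<open>An iterate that never becomes good grows by a factor of at most \<open>k / 2\<close> per step, whereas the iterates
  of the indicator of \<open>K\<close>, which are the sums of the iterates of its vertices, grow by at least \<open>9 k / 10\<close>.\<close>

lemma exists_good: "\<exists>v\<in>K. good (xs v (n - 1))"
proof (rule ccontr)
  assume "\<not> (\<exists>v\<in>K. good (xs v (n - 1)))"
  \<comment> \<open>The cone is invariant under \<open>M\<close>, so being outside at time
    \<open>n - 1\<close> means being outside at every earlier time.\<close>
  have ng: "\<not> good (xs v t)" if "v \<in> K" "t < n" for v t
  proof -
    have "t \<le> n - 1" using that by linarith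
    then show ?thesis using \<open>\<not> (\<exists>v\<in>K. good (xs v (n - 1)))\<close> good_mono[of v t "n - 1"] that by blast
  qed
  have small: "nrm n (xs v t) \<le> (real k / 2) ^ t" if v: "v \<in> K" and t: "t \<le> n" for v t
    using t
  proof (induction t)
    case 0
    have "{v} \<subseteq> {..<n}" using v Kn by auto
    then have "nrm n (indicator {v}) = 1" by (subst nrm_indicator) auto
    then show ?case by (simp add: iter_def)
  next
    case (Suc t)
    have "nrm n (xs v (Suc t)) \<le> real k / 2 * nrm n (xs v t)"
      unfolding xs_Suc by (rule not_good_step[OF onU_xs[OF v] ng[OF v]]) (use Suc in simp)
    also have "\<dots> \<le> real k / 2 * (real k / 2) ^ t" using Suc by (intro mult_left_mono) auto
    finally show ?case by simp
  qed
  define y where "y t = (M ^^ t) (indicator K)" for t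
  have fK: "finite K" using Kn finite_subset by blast
  have "(indicator K :: nat \<Rightarrow> real) = (\<lambda>h. \<Sum>v\<in>K. indicator {v} h)"
  proof
    fix h
    have "(\<Sum>v\<in>K. indicator {v} h) = (\<Sum>v\<in>K. if v = h then 1 else 0 :: real)"
      by (intro sum.cong) (auto simp: indicator_def)
    then show "indicator K h = (\<Sum>v\<in>K. indicator {v} h :: real)"
      using fK by (simp add: indicator_def)
  qed
  then have y_sum: "y t = (\<lambda>i. \<Sum>v\<in>K. xs v t i)" for t
    unfolding y_def iter_def by (simp add: mstep_power_sum)
  have yg: "good (y t) \<and> onU (y t) \<and> real k * (9 / 10 * real k) ^ t \<le> \<bar>ss (y t)\<bar>" for t
  proof (induction t)
    case 0
    have "ss (indicator K) = real k" using k by simp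
    moreover have "nrm n (indicator K) = sqrt (real k)" using k by (simp add: nrm_indicator[OF Kn])
    ultimately have "good (indicator K)" unfolding good_def using k sqrt_k by simp
    moreover have "onU (indicator K)" using K by (auto simp: onU_def indicator_def)
    ultimately show ?case using \<open>ss (indicator K) = real k\<close> by (simp add: y_def)
  next
    case (Suc t)
    have "y (Suc t) = M (y t)" by (simp add: y_def)
    moreover have "real k * (9 / 10 * real k) ^ Suc t \<le> 9 / 10 * real k * \<bar>ss (y t)\<bar>"
      using Suc mult_left_mono[of "real k * (9 / 10 * real k) ^ t" "\<bar>ss (y t)\<bar>" "9 / 10 * real k"]
      by (simp add: mult_ac)
    moreover have "good (M (y t))" "9 / 10 * real k * \<bar>ss (y t)\<bar> \<le> \<bar>ss (M (y t))\<bar>"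
      using Suc good_step(1,2)[of "y t"] by blast+
    ultimately show ?case using onU_M[of "y t"] by simp
  qed
  have "real k * (9 / 10 * real k) ^ n \<le> \<bar>ss (y n)\<bar>" using yg by blast
  also have "ss (y n) = (\<Sum>v\<in>K. ss (xs v n))" unfolding y_sum by (rule sum.swap)
  also have "\<bar>\<dots>\<bar> \<le> (\<Sum>v\<in>K. \<bar>ss (xs v n)\<bar>)" by (rule sum_abs)
  also have "\<dots> \<le> (\<Sum>v\<in>K. sqrt (real k) * (real k / 2) ^ n)"
  proof (rule sum_mono)
    fix v assume v: "v \<in> K"
    have "\<bar>ss (xs v n)\<bar> \<le> sqrt (real k) * nrm n (xs v n)" using Cauchy_subset[OF Kn] k by simp
    also have "\<dots> \<le> sqrt (real k) * (real k / 2) ^ n" using small[OF v] by (intro mult_left_mono) auto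
    finally show "\<bar>ss (xs v n)\<bar> \<le> sqrt (real k) * (real k / 2) ^ n" .
  qed
  also have "\<dots> = real k * (sqrt (real k) * (real k / 2) ^ n)" using k by simp
  finally have "(9 / 10 * real k) ^ n \<le> sqrt (real k) * (real k / 2) ^ n" using k by simp
  also have "(9 / 10 * real k) ^ n = (9 / 5) ^ n * (real k / 2) ^ n"
    by (subst power_mult_distrib[symmetric]) simp
  finally have "(9 / 5) ^ n \<le> sqrt (real k)"
    by (rule mult_right_le_imp_le) (use k in simp)
  \<comment> \<open>The ratio of the two growth rates is 9/5. Bernoulli makes its n-th power at
    least 1 + 4n/5, while sqrt k \<le> (1 + n)/2.\<close>
  moreover have "1 + real n * (4 / 5) \<le> (1 + 4 / 5) ^ n" by (rule Bernoulli_inequality) simp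
  then have "1 + real n * (4 / 5) \<le> (9 / 5) ^ n" by simp
  ultimately have "1 + real n * (4 / 5) \<le> sqrt (real k)" by (rule order.trans[rotated])
  moreover have "sqrt (real k) \<le> (1 + real k) / 2"
    using arith_geo_mean_sqrt[of 1 "real k"] by simp
  moreover have "real k \<le> real n" "1 \<le> real k" using kn k by auto
  ultimately show False by (simp add: field_simps | linarith | argo)
qed

text \<open>One more step from a good iterate gives s times the indicator of \<open>K\<close> plus
  an error of squared norm at most k s^2 / 400, so at most k/100 coordinates have error |s|/2 or
  more. A cut just above |s|/2 is therefore right except at those coordinates.\<close>

lemma extraction:
  "\<exists>v\<in>K. \<exists>g<n. let x = xs v n; S = {h. h < n \<and> \<bar>x g\<bar> \<le> \<bar>x h\<bar>} in
     100 * card (K - S) \<le> k \<and> 100 * card (S - K) \<le> k"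
proof -
  obtain v where v: "v \<in> K" "good (xs v (n - 1))" using exists_good by blast
  define z where "z = xs v (n - 1)"
  define x where "x = xs v n"
  define e where "e = err z"
  define s where "s = ss z"
  have n: "0 < n" using kn k by simp
  have xz: "x = M z" unfolding x_def z_def using xs_Suc[of v "n - 1"] n by simp
  have xi: "x i = s * indicator K i + e i" for i unfolding xz e_def s_def by (simp add: err_def)
  have gz: "onU z" "good z" unfolding z_def using v onU_xs by auto
  have s0: "s \<noteq> 0" using gz by (simp add: good_def s_def)
  have "sqrt (real k) * nrm n e \<le> real k / 20 * \<bar>s\<bar>" using good_step(3)[OF gz] by (simp add: e_def s_def)
  then have "(sqrt (real k) * nrm n e)\<^sup>2 \<le> (real k / 20 * \<bar>s\<bar>)\<^sup>2"
    by (intro power_mono) (auto simp: L2_set_nonneg)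
  then have "real k * nsq n e \<le> real k * (real k * s\<^sup>2 / 400)"
    by (simp add: power_mult_distrib nrm_nsq power_divide power2_eq_square[of "real k"])
  then have ne: "nsq n e \<le> real k * s\<^sup>2 / 400" using k by simp
  define bad where "bad = {i. i < n \<and> \<bar>s\<bar> / 2 \<le> \<bar>e i\<bar>}"
  have fb: "finite bad" by (simp add: bad_def)
  have "real (card bad) * (s\<^sup>2 / 4) = (\<Sum>i\<in>bad. s\<^sup>2 / 4)" by simp
  also have "\<dots> \<le> (\<Sum>i\<in>bad. (e i)\<^sup>2)"
  proof (rule sum_mono)
    fix i assume "i \<in> bad"
    then have "(\<bar>s\<bar> / 2)\<^sup>2 \<le> \<bar>e i\<bar>\<^sup>2" by (intro power_mono) (auto simp: bad_def)
    then show "s\<^sup>2 / 4 \<le> (e i)\<^sup>2" by (simp add: power_divide)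
  qed
  also have "\<dots> \<le> nsq n e" unfolding nsq_def by (intro sum_mono2) (auto simp: bad_def)
  finally have "real (card bad) * (s\<^sup>2 / 4) \<le> real k * s\<^sup>2 / 400" using ne by linarith
  then have "real (card bad) * 100 * (s\<^sup>2 / 400) \<le> real k * (s\<^sup>2 / 400)" by simp
  then have cb: "100 * card bad \<le> k" using s0 by (simp del: times_divide_eq_right)
  have fK: "finite K" using Kn finite_subset by blast
  define Gd where "Gd = K - bad"
  have "card bad < card K" using cb k by linarith
  then have Gne: "Gd \<noteq> {}" unfolding Gd_def using fb card_mono[of bad K] by auto
  have "finite Gd" using fK by (simp add: Gd_def)
  \<comment> \<open>The threshold is attained at a vertex: \<open>g\<close> minimises the absolute
    entry over the accurately recovered part of \<open>K\<close>, so it keeps all of that part and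
    still exceeds |s|/2.\<close>
  then have "Min ((\<lambda>h. \<bar>x h\<bar>) ` Gd) \<in> (\<lambda>h. \<bar>x h\<bar>) ` Gd" using Gne by (intro Min_in) auto
  then obtain g where g1: "g \<in> Gd" "Min ((\<lambda>h. \<bar>x h\<bar>) ` Gd) = \<bar>x g\<bar>" by blast
  have g: "g \<in> Gd" "\<And>h. h \<in> Gd \<Longrightarrow> \<bar>x g\<bar> \<le> \<bar>x h\<bar>"
    using g1 \<open>finite Gd\<close> by (auto simp flip: g1(2))
  define S where "S = {h. h < n \<and> \<bar>x g\<bar> \<le> \<bar>x h\<bar>}"
  have gK: "g \<in> K" "g < n" "\<bar>e g\<bar> < \<bar>s\<bar> / 2" using g(1) Kn by (auto simp: Gd_def bad_def)
  have "x g = s + e g" using gK xi by simp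
  then have xg: "\<bar>s\<bar> / 2 < \<bar>x g\<bar>" using gK(3) by linarith
  have "K - S \<subseteq> bad" using g(2) Kn by (auto simp: S_def Gd_def)
  moreover have "S - K \<subseteq> bad"
  proof
    fix h assume h: "h \<in> S - K"
    then have "x h = e h" by (simp add: xi)
    then show "h \<in> bad" using h xg by (auto simp: S_def bad_def)
  qed
  ultimately have "card (K - S) \<le> card bad" "card (S - K) \<le> card bad" using fb by (auto intro: card_mono)
  then have "100 * card (K - S) \<le> k \<and> 100 * card (S - K) \<le> k" using cb by linarith
  then show ?thesis using v(1) gK(2) unfolding S_def x_def Let_def by blast
qed

end

section \<open>From the iterate to a maximum clique\<close>

text \<open>The count is compared with 3k/4, as \<open>k\<close> is an input and the threshold set
  has nearly \<open>k\<close> elements. Absolute values are used because the iterate may be close to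
  a negative multiple of the indicator.\<close>

definition fset :: "nat \<Rightarrow> nat \<Rightarrow> (nat \<times> nat) set \<Rightarrow> (nat \<Rightarrow> real) \<Rightarrow> nat \<Rightarrow> nat set" where
  "fset n k G x g = {i. i < n \<and> 3 * k \<le> 4 * card {h. h < n \<and> \<bar>x g\<bar> \<le> \<bar>x h\<bar> \<and> nb G i h}}"

lemma is_clique_plant: "K \<subseteq> {..<n} \<Longrightarrow> is_clique n (plant E K) K"
  by (auto simp: is_clique_def adj_plant)

text \<open>\<open>D - K\<close> is a clique of the unplanted graph, hence has at most k/10
  vertices; as \<open>D\<close> is at least as large as \<open>K\<close>, it also misses at most
  k/10 of \<open>K\<close>. So \<open>D\<close> contains at least 89 percent of \<open>K\<close>
  within \<open>S\<close>, all adjacent or equal to each member of \<open>D\<close>.\<close>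

lemma max_clique_subset_fset:
  assumes K: "K \<subseteq> {..<n}" "card K = k"
    and S: "S = {h. h < n \<and> \<bar>x g\<bar> \<le> \<bar>x h\<bar>}" "100 * card (K - S) \<le> k"
    and D: "is_max_clique n (plant E K) D"
    and clq: "\<And>T. is_clique n E T \<Longrightarrow> 10 * card T \<le> k"
  shows "D \<subseteq> fset n k (plant E K) x g"
proof
  fix v assume v: "v \<in> D"
  have Dn: "D \<subseteq> {..<n}" using D by (auto simp: is_max_clique_def is_clique_def)
  have fD: "finite D" "finite K" using Dn K finite_subset by blast+
  have cD: "card K \<le> card D" using D is_clique_plant[OF K(1)] by (auto simp: is_max_clique_def)
  have "is_clique n E (D - K)"
    using D by (auto simp: is_max_clique_def is_clique_def adj_plant)
  then have "10 * card (D - K) \<le> k" by (rule clq)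
  moreover have "card (K - D) \<le> card (D - K)" using fD cD by (intro card_le_sym_Diff)
  ultimately have KD: "10 * card (K - D) \<le> k" by linarith
  have "K \<subseteq> (K \<inter> S \<inter> D) \<union> ((K - S) \<union> (K - D))" by auto
  then have "card K \<le> card ((K \<inter> S \<inter> D) \<union> ((K - S) \<union> (K - D)))" using fD by (intro card_mono) auto
  also have "\<dots> \<le> card (K \<inter> S \<inter> D) + card ((K - S) \<union> (K - D))" by (rule card_Un_le)
  also have "\<dots> \<le> card (K \<inter> S \<inter> D) + (card (K - S) + card (K - D))" using card_Un_le by (rule add_left_mono)
  finally have big: "3 * k \<le> 4 * card (K \<inter> S \<inter> D)" using KD S(2) K(2) by linarith
  have "card (K \<inter> S \<inter> D) \<le> card {h. h < n \<and> \<bar>x g\<bar> \<le> \<bar>x h\<bar> \<and> nb (plant E K) v h}"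
    using D v by (intro card_mono) (auto simp: S nb_def is_max_clique_def is_clique_def)
  then show "v \<in> fset n k (plant E K) x g" using big Dn v by (auto simp: fset_def)
qed

lemma subset_fset:
  assumes K: "K \<subseteq> {..<n}" "card K = k"
    and S: "S = {h. h < n \<and> \<bar>x g\<bar> \<le> \<bar>x h\<bar>}" "100 * card (K - S) \<le> k"
  shows "K \<subseteq> fset n k (plant E K) x g"
proof
  fix v assume v: "v \<in> K"
  have fK: "finite K" using K finite_subset by blast
  have "card K = card (K \<inter> S) + card (K - S)" using fK by (rule card_Int_Diff)
  then have big: "3 * k \<le> 4 * card (K \<inter> S)" using S(2) K(2) by linarith
  have "card (K \<inter> S) \<le> card {h. h < n \<and> \<bar>x g\<bar> \<le> \<bar>x h\<bar> \<and> nb (plant E K) v h}"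
    using v by (intro card_mono) (auto simp: S nb_def adj_plant)
  then show "v \<in> fset n k (plant E K) x g" using big K v by (auto simp: fset_def)
qed

lemma bil_indicator:
  assumes "S \<subseteq> {..<n}" "K \<subseteq> {..<n}"
  shows "bil n E (indicator S) (indicator K) = (\<Sum>v\<in>S. \<Sum>h\<in>K. sg E v h)"
proof -
  have "(\<Sum>j<n. sg E i j * indicator S i * indicator K j) = indicator S i * (\<Sum>h\<in>K. sg E i h)" for i
  proof -
    have "(\<Sum>j<n. sg E i j * indicator S i * indicator K j) = (\<Sum>j<n. indicator K j * (indicator S i * sg E i j))"
      by (intro sum.cong refl) (simp only: mult_ac)
    also have "\<dots> = (\<Sum>j\<in>K. indicator S i * sg E i j)" by (rule sum_indicator_restrict[OF assms(2)])
    finally show ?thesis by (simp only: sum_distrib_left)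
  qed
  then have "bil n E (indicator S) (indicator K) = (\<Sum>i<n. indicator S i * (\<Sum>h\<in>K. sg E i h))"
    unfolding bil_def by simp
  also have "\<dots> = (\<Sum>v\<in>S. \<Sum>h\<in>K. sg E v h)" by (rule sum_indicator_restrict[OF assms(1)])
  finally show ?thesis .
qed

lemma sum_sg:
  assumes "finite K" "v \<notin> K"
  shows "(\<Sum>h\<in>K. sg E v h) = 2 * real (card {h\<in>K. adj E v h}) - real (card K)"
proof -
  have "(\<Sum>h\<in>K. sg E v h) = (\<Sum>h\<in>K. 2 * (if adj E v h then 1 else 0) - 1)"
    using assms by (intro sum.cong) (auto simp: sg_def)
  also have "\<dots> = 2 * (\<Sum>h\<in>K. if adj E v h then 1 else 0) - real (card K)"
    by (simp add: sum_subtractf sum_distrib_left)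
  also have "(\<Sum>h\<in>K. if adj E v h then 1 else 0 :: real) = real (card {h\<in>K. adj E v h})"
    using assms(1) by (simp add: sum.If_cases Int_def)
  finally show ?thesis .
qed

text \<open>Replacing \<open>S\<close> by \<open>K\<close> loses at most 1 percent, so a vertex
  outside \<open>K\<close> that passes the test has 74 percent of \<open>K\<close> as neighbours,
  and these edges belong to \<open>E\<close>. \<open>s\<close> such vertices would contradict
  \<open>disc\<close>.\<close>

lemma card_fset_diff:
  assumes K: "K \<subseteq> {..<n}" "card K = k"
    and S: "S = {h. h < n \<and> \<bar>x g\<bar> \<le> \<bar>x h\<bar>}" "100 * card (S - K) \<le> k"
    and dsc: "disc n k s E"
  shows "card (fset n k (plant E K) x g - K) < s"
proof (rule ccontr)
  let ?F = "fset n k (plant E K) x g"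
  assume "\<not> card (?F - K) < s"
  then obtain T where T: "T \<subseteq> ?F - K" "card T = s" using obtain_subset_with_card_n[of s "?F - K"] by (auto simp: not_less)
  have Tn: "T \<subseteq> {..<n}" using T by (auto simp: fset_def)
  have fK: "finite K" using K finite_subset by blast
  have "12 / 25 * real k \<le> (\<Sum>h\<in>K. sg E v h)" if v: "v \<in> T" for v
  proof -
    have vF: "v \<in> ?F" "v \<notin> K" using v T by auto
    let ?H = "{h. h < n \<and> \<bar>x g\<bar> \<le> \<bar>x h\<bar> \<and> nb (plant E K) v h}"
    have "?H \<subseteq> {h\<in>K. adj E v h} \<union> (S - K)" using vF by (auto simp: S nb_def adj_plant)
    then have "card ?H \<le> card ({h\<in>K. adj E v h} \<union> (S - K))" using fK by (intro card_mono) (auto simp: S)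
    also have "\<dots> \<le> card {h\<in>K. adj E v h} + card (S - K)" by (rule card_Un_le)
    finally have "3 * k \<le> 4 * (card {h\<in>K. adj E v h} + card (S - K))" using vF by (simp add: fset_def)
    moreover have "3 * k \<le> 4 * (a + b) \<Longrightarrow> 100 * b \<le> k \<Longrightarrow> 74 * k \<le> 100 * a" for a b :: nat by presburger
    ultimately have "74 * k \<le> 100 * card {h\<in>K. adj E v h}" using S(2) by blast
    then have "74 * real k \<le> 100 * real (card {h\<in>K. adj E v h})" by linarith
    then show ?thesis using sum_sg[OF fK vF(2), of E] K(2) by linarith
  qed
  then have "(\<Sum>v\<in>T. 12 / 25 * real k) \<le> (\<Sum>v\<in>T. \<Sum>h\<in>K. sg E v h)" by (rule sum_mono)
  then have "12 / 25 * (real s * real k) \<le> bil n E (indicator T) (indicator K)"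
    unfolding bil_indicator[OF Tn K(1)] using T(2) by simp
  moreover have "bil n E (indicator T) (indicator K) < 12 / 25 * (real s * real k)"
    using dsc Tn K T(2) unfolding disc_def by blast
  ultimately show False by (simp add: not_le[symmetric])
qed

text \<open>The indicator of a clique of size c has form value c(c-1), while the norm bound allows
  at most L c.\<close>

lemma clique_bound:
  assumes op: "opb n E m L" and T: "is_clique n E T" and c: "real (card T) \<le> m" and L: "0 \<le> L"
  shows "real (card T) \<le> L + 1"
proof (cases "card T = 0")
  case True
  then show ?thesis using L by simp
next
  case False
  have Tn: "T \<subseteq> {..<n}" using T by (simp add: is_clique_def)
  have fT: "finite T" using Tn finite_subset by blast
  define d where "d = card T"
  have d: "0 < d" using False by (simp add: d_def)
  have "(\<Sum>h\<in>T. sg E v h) = real d - 1" if v: "v \<in> T" for v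
  proof -
    have "(\<Sum>h\<in>T. sg E v h) = (\<Sum>h\<in>T - {v}. 1)"
      using T v fT by (intro sum.mono_neutral_cong_right) (auto simp: sg_def is_clique_def)
    also have "\<dots> = real d - 1" using v fT d by (simp add: d_def of_nat_diff Suc_leI)
    finally show ?thesis .
  qed
  then have "bil n E (indicator T) (indicator T) = real d * (real d - 1)"
    unfolding bil_indicator[OF Tn Tn] by (simp add: d_def)
  moreover have "supp n (indicator T) = T" using Tn by (auto simp: supp_def indicator_def)
  then have "bil n E (indicator T) (indicator T) \<le> L * sqrt (nsq n (indicator T)) * sqrt (nsq n (indicator T))"
    using op c unfolding opb_def by simp
  then have "bil n E (indicator T) (indicator T) \<le> L * sqrt (real d) * sqrt (real d)"
    unfolding nsq_indicator[OF Tn] d_def .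
  ultimately have "real d * (real d - 1) \<le> real d * L" by (simp add: mult_ac)
  then have "real d - 1 \<le> L" using d by simp
  then show ?thesis by (simp add: d_def)
qed

text \<open>Otherwise the form between \<open>K\<close> and \<open>X\<close> exceeds |X| k / 5,
  while the norm bound allows only L times the square root of |X| k; this fails once |X| k \<ge> 25
  L^2.\<close>

lemma exists_low_degree:
  assumes op: "opb n E (real n) L" and L: "0 < L" and K: "K \<subseteq> {..<n}" "card K = k" "0 < k"
    and X: "X \<subseteq> {..<n} - K" "25 * L\<^sup>2 \<le> real (card X) * real k"
  shows "\<exists>v\<in>K. real (card {u\<in>X. adj E v u}) \<le> 3 / 5 * real (card X)"
proof (rule ccontr)
  assume "\<not> ?thesis"
  then have big: "3 / 5 * real (card X) < real (card {u\<in>X. adj E v u})" if "v \<in> K" for v using that by auto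
  have fX: "finite X" "finite K" using X K finite_subset by blast+
  have Xn: "X \<subseteq> {..<n}" using X by auto
  define c where "c = real (card X) * real k"
  have "0 < 25 * L\<^sup>2" using L by simp
  then have c: "0 < c" using X(2) unfolding c_def by (rule less_le_trans)
  have "(\<Sum>v\<in>K. 1 / 5 * real (card X)) < (\<Sum>v\<in>K. \<Sum>u\<in>X. sg E v u)"
  proof (rule sum_strict_mono)
    show "finite K" "K \<noteq> {}" using fX K by auto
    fix v assume v: "v \<in> K"
    then have "v \<notin> X" using X by auto
    then show "1 / 5 * real (card X) < (\<Sum>u\<in>X. sg E v u)"
      using sum_sg[OF fX(1), of v E] big[OF v] by linarith
  qed
  then have "1 / 5 * c < bil n E (indicator K) (indicator X)"
    unfolding bil_indicator[OF K(1) Xn] using K by (simp add: c_def mult_ac)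
  also have "\<dots> \<le> L * sqrt (nsq n (indicator K)) * sqrt (nsq n (indicator X))"
  proof -
    have "card (supp n y) \<le> n" for y using card_mono[of "{..<n}" "supp n y"] by (auto simp: supp_def)
    then show ?thesis using op unfolding opb_def by simp
  qed
  also have "\<dots> = L * sqrt c"
    unfolding nsq_indicator[OF K(1)] nsq_indicator[OF Xn] by (simp add: c_def K real_sqrt_mult mult_ac)
  finally have "sqrt c * sqrt c < (5 * L) * sqrt c" using c by simp
  then have "sqrt c < 5 * L" by (rule mult_right_less_imp_less) (use c in simp)
  then have "(sqrt c)\<^sup>2 < (5 * L)\<^sup>2" using c by (intro power_strict_mono) auto
  then have "c < (5 * L)\<^sup>2" using c by simp
  then show False using X(2) by (simp add: c_def power_mult_distrib)
qed

definition cnb :: "nat \<Rightarrow> (nat \<times> nat) set \<Rightarrow> nat list \<Rightarrow> nat set" where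
  "cnb n G vs = {u. u < n \<and> (\<forall>v\<in>set vs. nb G u v)}"

text \<open>Greedy choice: as long as at least \<open>mu\<close> outsiders survive, some vertex of
  \<open>K\<close> keeps at most 3/5 of them. Below \<open>mu\<close> any vertex of \<open>K\<close>
  will do, since the set only shrinks; this lets \<open>t\<close> be fixed in advance.\<close>

lemma exists_seeds:
  fixes mu :: real
  assumes op: "opb n E (real n) L" and L: "0 < L" and K: "K \<subseteq> {..<n}" "card K = k" "0 < k"
    and mu: "25 * L\<^sup>2 \<le> mu * real k"
  shows "\<exists>vs. length vs = t \<and> set vs \<subseteq> K \<and> K \<subseteq> cnb n (plant E K) vs \<and>
    real (card (cnb n (plant E K) vs - K)) \<le> max mu ((3 / 5) ^ t * real n)"
proof (induction t)
  case 0
  have "card (cnb n (plant E K) [] - K) \<le> card {..<n}" by (intro card_mono) (auto simp: cnb_def)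
  then show ?case using K by (intro exI[of _ "[]"]) (auto simp: cnb_def)
next
  case (Suc t)
  then obtain vs where vs: "length vs = t" "set vs \<subseteq> K" "K \<subseteq> cnb n (plant E K) vs"
    "real (card (cnb n (plant E K) vs - K)) \<le> max mu ((3 / 5) ^ t * real n)" by blast
  define X where "X = cnb n (plant E K) vs - K"
  have X: "X \<subseteq> {..<n} - K" by (auto simp: X_def cnb_def)
  then have fX: "finite X" using finite_subset by blast
  have ext: "cnb n (plant E K) (v # vs) - K = {u\<in>X. adj E v u}" "K \<subseteq> cnb n (plant E K) (v # vs)" if "v \<in> K" for v
    using that vs(3) by (auto simp: X_def cnb_def nb_def adj_plant adj_commute)
  obtain v where v: "v \<in> K" "real (card {u\<in>X. adj E v u}) \<le> max mu ((3 / 5) ^ Suc t * real n)"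
  proof (cases "mu \<le> real (card X)")
    case True
    then have "25 * L\<^sup>2 \<le> real (card X) * real k" using mu by (meson mult_right_mono of_nat_0_le_iff order.trans)
    from exists_low_degree[OF op L K X this] obtain v where v: "v \<in> K"
      "real (card {u\<in>X. adj E v u}) \<le> 3 / 5 * real (card X)" by blast
    have "3 / 5 * real (card X) \<le> max mu ((3 / 5) ^ Suc t * real n)"
      using vs(4) unfolding X_def[symmetric] by (auto simp: max_def mult_ac split: if_splits)
    then show thesis using that v by force
  next
    case False
    obtain v where v: "v \<in> K" using K by fastforce
    have "card {u\<in>X. adj E v u} \<le> card X" using fX by (intro card_mono) auto
    then show thesis using that[OF v] False by linarith
  qed
  have "length (v # vs) = Suc t" "set (v # vs) \<subseteq> K" using vs v by auto
  then show ?case using ext[OF v(1)] v(2) by (intro exI[of _ "v # vs"]) simp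
qed

subsection \<open>Vertex-cover branching\<close>

text \<open>The guessed bits are packed into a number \<open>z\<close>, read from the least significant end; the leading
  1 of \<open>z\<close> only marks the end of the string.\<close>

definition conf :: "(nat \<times> nat) set \<Rightarrow> nat set \<Rightarrow> nat \<Rightarrow> nat \<Rightarrow> bool" where
  "conf G F u v \<longleftrightarrow> u \<in> F \<and> v \<in> F \<and> \<not> nb G u v"

fun brk :: "(nat \<times> nat) set \<Rightarrow> nat \<times> nat \<Rightarrow> nat set \<times> nat \<Rightarrow> nat set \<times> nat" where
  "brk G (u, v) (F, z) = (if conf G F u v \<and> z div 2 \<noteq> 0
     then (if odd z then F - {u} else F - {v}, z div 2) else (F, z))"

lemma brk_subset: "fst (fold (brk G) ps (F, z)) \<subseteq> F"
proof (induction ps arbitrary: F z)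
  case (Cons p ps)
  obtain F' z' where b: "brk G p (F, z) = (F', z')" by fastforce
  then have "F' \<subseteq> F" by (cases p) (auto split: if_splits)
  then show ?case using Cons[of F' z'] b by simp
qed simp

lemma brk_one: "fold (brk G) ps (F, 1) = (F, 1)"
  by (induction ps) auto

text \<open>Each conflicting pair has an endpoint outside the clique \<open>D\<close>, and the right
  bit deletes it. Hence either all \<open>q\<close> bits are spent, each removing a vertex of
  \<open>F - D\<close>, or the scan ends with every scanned pair settled. Sets only shrink, so
  settled pairs never conflict again and one scan is enough.\<close>

lemma branching_code:
  assumes "finite F" "D \<subseteq> F" "\<And>u v. u \<in> D \<Longrightarrow> v \<in> D \<Longrightarrow> nb G u v"
  shows "\<exists>z\<ge>1. z < 2 ^ Suc q \<and> (let F' = fst (fold (brk G) ps (F, z)) in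
     D \<subseteq> F' \<and> (card (F' - D) + q \<le> card (F - D) \<or> (\<forall>(u, v)\<in>set ps. \<not> conf G F' u v)))"
  using assms
proof (induction ps arbitrary: F q)
  case Nil
  have "(1::nat) < 2 ^ Suc q" by (rule one_less_power) auto
  with Nil show ?case by (intro exI[of _ 1]) simp
next
  case (Cons p ps)
  obtain u v where p: "p = (u, v)" by fastforce
  show ?case
  proof (cases "conf G F u v")
    case False
    from Cons.IH[OF Cons.prems, of q] obtain z where z: "1 \<le> z" "z < 2 ^ Suc q"
      "let F' = fst (fold (brk G) ps (F, z)) in
       D \<subseteq> F' \<and> (card (F' - D) + q \<le> card (F - D) \<or> (\<forall>(u, v)\<in>set ps. \<not> conf G F' u v))" by blast
    have "\<not> conf G (fst (fold (brk G) ps (F, z))) u v"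
      using False brk_subset[of G ps F z] by (auto simp: conf_def)
    moreover have "fold (brk G) (p # ps) (F, z) = fold (brk G) ps (F, z)" using False by (simp add: p)
    ultimately have "let F' = fst (fold (brk G) (p # ps) (F, z)) in
       D \<subseteq> F' \<and> (card (F' - D) + q \<le> card (F - D) \<or> (\<forall>(u, v)\<in>set (p # ps). \<not> conf G F' u v))"
      using z(3) by (simp only: Let_def p list.set) blast
    then show ?thesis using z(1,2) by blast
  next
    case True
    show ?thesis
    proof (cases q)
      case 0
      have "fold (brk G) (p # ps) (F, 1) = (F, 1)" by (rule brk_one)
      then show ?thesis using 0 Cons.prems(2) by (intro exI[of _ 1]) (simp only: Let_def fst_conv, simp)
    next
      case (Suc q')
      \<comment> \<open>Bit 1 deletes \<open>u\<close> and bit 0 deletes \<open>v\<close>; the bit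
        is chosen so that the deleted vertex \<open>w\<close> avoids \<open>D\<close>.\<close>
      define b where "b = (if u \<in> D then 0 else 1 :: nat)"
      define w where "w = (if u \<in> D then v else u)"
      have w: "w \<in> F" "w \<notin> D" using True Cons.prems(3)[of u v] by (auto simp: w_def conf_def)
      have "\<exists>z\<ge>1. z < 2 ^ Suc q' \<and> (let F' = fst (fold (brk G) ps (F - {w}, z)) in
        D \<subseteq> F' \<and> (card (F' - D) + q' \<le> card (F - {w} - D) \<or> (\<forall>(u, v)\<in>set ps. \<not> conf G F' u v)))"
        by (rule Cons.IH) (use Cons.prems(1,2) w in blast, use Cons.prems(2) w in blast, rule Cons.prems(3))
      then obtain z where z: "1 \<le> z" "z < 2 ^ Suc q'" "let F' = fst (fold (brk G) ps (F - {w}, z)) in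
        D \<subseteq> F' \<and> (card (F' - D) + q' \<le> card (F - {w} - D) \<or> (\<forall>(u, v)\<in>set ps. \<not> conf G F' u v))" by blast
      define F' where "F' = fst (fold (brk G) ps (F - {w}, z))"
      have d: "(2 * z + b) div 2 = z" "odd (2 * z + b) = (u \<notin> D)" by (auto simp: b_def)
      have st: "fold (brk G) (p # ps) (F, 2 * z + b) = fold (brk G) ps (F - {w}, z)"
        using True z(1) unfolding p fold_simps brk.simps d by (auto simp: w_def)
      have "w \<notin> F'" unfolding F'_def using brk_subset[of G ps "F - {w}" z] by auto
      then have nc: "\<not> conf G F' u v" by (auto simp: conf_def w_def split: if_splits)
      have "F - {w} - D = (F - D) - {w}" by auto
      then have "Suc (card (F - {w} - D)) = card (F - D)" using card.remove[of "F - D" w] w Cons.prems(1) by simp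
      then have "D \<subseteq> F' \<and> (card (F' - D) + q \<le> card (F - D) \<or> (\<forall>(u, v)\<in>set (p # ps). \<not> conf G F' u v))"
        using z(3) nc unfolding F'_def[symmetric] Let_def Suc p list.set by auto
      moreover have "2 * z + b < 2 ^ Suc q" using z(2) by (auto simp: b_def Suc)
      moreover have "1 \<le> 2 * z + b" using z(1) by simp
      ultimately show ?thesis unfolding F'_def st[symmetric] Let_def by blast
    qed
  qed
qed

definition pairs :: "nat \<Rightarrow> (nat \<times> nat) list" where
  "pairs n = List.product [0..<n] [0..<n]"

definition pass :: "nat \<Rightarrow> (nat \<times> nat) set \<Rightarrow> nat \<Rightarrow> nat set \<Rightarrow> nat set" where
  "pass n G z F = fst (fold (brk G) (pairs n) (F, z))"

lemma branching_codes:
  assumes "F \<subseteq> {..<n}" "D \<subseteq> F" "\<And>u v. u \<in> D \<Longrightarrow> v \<in> D \<Longrightarrow> nb G u v" "card (F - D) \<le> c * q" "2 ^ Suc q \<le> n"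
  shows "\<exists>zs. length zs = c \<and> (\<forall>z\<in>set zs. z < n) \<and>
     (let F' = fold (pass n G) zs F in D \<subseteq> F' \<and> is_clique n G F')"
  using assms
proof (induction c arbitrary: F)
  case 0
  have "finite F" using 0 finite_subset by blast
  then have "F = D" using 0 by auto
  then show ?case using 0 by (auto simp: is_clique_def nb_def)
next
  case (Suc c)
  have fF: "finite F" using Suc.prems finite_subset by blast
  from branching_code[OF fF Suc.prems(2,3), of q "pairs n"] obtain z where z': "z < 2 ^ Suc q"
    and z: "D \<subseteq> pass n G z F"
      "card (pass n G z F - D) + q \<le> card (F - D) \<or> (\<forall>(u, v)\<in>set (pairs n). \<not> conf G (pass n G z F) u v)"
    unfolding pass_def Let_def by blast
  have zn: "z < n" using z' Suc.prems(5) by (rule less_le_trans)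
  have sub: "pass n G z F \<subseteq> {..<n}" using brk_subset[of G "pairs n" F z] Suc.prems(1) by (auto simp: pass_def)
  from z(2) show ?case
  proof
    assume "card (pass n G z F - D) + q \<le> card (F - D)"
    then have "card (pass n G z F - D) \<le> c * q" using Suc.prems(4) by simp
    from Suc.IH[OF sub z(1) Suc.prems(3) this Suc.prems(5)] obtain zs where
      "length zs = c" "\<forall>z\<in>set zs. z < n" "let F' = fold (pass n G) zs (pass n G z F) in D \<subseteq> F' \<and> is_clique n G F'" by blast
    then show ?thesis using zn by (intro exI[of _ "z # zs"]) auto
  next
    assume nc: "\<forall>(u, v)\<in>set (pairs n). \<not> conf G (pass n G z F) u v"
    have cl: "is_clique n G (pass n G z F)"
      unfolding is_clique_def
    proof (intro conjI ballI impI sub)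
      fix u v assume uv: "u \<in> pass n G z F" "v \<in> pass n G z F" "u \<noteq> v"
      then have "(u, v) \<in> set (pairs n)" using sub by (auto simp: pairs_def)
      then have "\<not> conf G (pass n G z F) u v" using nc by blast
      then show "adj G u v" using uv by (simp add: conf_def nb_def)
    qed
    \<comment> \<open>Code 1 carries no bits and changes nothing, so it pads the list once a clique
      is reached.\<close>
    have id: "fold (pass n G) (replicate c 1) F' = F'" for F'
      by (induction c arbitrary: F') (auto simp: pass_def brk_one[unfolded One_nat_def])
    have "1 < (2::nat) ^ Suc q" by (rule one_less_power) auto
    then have "1 < n" using Suc.prems(5) by (rule less_le_trans)
    then show ?thesis using zn z(1) cl by (intro exI[of _ "z # replicate c 1"]) (auto simp: Let_def id[unfolded One_nat_def] simp del: fold_replicate)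
  qed
qed

section \<open>The program\<close>

text \<open>Invariant rule for loops. Frame facts about unwritten variables and arrays are supplied
  to the induction step, so that \<open>I\<close> need only mention what the body changes.\<close>

lemma for_rule:
  assumes c: "0 \<notin> wvars c" and v: "v \<noteq> 0" and base: "I 0 s0"
    and step: "\<And>i s. \<lbrakk>i < s0 (V 0); I i s; \<And>x. x \<noteq> v \<Longrightarrow> x \<notin> wvars c \<Longrightarrow> s (V x) = s0 (V x);
       \<And>a j. a \<notin> warrs c \<Longrightarrow> s (A a j) = s0 (A a j)\<rbrakk> \<Longrightarrow> I (Suc i) (exec E c (s(V v := i)))"
  shows "\<exists>s'. I (s0 (V 0)) s' \<and> exec E (CFor v c) s0 = s'(V v := s0 (V 0))"
proof -
  define f where "f = (\<lambda>i s. exec E c (s(V v := i)))"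
  define S where "S i = fold f [0..<i] s0" for i
  have SS: "S (Suc i) = exec E c ((S i)(V v := i))" for i by (simp add: S_def f_def)
  have fr: "x \<noteq> v \<Longrightarrow> x \<notin> wvars c \<Longrightarrow> S i (V x) = s0 (V x)" "a \<notin> warrs c \<Longrightarrow> S i (A a j) = s0 (A a j)" for i x a j
    by (induction i) (simp_all add: S_def f_def exec_var_frame exec_arr_frame)
  have "i \<le> s0 (V 0) \<Longrightarrow> I i (S i)" for i
  proof (induction i)
    case 0
    then show ?case using base by (simp add: S_def)
  next
    case (Suc i)
    then show ?case unfolding SS using fr by (intro step) auto
  qed
  then have "I (s0 (V 0)) (S (s0 (V 0)))" by simp
  moreover have "exec E (CFor v c) s0 = (S (s0 (V 0)))(V v := s0 (V 0))"
    unfolding S_def f_def by (rule exec.simps)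
  ultimately show ?thesis by blast
qed

declare exec.simps(11) [simp del]

text \<open>The language has no empty command; variable 9 is reserved as a dummy target.\<close>

definition skip :: com where "skip = CConst 9 0"

lemma skip_simps [simp]:
  "exec E skip s = s(V 9 := 0)" "wvars skip = {9}" "warrs skip = {}" "outs E skip s = {}"
  "depth skip = 0" "wfc b skip = wok b 9"
  by (simp_all add: skip_def)

text \<open>\<open>adj\<close> is irreflexive, so equality is tested separately: both truncated
  differences vanish exactly when the arguments agree.\<close>

definition NB :: "nat \<Rightarrow> nat \<Rightarrow> nat \<Rightarrow> com" where
  "NB r a b = CEdge r a b ;; CIf r skip (CSub 10 a b ;; CSub 11 b a ;; CAdd 10 10 11 ;; CIf 10 skip (CConst r 1))"

lemma NB_simps [simp]:
  "wvars (NB r a b) = {r, 9, 10, 11}" "warrs (NB r a b) = {}" "outs E (NB r a b) s = {}"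
  "depth (NB r a b) = 0"
  "wfc d (NB r a b) \<longleftrightarrow> wok d r \<and> vok d a \<and> vok d b \<and> wok d 9 \<and> wok d 10 \<and> wok d 11"
  by (auto simp: NB_def wok_def)

lemma exec_NB [simp]:
  assumes "r \<notin> {9, 10, 11}" "a \<notin> {r, 9, 10, 11}" "b \<notin> {r, 9, 10, 11}"
  shows "exec E (NB r a b) s (V r) = (if nb E (s (V a)) (s (V b)) then 1 else 0)"
  using assms by (auto simp: NB_def nb_def adj_def)

lemma exec_NB_frame [simp]:
  "x \<notin> {r, 9, 10, 11} \<Longrightarrow> exec E (NB r a b) s (V x) = s (V x)" "exec E (NB r a b) s (A c j) = s (A c j)"
  by (auto intro: exec_var_frame exec_arr_frame)

text \<open>The list of seed variables is unrolled when the program is written, its length depending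
  only on epsilon.\<close>

primrec pU_inner :: "nat list \<Rightarrow> com" where
  "pU_inner [] = skip"
| "pU_inner (w # ws) = NB 12 4 w ;; CIf 12 skip (CConst 7 0) ;; pU_inner ws"

lemma wvars_pU_inner: "wvars (pU_inner ws) \<subseteq> {7, 9, 10, 11, 12}"
  by (induction ws) auto

lemma pU_inner_simps [simp]:
  "warrs (pU_inner ws) = {}" "outs E (pU_inner ws) s = {}"
  "depth (pU_inner ws) = 0"
  by (induction ws arbitrary: s) auto

lemma wfc_pU_inner: "(\<And>w. w \<in> set ws \<Longrightarrow> vok b w) \<Longrightarrow> 13 \<le> b \<Longrightarrow> wfc b (pU_inner ws)"
  by (induction ws) (auto simp: wok_def vok_def)

lemma exec_pU_inner_frame [simp]:
  "x \<notin> {7, 9, 10, 11, 12} \<Longrightarrow> exec E (pU_inner ws) s (V x) = s (V x)" "exec E (pU_inner ws) s (A a j) = s (A a j)"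
  using wvars_pU_inner[of ws] by (auto intro!: exec_var_frame exec_arr_frame)

lemma exec_pU_inner:
  "(\<forall>w\<in>set ws. 13 \<le> w) \<Longrightarrow>
    exec E (pU_inner ws) s (V 7) = (if \<forall>w\<in>set ws. nb E (s (V 4)) (s (V w)) then s (V 7) else 0)"
proof (induction ws arbitrary: s)
  case (Cons w ws)
  define s1 where "s1 = exec E (NB 12 4 w ;; CIf 12 skip (CConst 7 0)) s"
  have w: "w \<notin> {12, 9, 10, 11}" "w \<noteq> 7" using Cons.prems by auto
  have s1: "s1 (V x) = s (V x)" if "x \<notin> {7, 9, 10, 11, 12}" for x
    using that unfolding s1_def by (auto simp: fun_upd_apply)
  have s17: "s1 (V 7) = (if nb E (s (V 4)) (s (V w)) then s (V 7) else 0)"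
    using w unfolding s1_def by (auto simp: fun_upd_apply)
  have 4: "s1 (V 4) = s (V 4)" by (rule s1) simp
  have ws: "s1 (V w') = s (V w')" if "w' \<in> set ws" for w'
    using Cons.prems that by (intro s1) auto
  have "exec E (pU_inner (w # ws)) s (V 7) = exec E (pU_inner ws) s1 (V 7)"
    by (simp add: s1_def)
  also have "\<dots> = (if \<forall>w\<in>set ws. nb E (s1 (V 4)) (s1 (V w)) then s1 (V 7) else 0)"
    using Cons.prems by (intro Cons.IH) simp
  also have "\<dots> = (if \<forall>w\<in>set ws. nb E (s (V 4)) (s (V w)) then s1 (V 7) else 0)"
    using 4 ws by simp
  finally show ?case by (simp add: s17)
qed simp

text \<open>
  Variables 20 and 21 hold the start vertex of the power iteration and the vertex whose entry is the
  threshold, 22 the size of the best clique so far, 30 to 69 the branching codes, those from 70 on the guessed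
  members of the planted clique; the variables 4 to 19 and 23 are work space. Array 0 is the common
  neighbourhood \<open>U\<close>, arrays 7 and 2 the positive and negative parts of the iterate, 3 and 4 those of the next
  iterate, 5 the candidate set of the branching, and 6 the best clique.
\<close>

definition pU :: "nat list \<Rightarrow> com" where
  "pU ws = CFor 4 (CConst 7 1 ;; pU_inner ws ;; CStore 0 4 7)"

lemma exec_pU:
  assumes ws: "\<forall>w\<in>set ws. 13 \<le> w" and i: "i < s (V 0)"
  shows "exec E (pU ws) s (A 0 i) = (if \<forall>w\<in>set ws. nb E i (s (V w)) then 1 else 0)"
proof -
  let ?c = "CConst 7 1 ;; pU_inner ws ;; CStore 0 4 7"
  have wv: "wvars ?c \<subseteq> {7, 9, 10, 11, 12}" using wvars_pU_inner[of ws] by auto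
  define I where "I m s' \<longleftrightarrow> (\<forall>i<m. s' (A 0 i) = (if \<forall>w\<in>set ws. nb E i (s (V w)) then 1 else 0 :: nat))" for m s'
  have "\<exists>s'. I (s (V 0)) s' \<and> exec E (CFor 4 ?c) s = s'(V 4 := s (V 0))"
  proof (rule for_rule)
    show "0 \<notin> wvars ?c" using wv by auto
    show "I 0 s" by (simp add: I_def)
    fix i s'
    assume i: "i < s (V 0)" and I: "I i s'" and fr: "\<And>x. x \<noteq> 4 \<Longrightarrow> x \<notin> wvars ?c \<Longrightarrow> s' (V x) = s (V x)"
    have w: "s' (V w) = s (V w)" "w \<noteq> 7" "w \<noteq> 4" if "w \<in> set ws" for w
    proof -
      have w13: "13 \<le> w" using ws that by blast
      then have "w \<notin> {7, 9, 10, 11, 12}" by auto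
      then have "w \<notin> wvars ?c" using wv by blast
      then show "s' (V w) = s (V w)" using w13 by (intro fr) auto
      show "w \<noteq> 7" "w \<noteq> 4" using w13 by auto
    qed
    define s2 where "s2 = s'(V 4 := i, V 7 := Suc 0)"
    have "exec E (pU_inner ws) s2 (V 7) = (if \<forall>w\<in>set ws. nb E i (s (V w)) then 1 else 0)"
      using exec_pU_inner[OF ws, of E s2] w by (simp add: s2_def)
    moreover have "exec E (pU_inner ws) s2 (V 4) = i" by (simp add: s2_def)
    moreover have "exec E (pU_inner ws) s2 (A a j) = s' (A a j)" for a j by (simp add: s2_def)
    ultimately show "I (Suc i) (exec E ?c (s'(V 4 := i)))"
      using I unfolding I_def by (simp add: s2_def[symmetric] less_Suc_eq)
  qed simp
  then show ?thesis using i unfolding pU_def I_def by auto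
qed

section \<open>The power iteration as a program\<close>

definition pInit :: com where
  "pInit = CFor 4 (CConst 7 0 ;; CStore 7 4 7 ;; CStore 2 4 7) ;; CConst 7 1 ;; CStore 7 20 7"

lemma exec_pInit:
  assumes i: "i < s (V 0)"
  shows "exec E pInit s (A 7 i) = (if i = s (V 20) then 1 else 0)" "exec E pInit s (A 2 i) = 0"
proof -
  let ?c = "CConst 7 0 ;; CStore 7 4 7 ;; CStore 2 4 7"
  define I where "I m s' \<longleftrightarrow> (\<forall>i<m. s' (A 7 i) = (0::nat) \<and> s' (A 2 i) = (0::nat))" for m s'
  have "\<exists>s'. I (s (V 0)) s' \<and> exec E (CFor 4 ?c) s = s'(V 4 := s (V 0))"
    by (rule for_rule) (auto simp: I_def less_Suc_eq)
  then obtain s' where I: "I (s (V 0)) s'" and e: "exec E (CFor 4 ?c) s = s'(V 4 := s (V 0))" by blast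
  have "exec E (CFor 4 ?c) s (V 20) = s (V 20)" by (rule exec_var_frame) simp
  then have "s' (V 20) = s (V 20)" by (simp add: e)
  moreover have "exec E pInit s = (let s1 = exec E (CFor 4 ?c) s in s1(V 7 := 1, A 7 (s1 (V 20)) := 1))"
    unfolding pInit_def Let_def by simp
  ultimately show "exec E pInit s (A 7 i) = (if i = s (V 20) then 1 else 0)" "exec E pInit s (A 2 i) = 0"
    using I i by (auto simp: I_def e Let_def)
qed

text \<open>Registers hold naturals, so a signed entry is a difference of two naturals, never
  normalised; a matrix entry -1 simply exchanges the two parts.\<close>

definition val :: "(loc \<Rightarrow> nat) \<Rightarrow> nat \<Rightarrow> real" where
  "val s i = real (s (A 7 i)) - real (s (A 2 i))"

definition pMul_inner :: com where
  "pMul_inner = CFor 5 (NB 12 4 5 ;; CLoad 13 7 5 ;; CLoad 14 2 5 ;;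
     CIf 12 (CAdd 7 7 13 ;; CAdd 8 8 14) (CAdd 7 7 14 ;; CAdd 8 8 13))"

lemma pMul_inner_simps [simp]:
  "wvars pMul_inner = {5, 7, 8, 9, 10, 11, 12, 13, 14}" "warrs pMul_inner = {}"
  by (auto simp: pMul_inner_def)

lemma exec_pMul_inner:
  "real (exec E pMul_inner s (V 7)) - real (exec E pMul_inner s (V 8))
     = real (s (V 7)) - real (s (V 8)) + (\<Sum>h<s (V 0). Bm E (s (V 4)) h * val s h)"
proof -
  let ?c = "NB 12 4 5 ;; CLoad 13 7 5 ;; CLoad 14 2 5 ;; CIf 12 (CAdd 7 7 13 ;; CAdd 8 8 14) (CAdd 7 7 14 ;; CAdd 8 8 13)"
  define I where "I m s' \<longleftrightarrow> real (s' (V 7)) - real (s' (V 8))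
     = real (s (V 7)) - real (s (V 8)) + (\<Sum>h<m. Bm E (s (V 4)) h * val s h)" for m s'
  have "\<exists>s'. I (s (V 0)) s' \<and> exec E (CFor 5 ?c) s = s'(V 5 := s (V 0))"
  proof (rule for_rule)
    fix i s'
    assume I: "I i s'" and fr: "\<And>x. x \<noteq> 5 \<Longrightarrow> x \<notin> wvars ?c \<Longrightarrow> s' (V x) = s (V x)"
      and fra: "\<And>a j. a \<notin> warrs ?c \<Longrightarrow> s' (A a j) = s (A a j)"
    have 4: "s' (V 4) = s (V 4)" by (rule fr) auto
    have a: "s' (A 7 i) = s (A 7 i)" "s' (A 2 i) = s (A 2 i)" by (rule fra; simp)+
    show "I (Suc i) (exec E ?c (s'(V 5 := i)))"
      using I unfolding I_def by (simp add: 4 a val_def Bm_def)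
  qed (auto simp: I_def)
  then show ?thesis unfolding pMul_inner_def I_def by auto
qed

definition pMul :: com where
  "pMul = CFor 4 (CConst 7 0 ;; CConst 8 0 ;; CLoad 17 0 4 ;; CIf 17 pMul_inner skip ;; CStore 3 4 7 ;; CStore 4 4 8)"

lemma exec_pMul:
  assumes i: "i < s (V 0)"
  shows "real (exec E pMul s (A 3 i)) - real (exec E pMul s (A 4 i)) = mstep (s (V 0)) E {i. s (A 0 i) \<noteq> 0} (val s) i"
proof -
  let ?c = "CConst 7 0 ;; CConst 8 0 ;; CLoad 17 0 4 ;; CIf 17 pMul_inner skip ;; CStore 3 4 7 ;; CStore 4 4 8"
  define I where "I m s' \<longleftrightarrow> (\<forall>i<m. real (s' (A 3 i)) - real (s' (A 4 i)) = mstep (s (V 0)) E {i. s (A 0 i) \<noteq> 0} (val s) i)" for m s'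
  have "\<exists>s'. I (s (V 0)) s' \<and> exec E (CFor 4 ?c) s = s'(V 4 := s (V 0))"
  proof (rule for_rule)
    fix i s'
    assume I: "I i s'" and fr: "\<And>x. x \<noteq> 4 \<Longrightarrow> x \<notin> wvars ?c \<Longrightarrow> s' (V x) = s (V x)"
      and fra: "\<And>a j. a \<notin> warrs ?c \<Longrightarrow> s' (A a j) = s (A a j)"
    have 0: "s' (V 0) = s (V 0)" by (rule fr) auto
    have a: "s' (A 0 j) = s (A 0 j)" "s' (A 7 j) = s (A 7 j)" "s' (A 2 j) = s (A 2 j)" for j by (rule fra; simp)+
    define s2 where "s2 = s'(V 4 := i, V 7 := 0, V 8 := 0, V 17 := s (A 0 i))"
    define s3 where "s3 = exec E (CIf 17 pMul_inner skip) s2"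
    have e: "exec E ?c (s'(V 4 := i)) = s3(A 3 (s3 (V 4)) := s3 (V 7), A 4 (s3 (V 4)) := s3 (V 8))"
      by (simp add: s3_def s2_def a fun_upd_twist)
    have s34: "s3 (V 4) = i" unfolding s3_def by (subst exec_var_frame) (auto simp: s2_def)
    have s3a: "s3 (A b j) = s' (A b j)" for b j unfolding s3_def by (subst exec_arr_frame) (auto simp: s2_def)
    have v2: "val s2 = val s" by (auto simp: val_def s2_def a fun_eq_iff)
    have "real (s3 (V 7)) - real (s3 (V 8)) = mstep (s (V 0)) E {i. s (A 0 i) \<noteq> 0} (val s) i"
    proof (cases "s (A 0 i) = 0")
      case True
      then show ?thesis by (simp add: s3_def s2_def mstep_def)
    next
      case False
      then have "s3 = exec E pMul_inner s2" by (simp add: s3_def s2_def)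
      then show ?thesis using False exec_pMul_inner[of E s2] unfolding v2
        by (simp add: s2_def mstep_def 0)
    qed
    then show "I (Suc i) (exec E ?c (s'(V 4 := i)))"
      using I unfolding I_def e s34 by (auto simp: s3a less_Suc_eq)
  qed (auto simp: I_def)
  then show ?thesis using i unfolding pMul_def I_def by auto
qed

definition pCopy :: com where
  "pCopy = CFor 4 (CLoad 7 3 4 ;; CStore 7 4 7 ;; CLoad 7 4 4 ;; CStore 2 4 7)"

lemma exec_pCopy:
  assumes i: "i < s (V 0)"
  shows "exec E pCopy s (A 7 i) = s (A 3 i)" "exec E pCopy s (A 2 i) = s (A 4 i)"
proof -
  let ?c = "CLoad 7 3 4 ;; CStore 7 4 7 ;; CLoad 7 4 4 ;; CStore 2 4 7"
  define I where "I m s' \<longleftrightarrow> (\<forall>i<m. s' (A 7 i) = s (A 3 i) \<and> s' (A 2 i) = s (A 4 i))" for m s'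
  have "\<exists>s'. I (s (V 0)) s' \<and> exec E (CFor 4 ?c) s = s'(V 4 := s (V 0))"
    by (rule for_rule) (auto simp: I_def less_Suc_eq)
  then show "exec E pCopy s (A 7 i) = s (A 3 i)" "exec E pCopy s (A 2 i) = s (A 4 i)"
    using i unfolding pCopy_def I_def by auto
qed

definition pPow :: com where "pPow = CFor 6 (pMul ;; pCopy)"

lemma pMul_simps [simp]:
  "wvars pMul = {4, 5, 7, 8, 9, 10, 11, 12, 13, 14, 17}" "warrs pMul = {3, 4}"
  "wvars pCopy = {4, 7}" "warrs pCopy = {2, 7}"
  by (auto simp: pMul_def pCopy_def)

lemma mstep_cong: "(\<And>i. i < n \<Longrightarrow> x i = y i) \<Longrightarrow> (i \<in> U \<longleftrightarrow> i \<in> U') \<Longrightarrow> mstep n G U x i = mstep n G U' y i"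
  by (auto simp: mstep_def)

lemma exec_pPow:
  assumes x: "\<And>i. i < n \<Longrightarrow> val s i = x i" and U: "\<And>i. i < n \<Longrightarrow> s (A 0 i) \<noteq> 0 \<longleftrightarrow> i \<in> U" and n: "s (V 0) = n"
    and i: "i < n"
  shows "val (exec E pPow s) i = (mstep n E U ^^ n) x i"
proof -
  let ?c = "pMul ;; pCopy"
  define I where "I m s' \<longleftrightarrow> (\<forall>i<n. val s' i = (mstep n E U ^^ m) x i)" for m s'
  have "\<exists>s'. I (s (V 0)) s' \<and> exec E (CFor 6 ?c) s = s'(V 6 := s (V 0))"
  proof (rule for_rule)
    fix j s'
    assume I: "I j s'" and fr: "\<And>x. x \<noteq> 6 \<Longrightarrow> x \<notin> wvars ?c \<Longrightarrow> s' (V x) = s (V x)"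
      and fra: "\<And>a j. a \<notin> warrs ?c \<Longrightarrow> s' (A a j) = s (A a j)"
    define s2 where "s2 = s'(V 6 := j)"
    have 0: "s2 (V 0) = n" unfolding s2_def using fr[of 0] n by simp
    have a: "s2 (A 0 j) = s (A 0 j)" for j unfolding s2_def using fra[of 0] by simp
    have v: "val s2 = val s'" by (auto simp: val_def s2_def fun_eq_iff)
    have "val (exec E ?c s2) i = (mstep n E U ^^ Suc j) x i" if i: "i < n" for i
    proof -
      have 1: "exec E pMul s2 (V 0) = n" by (subst exec_var_frame) (auto simp: 0)
      have "val (exec E ?c s2) i = real (exec E pMul s2 (A 3 i)) - real (exec E pMul s2 (A 4 i))"
        unfolding val_def using exec_pCopy[of i "exec E pMul s2" E] i 1 by simp
      also have "\<dots> = mstep n E {i. s2 (A 0 i) \<noteq> 0} (val s2) i"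
        using exec_pMul[of i s2 E] i 0 by simp
      also have "\<dots> = mstep n E U ((mstep n E U ^^ j) x) i"
        using I U[OF i] unfolding v a I_def by (intro mstep_cong) auto
      finally show ?thesis by simp
    qed
    then show "I (Suc j) (exec E ?c (s'(V 6 := j)))" unfolding I_def s2_def by blast
  qed (auto simp: I_def x)
  then obtain s' where I: "I (s (V 0)) s'" and e: "exec E (CFor 6 ?c) s = s'(V 6 := s (V 0))" by blast
  have "val (exec E pPow s) i = val s' i" unfolding pPow_def e by (simp add: val_def)
  then show ?thesis using I i n unfolding I_def by simp
qed

section \<open>Thresholding and the candidate set as a program\<close>

definition pThr :: com where
  "pThr = CLoad 13 7 21 ;; CLoad 14 2 21 ;; CSub 7 13 14 ;; CSub 8 14 13 ;; CAdd 15 7 8"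

lemma real_dist_nat: "real ((a - b) + (b - a)) = \<bar>real a - real b\<bar>"
  by (cases "a \<le> b") auto

lemma exec_pThr: "real (exec E pThr s (V 15)) = \<bar>val s (s (V 21))\<bar>"
  unfolding val_def real_dist_nat[symmetric] by (simp add: pThr_def)

definition pF_inner :: com where
  "pF_inner = CFor 5 (CLoad 13 7 5 ;; CLoad 14 2 5 ;; CSub 7 13 14 ;; CSub 8 14 13 ;; CAdd 7 7 8 ;; CSub 7 15 7 ;;
     CIf 7 skip (NB 12 4 5 ;; CAdd 16 16 12))"

lemma card_less_Suc:
  "card {h. h < Suc m \<and> P h} = card {h. h < m \<and> P h} + (if P m then 1 else 0)"
proof -
  have "{h. h < Suc m \<and> P h} = (if P m then insert m {h. h < m \<and> P h} else {h. h < m \<and> P h})"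
    by (auto simp: less_Suc_eq)
  then show ?thesis by simp
qed

lemma pF_inner_simps [simp]:
  "wvars pF_inner = {5, 7, 8, 9, 10, 11, 12, 13, 14, 16}" "warrs pF_inner = {}"
  by (auto simp: pF_inner_def)

lemma exec_pF_inner:
  "exec E pF_inner s (V 16) = s (V 16) + card {h. h < s (V 0) \<and> (real (s (V 15)) \<le> \<bar>val s h\<bar> \<and> nb E (s (V 4)) h)}"
proof -
  let ?c = "CLoad 13 7 5 ;; CLoad 14 2 5 ;; CSub 7 13 14 ;; CSub 8 14 13 ;; CAdd 7 7 8 ;; CSub 7 15 7 ;;
     CIf 7 skip (NB 12 4 5 ;; CAdd 16 16 12)"
  define I where "I m s' \<longleftrightarrow> s' (V 16) = s (V 16) + card {h. h < m \<and> (real (s (V 15)) \<le> \<bar>val s h\<bar> \<and> nb E (s (V 4)) h)}" for m s'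
  have "\<exists>s'. I (s (V 0)) s' \<and> exec E (CFor 5 ?c) s = s'(V 5 := s (V 0))"
  proof (rule for_rule)
    fix i s'
    assume I: "I i s'" and fr: "\<And>x. x \<noteq> 5 \<Longrightarrow> x \<notin> wvars ?c \<Longrightarrow> s' (V x) = s (V x)"
      and fra: "\<And>a j. a \<notin> warrs ?c \<Longrightarrow> s' (A a j) = s (A a j)"
    have 4: "s' (V 4) = s (V 4)" "s' (V 15) = s (V 15)" by (rule fr; simp)+
    have a: "s' (A 7 i) = s (A 7 i)" "s' (A 2 i) = s (A 2 i)" by (rule fra; simp)+
    define w where "w = (s (A 7 i) - s (A 2 i)) + (s (A 2 i) - s (A 7 i))"
    have w: "real (s (V 15)) \<le> \<bar>val s i\<bar> \<longleftrightarrow> s (V 15) - w = 0"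
      unfolding val_def real_dist_nat[symmetric] w_def[symmetric] by auto
    have "exec E ?c (s'(V 5 := i)) (V 16) = s' (V 16) + (if s (V 15) - w = 0 \<and> nb E (s (V 4)) i then 1 else 0)"
      by (simp add: 4 a w_def)
    then show "I (Suc i) (exec E ?c (s'(V 5 := i)))"
      using I unfolding I_def card_less_Suc w by simp
  qed (auto simp: I_def)
  then show ?thesis unfolding pF_inner_def I_def by auto
qed

text \<open>The test 3k \<le> 4 * count is done by repeated addition, and truncated subtraction
  yields 0 exactly when it holds.\<close>

definition pF :: com where
  "pF = CFor 4 (CConst 16 0 ;; pF_inner ;; CAdd 16 16 16 ;; CAdd 16 16 16 ;; CAdd 17 1 1 ;; CAdd 17 17 1 ;;
     CSub 17 17 16 ;; CIf 17 (CConst 17 0) (CConst 17 1) ;; CStore 5 4 17)"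

lemma exec_pF:
  assumes i: "i < s (V 0)" and g: "real (s (V 15)) = \<bar>val s g\<bar>"
  shows "exec E pF s (A 5 i) = (if i \<in> fset (s (V 0)) (s (V 1)) E (val s) g then 1 else 0)"
proof -
  let ?d = "CAdd 16 16 16 ;; CAdd 16 16 16 ;; CAdd 17 1 1 ;; CAdd 17 17 1 ;;
     CSub 17 17 16 ;; CIf 17 (CConst 17 0) (CConst 17 1) ;; CStore 5 4 17"
  let ?c = "CConst 16 0 ;; pF_inner ;; ?d"
  define I where "I m s' \<longleftrightarrow> (\<forall>i<m. s' (A 5 i) = (if i \<in> fset (s (V 0)) (s (V 1)) E (val s) g then 1 else 0 :: nat))" for m s'
  have "\<exists>s'. I (s (V 0)) s' \<and> exec E (CFor 4 ?c) s = s'(V 4 := s (V 0))"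
  proof (rule for_rule)
    fix i s'
    assume i: "i < s (V 0)" and I: "I i s'" and fr: "\<And>x. x \<noteq> 4 \<Longrightarrow> x \<notin> wvars ?c \<Longrightarrow> s' (V x) = s (V x)"
      and fra: "\<And>a j. a \<notin> warrs ?c \<Longrightarrow> s' (A a j) = s (A a j)"
    have v: "s' (V 0) = s (V 0)" "s' (V 1) = s (V 1)" "s' (V 15) = s (V 15)"
      using fr[of 0] fr[of 1] fr[of 15] by simp_all
    have a: "s' (A 7 j) = s (A 7 j)" "s' (A 2 j) = s (A 2 j)" for j by (rule fra; simp)+
    define s2 where "s2 = s'(V 4 := i, V 16 := 0)"
    define s3 where "s3 = exec E pF_inner s2"
    have v2: "val s2 = val s" by (auto simp: val_def s2_def a fun_eq_iff)
    define cc where "cc = card {h. h < s (V 0) \<and> (\<bar>val s g\<bar> \<le> \<bar>val s h\<bar> \<and> nb E i h)}"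
    have s316: "s3 (V 16) = cc" unfolding s3_def exec_pF_inner v2 cc_def by (simp add: s2_def v g)
    have s34: "s3 (V 4) = i" unfolding s3_def by (subst exec_var_frame) (auto simp: s2_def)
    have s31: "s3 (V 1) = s (V 1)" unfolding s3_def by (subst exec_var_frame) (auto simp: s2_def v[unfolded One_nat_def])
    have s3a: "s3 (A b j) = s' (A b j)" for b j unfolding s3_def by (subst exec_arr_frame) (auto simp: s2_def)
    have e: "exec E ?c (s'(V 4 := i)) = exec E ?d s3" by (simp only: exec.simps s3_def s2_def)
    have d: "exec E ?d s3 (A 5 j) = (if j = i then if 3 * s (V 1) \<le> 4 * cc then 1 else 0 else s' (A 5 j))" for j
      by (simp add: s316 s34 s31[unfolded One_nat_def] s3a)
    have "i \<in> fset (s (V 0)) (s (V 1)) E (val s) g \<longleftrightarrow> 3 * s (V 1) \<le> 4 * cc"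
      using i by (simp add: fset_def cc_def)
    then show "I (Suc i) (exec E ?c (s'(V 4 := i)))"
      using I unfolding I_def e d by (simp add: less_Suc_eq)
  qed (auto simp: I_def)
  then show ?thesis using i unfolding pF_def I_def by auto
qed

section \<open>The branching passes as a program\<close>

definition Fs :: "nat \<Rightarrow> (loc \<Rightarrow> nat) \<Rightarrow> nat set" where
  "Fs n s = {i. i < n \<and> s (A 5 i) \<noteq> 0}"

text \<open>Variable 18 is the unread part of the code. Its lowest bit is z - 2 * (z div 2), and
  copying a variable is addition of 0.\<close>

definition pBrk :: com where
  "pBrk = NB 12 4 5 ;; CLoad 13 5 4 ;; CLoad 14 5 5 ;; CIf 12 skip (CIf 13 (CIf 14 (CConst 7 2 ;; CDiv 8 18 7 ;;
     CIf 8 (CAdd 7 8 8 ;; CSub 17 18 7 ;; CConst 7 0 ;; CAdd 18 8 7 ;; CIf 17 (CStore 5 4 7) (CStore 5 5 7)) skip) skip) skip)"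

lemma pBrk_simps [simp]:
  "wvars pBrk = {7, 8, 9, 10, 11, 12, 13, 14, 17, 18}" "warrs pBrk = {5}"
  by (auto simp: pBrk_def)

lemma exec_pBrk:
  assumes "s (V 4) < n" "s (V 5) < n"
  shows "(Fs n (exec E pBrk s), exec E pBrk s (V 18)) = brk E (s (V 4), s (V 5)) (Fs n s, s (V 18))"
proof -
  define s1 where "s1 = (exec E (NB 12 4 5) s)(V 13 := s (A 5 (s (V 4))), V 14 := s (A 5 (s (V 5))))"
  define c where "c = CIf 12 skip (CIf 13 (CIf 14 (CConst 7 2 ;; CDiv 8 18 7 ;;
     CIf 8 (CAdd 7 8 8 ;; CSub 17 18 7 ;; CConst 7 0 ;; CAdd 18 8 7 ;; CIf 17 (CStore 5 4 7) (CStore 5 5 7)) skip) skip) skip)"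
  have e: "exec E pBrk s = exec E c s1" unfolding pBrk_def c_def s1_def by simp
  have s1: "s1 (V 4) = s (V 4)" "s1 (V 5) = s (V 5)" "s1 (V 18) = s (V 18)" "s1 (A 5 j) = s (A 5 j)"
    "s1 (V 12) = (if nb E (s (V 4)) (s (V 5)) then 1 else 0)" "s1 (V 13) = s (A 5 (s (V 4)))" "s1 (V 14) = s (A 5 (s (V 5)))" for j
    by (simp_all add: s1_def)
  have cf: "conf E (Fs n s) (s (V 4)) (s (V 5)) \<longleftrightarrow> s1 (V 12) = 0 \<and> s1 (V 13) \<noteq> 0 \<and> s1 (V 14) \<noteq> 0"
    using assms by (auto simp: conf_def Fs_def s1)
  have odd: "s (V 18) - 2 * (s (V 18) div 2) = 0 \<longleftrightarrow> even (s (V 18))" by presburger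
  show ?thesis
  proof (cases "conf E (Fs n s) (s (V 4)) (s (V 5)) \<and> s (V 18) div 2 \<noteq> 0")
    case False
    have nc: "\<not> (s1 (V 12) = 0 \<and> s1 (V 13) \<noteq> 0 \<and> s1 (V 14) \<noteq> 0 \<and> s (V 18) div 2 \<noteq> 0)"
      using False cf by blast
    have "Fs n (exec E c s1) = Fs n s \<and> exec E c s1 (V 18) = s (V 18)"
      using nc unfolding c_def Fs_def by (auto simp: s1(1-4))
    then show ?thesis unfolding brk.simps if_not_P[OF False] e by simp
  next
    case True
    then have t: "s1 (V 12) = 0" "s1 (V 13) \<noteq> 0" "s1 (V 14) \<noteq> 0" "s (V 18) div 2 \<noteq> 0" using cf by auto
    have c18: "exec E c s1 (V 18) = s (V 18) div 2"
      using t unfolding c_def by (simp add: s1(3))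
    have c5: "exec E c s1 (A 5 j) = (if j = (if odd (s (V 18)) then s (V 4) else s (V 5)) then 0 else s (A 5 j))" for j
      using t odd unfolding c_def by (simp add: s1(1-4) mult_2)
    show ?thesis using True unfolding e c18 by (auto simp: Fs_def c5)
  qed
qed

text \<open>The code is copied to variable 18 before it is consumed: the guess itself is the counter
  of an enclosing loop and must not be overwritten.\<close>

definition pPass :: "nat \<Rightarrow> com" where
  "pPass z = CConst 7 0 ;; CAdd 18 z 7 ;; CFor 4 (CFor 5 pBrk)"

lemma product_append: "List.product (xs @ ys) zs = List.product xs zs @ List.product ys zs"
  by (induction xs) auto

lemma exec_pPass:
  assumes z: "z \<noteq> 7" and n: "s (V 0) = n"
  shows "Fs n (exec E (pPass z) s) = pass n E (s (V z)) (Fs n s)"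
proof -
  define s1 where "s1 = s(V 7 := 0, V 18 := s (V z))"
  define st where "st s' = (Fs n s', s' (V 18))" for s'
  have n1: "s1 (V 0) = n" using n by (simp add: s1_def)
  have inner: "st (exec E (CFor 5 pBrk) s2) = fold (brk E) (map (Pair (s2 (V 4))) [0..<n]) (st s2)"
    if n2: "s2 (V 0) = n" and i: "s2 (V 4) < n" for s2
  proof -
    define I where "I m s' \<longleftrightarrow> st s' = fold (brk E) (map (Pair (s2 (V 4))) [0..<m]) (st s2)" for m s'
    have "\<exists>s'. I (s2 (V 0)) s' \<and> exec E (CFor 5 pBrk) s2 = s'(V 5 := s2 (V 0))"
    proof (rule for_rule)
      fix j s'
      assume j: "j < s2 (V 0)" and I: "I j s'" and fr: "\<And>x. x \<noteq> 5 \<Longrightarrow> x \<notin> wvars pBrk \<Longrightarrow> s' (V x) = s2 (V x)"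
      have 4: "s' (V 4) = s2 (V 4)" by (rule fr) auto
      have u: "st (s'(V 5 := j)) = st s'" by (simp add: st_def Fs_def)
      have "st (exec E pBrk (s'(V 5 := j))) = brk E (s2 (V 4), j) (st (s'(V 5 := j)))"
        using exec_pBrk[of "s'(V 5 := j)" n E] i j n2 unfolding st_def by (simp add: 4)
      then show "I (Suc j) (exec E pBrk (s'(V 5 := j)))" using I unfolding I_def u by simp
    qed (auto simp: I_def)
    then obtain s' where "I n s'" "exec E (CFor 5 pBrk) s2 = s'(V 5 := n)" using n2 by auto
    then show ?thesis unfolding I_def by (simp add: st_def Fs_def)
  qed
  define I where "I m s' \<longleftrightarrow> st s' = fold (brk E) (List.product [0..<m] [0..<n]) (st s1)" for m s'
  have "\<exists>s'. I (s1 (V 0)) s' \<and> exec E (CFor 4 (CFor 5 pBrk)) s1 = s'(V 4 := s1 (V 0))"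
  proof (rule for_rule)
    fix i s'
    assume i: "i < s1 (V 0)" and I: "I i s'" and fr: "\<And>x. x \<noteq> 4 \<Longrightarrow> x \<notin> wvars (CFor 5 pBrk) \<Longrightarrow> s' (V x) = s1 (V x)"
    have 0: "s' (V 0) = n" using fr[of 0] n1 by simp
    have u: "st (s'(V 4 := i)) = st s'" by (simp add: st_def Fs_def)
    have "st (exec E (CFor 5 pBrk) (s'(V 4 := i))) = fold (brk E) (map (Pair i) [0..<n]) (st s')"
      using inner[of "s'(V 4 := i)"] i n1 0 u by simp
    then show "I (Suc i) (exec E (CFor 5 pBrk) (s'(V 4 := i)))"
      using I unfolding I_def by (simp add: product_append)
  qed (auto simp: I_def)
  then obtain s' where "I n s'" "exec E (CFor 4 (CFor 5 pBrk)) s1 = s'(V 4 := n)" using n1 by auto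
  then have "st (exec E (CFor 4 (CFor 5 pBrk)) s1) = fold (brk E) (pairs n) (Fs n s, s (V z))"
    unfolding I_def pairs_def by (simp add: st_def Fs_def s1_def)
  moreover have "exec E (pPass z) s = exec E (CFor 4 (CFor 5 pBrk)) s1"
    using z unfolding pPass_def s1_def by simp
  ultimately show ?thesis unfolding pass_def st_def by (metis fst_conv)
qed

primrec pPasses :: "nat list \<Rightarrow> com" where
  "pPasses [] = skip"
| "pPasses (z # zs) = pPass z ;; pPasses zs"

lemma pPass_simps [simp]:
  "wvars (pPass z) = {4, 5, 7, 8, 9, 10, 11, 12, 13, 14, 17, 18}" "warrs (pPass z) = {5}"
  by (auto simp: pPass_def)

lemma wvars_pPasses: "wvars (pPasses zs) \<subseteq> {4, 5, 7, 8, 9, 10, 11, 12, 13, 14, 17, 18}"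
  by (induction zs) auto

lemma warrs_pPasses: "warrs (pPasses zs) \<subseteq> {5}"
  by (induction zs) auto

lemma exec_pPasses:
  assumes "\<forall>z\<in>set zs. 19 \<le> z" "s (V 0) = n"
  shows "Fs n (exec E (pPasses zs) s) = fold (pass n E) (map (\<lambda>z. s (V z)) zs) (Fs n s)"
  using assms
proof (induction zs arbitrary: s)
  case Nil
  then show ?case by (simp add: Fs_def)
next
  case (Cons z zs)
  define s1 where "s1 = exec E (pPass z) s"
  have fr: "s1 (V x) = s (V x)" if "19 \<le> x \<or> x = 0" for x
    unfolding s1_def using that by (intro exec_var_frame) auto
  have "map (\<lambda>z. s1 (V z)) zs = map (\<lambda>z. s (V z)) zs"
    using Cons.prems(1) by (intro map_cong refl fr) auto
  moreover have "Fs n s1 = pass n E (s (V z)) (Fs n s)"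
    unfolding s1_def using Cons.prems by (intro exec_pPass) auto
  moreover have "Fs n (exec E (pPasses zs) s1) = fold (pass n E) (map (\<lambda>z. s1 (V z)) zs) (Fs n s1)"
    using Cons.prems fr[of 0] by (intro Cons.IH) auto
  moreover have "exec E (pPasses (z # zs)) s = exec E (pPasses zs) s1" by (simp add: s1_def)
  ultimately show ?case by (simp only: list.map fold_simps)
qed

section \<open>Checking candidates and recording the best clique\<close>

definition Bs :: "nat \<Rightarrow> (loc \<Rightarrow> nat) \<Rightarrow> nat set" where
  "Bs n s = {i. i < n \<and> s (A 6 i) \<noteq> 0}"

definition pChk_inner :: com where
  "pChk_inner = CFor 5 (CLoad 14 5 5 ;; CIf 14 (NB 12 4 5 ;; CIf 12 skip (CConst 23 0)) skip)"

lemma pChk_inner_simps [simp]: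
  "wvars pChk_inner = {5, 9, 10, 11, 12, 14, 23}" "warrs pChk_inner = {}"
  by (auto simp: pChk_inner_def)

lemma exec_pChk_inner:
  "exec E pChk_inner s (V 23) \<noteq> 0 \<longleftrightarrow> s (V 23) \<noteq> 0 \<and> (\<forall>j<s (V 0). s (A 5 j) \<noteq> 0 \<longrightarrow> nb E (s (V 4)) j)"
proof -
  let ?c = "CLoad 14 5 5 ;; CIf 14 (NB 12 4 5 ;; CIf 12 skip (CConst 23 0)) skip"
  define I where "I m s' \<longleftrightarrow> (s' (V 23) \<noteq> 0 \<longleftrightarrow> s (V 23) \<noteq> 0 \<and> (\<forall>j<m. s (A 5 j) \<noteq> 0 \<longrightarrow> nb E (s (V 4)) j))" for m and s' :: "loc \<Rightarrow> nat"
  have "\<exists>s'. I (s (V 0)) s' \<and> exec E (CFor 5 ?c) s = s'(V 5 := s (V 0))"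
  proof (rule for_rule)
    fix i s'
    assume I: "I i s'" and fr: "\<And>x. x \<noteq> 5 \<Longrightarrow> x \<notin> wvars ?c \<Longrightarrow> s' (V x) = s (V x)"
      and fra: "\<And>a j. a \<notin> warrs ?c \<Longrightarrow> s' (A a j) = s (A a j)"
    have 4: "s' (V 4) = s (V 4)" by (rule fr) auto
    have a: "s' (A 5 i) = s (A 5 i)" by (rule fra) simp
    have "exec E ?c (s'(V 5 := i)) (V 23) = (if s (A 5 i) \<noteq> 0 \<and> \<not> nb E (s (V 4)) i then 0 else s' (V 23))"
      by (simp add: 4 a)
    then show "I (Suc i) (exec E ?c (s'(V 5 := i)))"
      using I unfolding I_def by (auto simp: less_Suc_eq)
  qed (auto simp: I_def)
  then show ?thesis unfolding pChk_inner_def I_def by auto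
qed

definition pChk :: com where
  "pChk = CFor 4 (CLoad 13 5 4 ;; CIf 13 (CConst 7 1 ;; CAdd 19 19 7 ;; pChk_inner) skip)"

lemma pChk_simps [simp]:
  "wvars pChk = {4, 5, 7, 9, 10, 11, 12, 13, 14, 19, 23}" "warrs pChk = {}"
  by (auto simp: pChk_def)

lemma exec_pChk:
  assumes n: "s (V 0) = n"
  shows "exec E pChk s (V 19) = s (V 19) + card (Fs n s)"
    "exec E pChk s (V 23) \<noteq> 0 \<longleftrightarrow> s (V 23) \<noteq> 0 \<and> is_clique n E (Fs n s)"
proof -
  let ?c = "CLoad 13 5 4 ;; CIf 13 (CConst 7 1 ;; CAdd 19 19 7 ;; pChk_inner) skip"
  define I where "I m s' \<longleftrightarrow> s' (V 19) = s (V 19) + card {i. i < m \<and> s (A 5 i) \<noteq> 0} \<and>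
    (s' (V 23) \<noteq> 0 \<longleftrightarrow> s (V 23) \<noteq> 0 \<and> (\<forall>i<m. s (A 5 i) \<noteq> 0 \<longrightarrow> (\<forall>j<n. s (A 5 j) \<noteq> 0 \<longrightarrow> nb E i j)))" for m s'
  have "\<exists>s'. I (s (V 0)) s' \<and> exec E (CFor 4 ?c) s = s'(V 4 := s (V 0))"
  proof (rule for_rule)
    fix i s'
    assume I: "I i s'" and fr: "\<And>x. x \<noteq> 4 \<Longrightarrow> x \<notin> wvars ?c \<Longrightarrow> s' (V x) = s (V x)"
      and fra: "\<And>a j. a \<notin> warrs ?c \<Longrightarrow> s' (A a j) = s (A a j)"
    have 0: "s' (V 0) = n" using fr[of 0] n by simp
    have a: "s' (A 5 j) = s (A 5 j)" for j by (rule fra) simp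
    define r where "r = exec E ?c (s'(V 4 := i))"
    have "I (Suc i) r"
    proof (cases "s (A 5 i) = 0")
      case True
      then have "r (V 19) = s' (V 19)" "r (V 23) = s' (V 23)"
        unfolding r_def by (simp_all add: a)
      then show ?thesis using I True unfolding I_def card_less_Suc by (auto simp: less_Suc_eq)
    next
      case False
      define s2 where "s2 = s'(V 4 := i, V 13 := s (A 5 i), V 7 := 1, V 19 := s' (V 19) + 1)"
      have e: "r = exec E pChk_inner s2" using False by (simp add: r_def s2_def a)
      have 19: "exec E pChk_inner s2 (V 19) = s' (V 19) + 1" by (subst exec_var_frame) (auto simp: s2_def)
      have 23: "exec E pChk_inner s2 (V 23) \<noteq> 0 \<longleftrightarrow> s' (V 23) \<noteq> 0 \<and> (\<forall>j<n. s (A 5 j) \<noteq> 0 \<longrightarrow> nb E i j)"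
        unfolding exec_pChk_inner by (simp add: s2_def 0 a)
      show ?thesis using I False unfolding I_def e 19 23 card_less_Suc by (auto simp: less_Suc_eq)
    qed
    then show "I (Suc i) (exec E ?c (s'(V 4 := i)))" unfolding r_def .
  qed (auto simp: I_def)
  then obtain s' where I: "I n s'" and e: "exec E pChk s = s'(V 4 := n)" using n unfolding pChk_def by auto
  show "exec E pChk s (V 19) = s (V 19) + card (Fs n s)" using I unfolding e I_def Fs_def by simp
  have "is_clique n E (Fs n s) \<longleftrightarrow> (\<forall>i<n. s (A 5 i) \<noteq> 0 \<longrightarrow> (\<forall>j<n. s (A 5 j) \<noteq> 0 \<longrightarrow> nb E i j))"
    by (auto simp: is_clique_def Fs_def nb_def)
  then show "exec E pChk s (V 23) \<noteq> 0 \<longleftrightarrow> s (V 23) \<noteq> 0 \<and> is_clique n E (Fs n s)"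
    using I unfolding e I_def by simp
qed

definition pSave :: com where "pSave = CFor 4 (CLoad 7 5 4 ;; CStore 6 4 7)"

lemma exec_pSave: "s (V 0) = n \<Longrightarrow> Bs n (exec E pSave s) = Fs n s"
proof -
  assume n: "s (V 0) = n"
  let ?c = "CLoad 7 5 4 ;; CStore 6 4 7"
  define I where "I m s' \<longleftrightarrow> (\<forall>i<m. s' (A 6 i) = s (A 5 i))" for m s'
  have "\<exists>s'. I (s (V 0)) s' \<and> exec E (CFor 4 ?c) s = s'(V 4 := s (V 0))"
    by (rule for_rule) (auto simp: I_def less_Suc_eq)
  then show ?thesis using n unfolding pSave_def I_def Bs_def Fs_def by auto
qed

definition pBest :: com where
  "pBest = CConst 23 1 ;; CConst 19 0 ;; pChk ;; CSub 7 19 22 ;;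
     CIf 23 (CIf 7 (CConst 7 0 ;; CAdd 22 19 7 ;; pSave) skip) skip"

text \<open>Invariant of the search for arbitrary guesses. The record changes only when a verified,
  strictly larger clique is found, so wrong guesses are harmless and one right guess is
  enough.\<close>

definition valid :: "nat \<Rightarrow> nat \<Rightarrow> (nat \<times> nat) set \<Rightarrow> (loc \<Rightarrow> nat) \<Rightarrow> bool" where
  "valid n k E s \<longleftrightarrow> s (V 0) = n \<and> s (V 1) = k \<and> is_clique n E (Bs n s) \<and> card (Bs n s) = s (V 22)"

lemma pSave_simps [simp]: "wvars pSave = {4, 7}" "warrs pSave = {6}"
  by (auto simp: pSave_def)

lemma exec_pBest:
  assumes v: "valid n k E s"
  shows "valid n k E (exec E pBest s)" "s (V 22) \<le> exec E pBest s (V 22)"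
    "is_clique n E (Fs n s) \<Longrightarrow> card (Fs n s) \<le> exec E pBest s (V 22)"
proof -
  define s1 where "s1 = exec E pChk (s(V 23 := 1, V 19 := 0))"
  define s2 where "s2 = s1(V 7 := s1 (V 19) - s1 (V 22))"
  define d where "d = CIf 23 (CIf 7 (CConst 7 0 ;; CAdd 22 19 7 ;; pSave) skip) skip"
  have e: "exec E pBest s = exec E d s2" unfolding pBest_def d_def s1_def s2_def by simp
  have n: "s (V 0) = n" "s (V 1) = k" using v by (auto simp: valid_def)
  have F0: "Fs n (s(V 23 := 1, V 19 := 0)) = Fs n s" by (simp add: Fs_def)
  have 19: "s1 (V 19) = card (Fs n s)" and 23: "s1 (V 23) \<noteq> 0 \<longleftrightarrow> is_clique n E (Fs n s)"
    unfolding s1_def using exec_pChk[of "s(V 23 := 1, V 19 := 0)" n E] n F0 by auto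
  have fr: "s1 (V 0) = n" "s1 (V 1) = k" "s1 (V 22) = s (V 22)"
    unfolding s1_def using n by (subst exec_var_frame; simp)+
  have fra: "s1 (A a j) = s (A a j)" for a j unfolding s1_def by (subst exec_arr_frame) auto
  have B: "Bs n s2 = Bs n s" and F: "Fs n s2 = Fs n s" by (auto simp: Bs_def Fs_def s2_def fra)
  show "valid n k E (exec E pBest s)" "s (V 22) \<le> exec E pBest s (V 22)"
    "is_clique n E (Fs n s) \<Longrightarrow> card (Fs n s) \<le> exec E pBest s (V 22)"
  proof (atomize (full), cases "is_clique n E (Fs n s) \<and> s (V 22) < card (Fs n s)")
    case True
    define s3 where "s3 = s2(V 7 := 0, V 22 := card (Fs n s))"
    have c: "s2 (V 23) \<noteq> 0" "s2 (V 7) \<noteq> 0" using True 23 19 fr by (auto simp: s2_def)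
    have ed: "exec E d s2 = exec E pSave s3" unfolding d_def s3_def using c 19 by (simp add: s2_def)
    have s3: "s3 (V 0) = n" "s3 (V 1) = k" "s3 (V 22) = card (Fs n s)" using fr by (auto simp: s3_def s2_def)
    have "Bs n (exec E pSave s3) = Fs n s3" using s3(1) by (rule exec_pSave)
    also have "\<dots> = Fs n s" using F by (simp add: s3_def Fs_def)
    finally have B3: "Bs n (exec E pSave s3) = Fs n s" .
    have "exec E pSave s3 (V 0) = n" "exec E pSave s3 (V 1) = k" "exec E pSave s3 (V 22) = card (Fs n s)"
      using s3 by (subst exec_var_frame; simp)+
    then show "valid n k E (exec E pBest s) \<and> s (V 22) \<le> exec E pBest s (V 22) \<and>
      (is_clique n E (Fs n s) \<longrightarrow> card (Fs n s) \<le> exec E pBest s (V 22))"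
      using True B3 unfolding e ed valid_def by simp
  next
    case False
    then have c: "s2 (V 23) = 0 \<or> s2 (V 7) = 0" using 23 19 fr by (auto simp: s2_def)
    have ed: "exec E d s2 = s2(V 9 := 0)" unfolding d_def using c by auto
    have "Bs n (s2(V 9 := 0)) = Bs n s" using B by (simp add: Bs_def)
    then have "valid n k E (s2(V 9 := 0))" using v fr by (simp add: valid_def s2_def)
    then show "valid n k E (exec E pBest s) \<and> s (V 22) \<le> exec E pBest s (V 22) \<and>
      (is_clique n E (Fs n s) \<longrightarrow> card (Fs n s) \<le> exec E pBest s (V 22))"
      using False fr unfolding e ed by (auto simp: s2_def not_less)
  qed
qed

section \<open>The work done for one tuple of guesses\<close>

definition pre :: "nat list \<Rightarrow> nat list \<Rightarrow> com" where
  "pre ws zs = pU ws ;; pInit ;; pPow ;; pThr ;; pF ;; pPasses zs"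

lemma wvars_pieces:
  "wvars (pU ws) \<subseteq> {4..18}" "wvars pInit \<subseteq> {4..18}" "wvars pPow \<subseteq> {4..18}" "wvars pThr \<subseteq> {4..18}"
  "wvars pF \<subseteq> {4..18}" "wvars (pPasses zs) \<subseteq> {4..18}"
  using wvars_pU_inner[of ws] wvars_pPasses[of zs]
  by (auto simp: pU_def pInit_def pPow_def pThr_def pF_def)

lemma warrs_pieces:
  "warrs (pU ws) = {0}" "warrs pInit = {2, 7}" "warrs pPow = {2, 3, 4, 7}" "warrs pThr = {}" "warrs pF = {5}"
  by (auto simp: pU_def pInit_def pPow_def pThr_def pF_def)

lemma wvars_pre: "wvars (pre ws zs) \<subseteq> {4..18}"
  unfolding pre_def wvars.simps by (intro Un_least wvars_pieces)

lemma warrs_pre: "6 \<notin> warrs (pre ws zs)"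
  using warrs_pPasses[of zs] unfolding pre_def warrs.simps warrs_pieces by auto

lemma fset_cong:
  assumes "\<And>h. h < n \<Longrightarrow> x h = y h" "g < n" shows "fset n k E x g = fset n k E y g"
proof -
  have "{h. h < n \<and> \<bar>x g\<bar> \<le> \<bar>x h\<bar> \<and> nb E i h} = {h. h < n \<and> \<bar>y g\<bar> \<le> \<bar>y h\<bar> \<and> nb E i h}" for i
    using assms by auto
  then show ?thesis by (simp add: fset_def)
qed

definition result :: "nat \<Rightarrow> nat \<Rightarrow> (nat \<times> nat) set \<Rightarrow> nat list \<Rightarrow> nat \<Rightarrow> nat \<Rightarrow> nat list \<Rightarrow> nat set" where
  "result n k E us v g bs = fold (pass n E) bs (fset n k E (iter n E (cnb n E us) v n) g)"

lemma exec_pre: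
  assumes n: "s (V 0) = n" and k: "s (V 1) = k" and ws: "\<forall>w\<in>set ws. 30 \<le> w" and zs: "\<forall>z\<in>set zs. 30 \<le> z"
    and g: "s (V 21) < n"
  shows "Fs n (exec E (pre ws zs) s)
    = result n k E (map (\<lambda>w. s (V w)) ws) (s (V 20)) (s (V 21)) (map (\<lambda>z. s (V z)) zs)"
proof -
  define s1 where "s1 = exec E (pU ws) s"
  define s2 where "s2 = exec E pInit s1"
  define s3 where "s3 = exec E pPow s2"
  define s4 where "s4 = exec E pThr s3"
  define s5 where "s5 = exec E pF s4"
  define us where "us = map (\<lambda>w. s (V w)) ws"
  define U where "U = cnb n E us"
  note wv = wvars_pieces(1)[of ws] wvars_pieces(2-5)
  have fr: "s1 (V x) = s (V x)" "s2 (V x) = s (V x)" "s3 (V x) = s (V x)" "s4 (V x) = s (V x)" "s5 (V x) = s (V x)"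
    if x: "x \<notin> {4..18}" for x
  proof -
    show 1: "s1 (V x) = s (V x)" unfolding s1_def using x wv(1) by (intro exec_var_frame) blast
    show 2: "s2 (V x) = s (V x)" unfolding s2_def 1[symmetric] using x wv(2) by (intro exec_var_frame) blast
    show 3: "s3 (V x) = s (V x)" unfolding s3_def 2[symmetric] using x wv(3) by (intro exec_var_frame) blast
    show 4: "s4 (V x) = s (V x)" unfolding s4_def 3[symmetric] using x wv(4) by (intro exec_var_frame) blast
    show "s5 (V x) = s (V x)" unfolding s5_def 4[symmetric] using x wv(5) by (intro exec_var_frame) blast
  qed
  have U1: "s1 (A 0 i) \<noteq> 0 \<longleftrightarrow> i \<in> U" if "i < n" for i
  proof -
    have "\<forall>w\<in>set ws. 13 \<le> w" using ws by auto
    from exec_pU[OF this, of i s E] show ?thesis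
      using n that unfolding s1_def by (auto simp: U_def cnb_def us_def)
  qed
  have U2: "s2 (A 0 i) = s1 (A 0 i)" for i
    unfolding s2_def by (intro exec_arr_frame) (simp add: warrs_pieces)
  have v2: "val s2 i = indicator {s (V 20)} i" if "i < n" for i
    using exec_pInit[of i s1 E] fr(1)[of 0] fr(1)[of 20] n that unfolding s2_def val_def by (simp add: indicator_def)
  have v3: "val s3 i = iter n E U (s (V 20)) n i" if "i < n" for i
    unfolding s3_def iter_def using v2 U1 U2 fr(2)[of 0] n that by (intro exec_pPow) auto
  have v4: "val s4 i = val s3 i" for i
    unfolding s4_def val_def by (subst (1 2) exec_arr_frame) (auto simp: warrs_pieces)
  have thr: "real (s4 (V 15)) = \<bar>val s4 (s (V 21))\<bar>"
    using exec_pThr[of E s3] fr(3)[of 21] unfolding s4_def[symmetric] v4 by simp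
  have 01: "s4 (V 0) = n" "s4 (V 1) = k" using fr(4)[of 0] fr(4)[of 1] n k by simp_all
  have "s5 (A 5 i) = (if i \<in> fset n k E (val s4) (s (V 21)) then 1 else 0)" if "i < n" for i
    using exec_pF[OF _ thr, of i E] that unfolding s5_def 01 by blast
  moreover have "fset n k E (val s4) (s (V 21)) \<subseteq> {..<n}" by (auto simp: fset_def)
  ultimately have "Fs n s5 = fset n k E (val s4) (s (V 21))" by (auto simp: Fs_def split: if_splits)
  also have "\<dots> = fset n k E (iter n E U (s (V 20)) n) (s (V 21))"
    using v3 v4 g by (intro fset_cong) auto
  finally have F5: "Fs n s5 = fset n k E (iter n E U (s (V 20)) n) (s (V 21))" .
  have "Fs n (exec E (pPasses zs) s5) = fold (pass n E) (map (\<lambda>z. s5 (V z)) zs) (Fs n s5)"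
    using zs fr(5)[of 0] n by (intro exec_pPasses) auto
  also have "map (\<lambda>z. s5 (V z)) zs = map (\<lambda>z. s (V z)) zs"
    using zs by (intro map_cong refl fr(5)) auto
  finally show ?thesis
    unfolding F5 result_def us_def[symmetric] U_def[symmetric]
    by (simp add: pre_def s1_def s2_def s3_def s4_def s5_def)
qed

definition body :: "nat list \<Rightarrow> nat list \<Rightarrow> com" where
  "body ws zs = pre ws zs ;; pBest"

lemma exec_body:
  assumes v: "valid n k E s"
  shows "valid n k E (exec E (body ws zs) s)" "s (V 22) \<le> exec E (body ws zs) s (V 22)"
    "\<lbrakk>\<forall>w\<in>set ws. 30 \<le> w; \<forall>z\<in>set zs. 30 \<le> z; s (V 21) < n;
      R = result n k E (map (\<lambda>w. s (V w)) ws) (s (V 20)) (s (V 21)) (map (\<lambda>z. s (V z)) zs);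
      is_clique n E R\<rbrakk> \<Longrightarrow> card R \<le> exec E (body ws zs) s (V 22)"
proof -
  define s1 where "s1 = exec E (pre ws zs) s"
  have fr: "s1 (V x) = s (V x)" if "x \<notin> {4..18}" for x
    unfolding s1_def using that wvars_pre[of ws zs] by (intro exec_var_frame) blast
  have "s1 (A 6 i) = s (A 6 i)" for i unfolding s1_def by (rule exec_arr_frame[OF warrs_pre])
  then have "Bs n s1 = Bs n s" by (simp add: Bs_def)
  then have v1: "valid n k E s1" using v fr[of 0] fr[of 1] fr[of 22] by (simp add: valid_def)
  have e: "exec E (body ws zs) s = exec E pBest s1" by (simp add: body_def s1_def)
  show "valid n k E (exec E (body ws zs) s)" "s (V 22) \<le> exec E (body ws zs) s (V 22)"
    unfolding e using exec_pBest(1,2)[OF v1] fr[of 22] by auto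
  assume "\<forall>w\<in>set ws. 30 \<le> w" "\<forall>z\<in>set zs. 30 \<le> z" "s (V 21) < n"
    "R = result n k E (map (\<lambda>w. s (V w)) ws) (s (V 20)) (s (V 21)) (map (\<lambda>z. s (V z)) zs)" "is_clique n E R"
  moreover have "s (V 0) = n" "s (V 1) = k" using v by (auto simp: valid_def)
  ultimately have "Fs n s1 = R" unfolding s1_def by (simp add: exec_pre)
  then show "card R \<le> exec E (body ws zs) s (V 22)"
    unfolding e using exec_pBest(3)[OF v1] \<open>is_clique n E R\<close> by simp
qed

section \<open>Enumeration of all guesses\<close>

primrec nest :: "nat list \<Rightarrow> com \<Rightarrow> com" where
  "nest [] c = c"
| "nest (v # vs) c = CFor v (nest vs c)"

lemma wvars_nest: "wvars (nest vs c) = set vs \<union> wvars c"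
  by (induction vs) auto

text \<open>\<open>f\<close> is the right guess and \<open>w\<close> the clique size it yields. Per
  loop, the invariant promises the record \<open>w\<close> only after the counter has passed
  \<open>f v\<close>; monotonicity of variable 22 then preserves it through all later
  guesses.\<close>

lemma nest_search:
  assumes pres: "\<And>s. valid n k E s \<Longrightarrow> valid n k E (exec E c s) \<and> s (V 22) \<le> exec E c s (V 22)"
    and hit: "\<And>s. valid n k E s \<Longrightarrow> (\<forall>v\<in>G. s (V v) = f v) \<Longrightarrow> w \<le> exec E c s (V 22)"
    and G: "0 \<notin> G" "1 \<notin> G" "22 \<notin> G" "G \<inter> wvars c = {}" "0 \<notin> wvars c" and f: "\<And>v. v \<in> G \<Longrightarrow> f v < n"
    and vs: "distinct vs" "set vs \<subseteq> G" and s: "valid n k E s"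
  shows "valid n k E (exec E (nest vs c) s) \<and> s (V 22) \<le> exec E (nest vs c) s (V 22) \<and>
    ((\<forall>v\<in>G - set vs. s (V v) = f v) \<longrightarrow> w \<le> exec E (nest vs c) s (V 22))"
  using vs s
proof (induction vs arbitrary: s)
  case Nil
  then show ?case using pres hit by auto
next
  case (Cons v vs)
  have v: "v \<in> G" "v \<noteq> 0" "v \<noteq> 1" "v \<noteq> 22" "v \<notin> set vs" using Cons.prems G by auto
  have n: "s (V 0) = n" using Cons.prems by (simp add: valid_def)
  have upd: "valid n k E (s'(V v := i)) \<longleftrightarrow> valid n k E s'" for s' i
    using v by (simp add: valid_def Bs_def)
  define I where "I m s' \<longleftrightarrow> valid n k E s' \<and> s (V 22) \<le> s' (V 22) \<and>
    ((\<forall>u\<in>G - set (v # vs). s (V u) = f u) \<longrightarrow> f v < m \<longrightarrow> w \<le> s' (V 22))" for m s'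
  have "\<exists>s'. I (s (V 0)) s' \<and> exec E (CFor v (nest vs c)) s = s'(V v := s (V 0))"
  proof (rule for_rule)
    show "0 \<notin> wvars (nest vs c)" using G Cons.prems by (auto simp: wvars_nest)
    show "v \<noteq> 0" by fact
    show "I 0 s" using Cons.prems by (simp add: I_def)
    fix i s'
    assume I: "I i s'" and fr: "\<And>x. x \<noteq> v \<Longrightarrow> x \<notin> wvars (nest vs c) \<Longrightarrow> s' (V x) = s (V x)"
    define s2 where "s2 = s'(V v := i)"
    have val2: "valid n k E s2" using I upd by (simp add: I_def s2_def)
    have 22: "s2 (V 22) = s' (V 22)" using v by (simp add: s2_def)
    have IH: "valid n k E (exec E (nest vs c) s2)" "s2 (V 22) \<le> exec E (nest vs c) s2 (V 22)"
      "(\<forall>u\<in>G - set vs. s2 (V u) = f u) \<longrightarrow> w \<le> exec E (nest vs c) s2 (V 22)"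
      using Cons.IH[of s2] Cons.prems val2 by auto
    have "w \<le> exec E (nest vs c) s2 (V 22)" if all: "\<forall>u\<in>G - set (v # vs). s (V u) = f u" and "f v < Suc i"
    proof (cases "f v = i")
      case True
      have "s2 (V u) = f u" if u: "u \<in> G - set vs" for u
      proof (cases "u = v")
        case False
        then have "u \<notin> wvars (nest vs c)" using u G by (auto simp: wvars_nest)
        then show ?thesis using False fr[of u] all u by (simp add: s2_def)
      qed (simp add: s2_def True)
      then show ?thesis using IH by blast
    next
      case False
      then have "w \<le> s' (V 22)" using I that by (simp add: I_def)
      then show ?thesis using IH(2) 22 by simp
    qed
    then show "I (Suc i) (exec E (nest vs c) (s'(V v := i)))"
      using IH I 22 unfolding I_def s2_def[symmetric] by auto
  qed
  then obtain s' where I: "I n s'" and e: "exec E (nest (v # vs) c) s = s'(V v := n)" using n by auto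
  have 22: "(s'(V v := n)) (V 22) = s' (V 22)" using v by simp
  have "valid n k E (s'(V v := n))" using I unfolding upd I_def by blast
  moreover have "s (V 22) \<le> s' (V 22) \<and> ((\<forall>u\<in>G - set (v # vs). s (V u) = f u) \<longrightarrow> w \<le> s' (V 22))"
    using I f[OF v(1)] unfolding I_def by blast
  ultimately show ?case unfolding e 22 by blast
qed

fun noout :: "com \<Rightarrow> bool" where
  "noout (COut r) = False"
| "noout (c ;; d) = (noout c \<and> noout d)"
| "noout (CIf r c d) = (noout c \<and> noout d)"
| "noout (CFor v c) = noout c"
| "noout _ = True"

lemma outs_noout: "noout c \<Longrightarrow> outs E c s = {}"
  by (induction c arbitrary: s) auto

text \<open>Forty codes of \<open>q\<close> usable bits match the bound \<open>40 * q\<close> on the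
  vertices of the candidate set outside \<open>K\<close>; the 40 is what makes the union bound of
  \<open>prob_not_disc_log\<close> converge.\<close>

definition codes :: "nat list" where
  "codes = [30..<70]"

lemma codes_simps [simp]: "set codes = {30..<70}" "distinct codes" "length codes = 40"
  by (simp_all only: codes_def set_upt distinct_upt length_upt)

lemma nth_codes: "i < 40 \<Longrightarrow> codes ! i = 30 + i"
  unfolding codes_def by (rule nth_upt) simp

definition guesses :: "nat \<Rightarrow> nat list" where
  "guesses t = [70..<70 + t] @ [20, 21] @ codes"

definition search :: "nat \<Rightarrow> com" where
  "search t = nest (guesses t) (body [70..<70 + t] codes)"

definition pOut :: com where
  "pOut = CFor 4 (CLoad 7 6 4 ;; CIf 7 (COut 4) skip)"

definition prog :: "nat \<Rightarrow> com" where
  "prog t = search t ;; pOut"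

lemma outs_pOut: "s (V 0) = n \<Longrightarrow> outs E pOut s = Bs n s"
proof -
  assume n: "s (V 0) = n"
  let ?c = "CLoad 7 6 4 ;; CIf 7 (COut 4) skip"
  have "fold (\<lambda>i s. exec E ?c (s(V 4 := i))) js s (A 6 i) = s (A 6 i)" for js i s
    by (induction js arbitrary: s) auto
  then have "outs E ?c ((fold (\<lambda>i s. exec E ?c (s(V 4 := i))) [0..<j] s)(V 4 := j)) = (if s (A 6 j) \<noteq> 0 then {j} else {})" for j
    by simp
  then show ?thesis unfolding pOut_def outs.simps Bs_def n by (auto split: if_splits)
qed

lemma wvars_body: "wvars (body ws zs) \<subseteq> {4..19} \<union> {22, 23}"
  using wvars_pre[of ws zs] by (auto simp: body_def pBest_def)

lemma noout_simps:
  "noout skip" "noout (NB r a b)" "noout (pU_inner ws)" "noout (pPasses zs)"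
proof -
  show s: "noout skip" by (simp add: skip_def)
  show nb: "noout (NB r a b)" for r a b by (simp add: NB_def s)
  show "noout (pU_inner ws)" by (induction ws) (auto simp: s nb)
  show "noout (pPasses zs)" by (induction zs) (auto simp: s nb pPass_def pBrk_def)
qed

lemma noout_search: "noout (search t)"
proof -
  have "noout (nest vs c) = noout c" for vs c by (induction vs) auto
  then show ?thesis
    by (simp add: search_def body_def pre_def pU_def pInit_def pPow_def pMul_def pMul_inner_def pCopy_def pThr_def
        pF_def pF_inner_def pBest_def pChk_def pChk_inner_def pSave_def noout_simps)
qed

theorem outs_prog:
  assumes len: "length us = t" "length bs = 40" and lt: "\<forall>u\<in>set us. u < n" "v < n" "g < n" "\<forall>z\<in>set bs. z < n"
    and R: "is_clique n E (result n k E us v g bs)"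
      "\<And>D. is_clique n E D \<Longrightarrow> card D \<le> card (result n k E us v g bs)"
  shows "is_max_clique n E (outs E (prog t) (start n k))"
proof -
  define f where "f x = (if x = 20 then v else if x = 21 then g else if x < 70 then bs ! (x - 30) else us ! (x - 70))" for x
  define w where "w = card (result n k E us v g bs)"
  define s where "s = exec E (search t) (start n k)"
  let ?G = "set (guesses t)"
  have mf: "map f [70..<70 + t] = us" "map f codes = bs"
    using len by (auto intro!: nth_equalityI simp: f_def nth_codes)
  have fn: "f x < n" if "x \<in> ?G" for x
    using that lt len by (auto simp: guesses_def f_def)
  have v0: "valid n k E (start n k)"
    by (auto simp: valid_def start_def Bs_def is_clique_def)
  have wb: "wvars (body [70..<70 + t] codes) \<subseteq> {4..19} \<union> {22, 23}" by (rule wvars_body)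
  have "valid n k E s \<and> start n k (V 22) \<le> s (V 22) \<and> ((\<forall>x\<in>?G - set (guesses t). start n k (V x) = f x) \<longrightarrow> w \<le> s (V 22))"
    unfolding s_def search_def
  proof (rule nest_search[where f = f and w = w])
    show "valid n k E (exec E (body [70..<70 + t] codes) s) \<and> s (V 22) \<le> exec E (body [70..<70 + t] codes) s (V 22)"
      if "valid n k E s" for s using exec_body(1,2)[OF that] by blast
    show "w \<le> exec E (body [70..<70 + t] codes) s (V 22)" if s: "valid n k E s" "\<forall>x\<in>?G. s (V x) = f x" for s
    proof -
      have "map (\<lambda>x. s (V x)) [70..<70 + t] = map f [70..<70 + t]" "map (\<lambda>x. s (V x)) codes = map f codes"
        using s(2) by (auto simp: guesses_def)
      then have m: "map (\<lambda>x. s (V x)) [70..<70 + t] = us" "map (\<lambda>x. s (V x)) codes = bs"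
        using mf by simp_all
      have vg: "s (V 20) = v" "s (V 21) = g" using s(2) by (auto simp: guesses_def f_def)
      show ?thesis unfolding w_def
        by (rule exec_body(3)[OF s(1)]) (use m vg lt R(1) in auto)
    qed
    show "0 \<notin> ?G" "1 \<notin> ?G" "22 \<notin> ?G" "distinct (guesses t)" "?G \<subseteq> ?G" by (auto simp: guesses_def)
    show "?G \<inter> wvars (body [70..<70 + t] codes) = {}"
    proof -
      have "?G \<inter> ({4..19} \<union> {22, 23}) = {}" by (auto simp: guesses_def)
      then show ?thesis using wb by blast
    qed
    have "0 \<notin> {4..19} \<union> {22, 23::nat}" by auto
    then show "0 \<notin> wvars (body [70..<70 + t] codes)" using wb by blast
    show "f x < n" if "x \<in> ?G" for x using fn that .
    show "valid n k E (start n k)" by (rule v0)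
  qed
  then have s: "valid n k E s" "w \<le> s (V 22)" by auto
  have "outs E (prog t) (start n k) = Bs n s"
    unfolding prog_def outs.simps outs_noout[OF noout_search] s_def[symmetric]
    using outs_pOut[of s n E] s by (simp add: valid_def)
  moreover have "is_max_clique n E (Bs n s)"
    using s R(2) unfolding is_max_clique_def valid_def w_def by (metis le_trans)
  ultimately show ?thesis by simp
qed

section \<open>Well-formedness and loop depth, which determines the running time\<close>

lemma wfc_nest: "wfc b c \<Longrightarrow> (\<And>v. v \<in> set vs \<Longrightarrow> wok b v) \<Longrightarrow> distinct vs \<Longrightarrow> set vs \<inter> wvars c = {} \<Longrightarrow> wfc b (nest vs c)"
  by (induction vs) (auto simp: wvars_nest)

lemma depth_nest: "depth (nest vs c) = length vs + depth c"
  by (induction vs) auto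

lemma wfc_pPasses: "(\<And>z. z \<in> set zs \<Longrightarrow> vok b z) \<Longrightarrow> 70 \<le> b \<Longrightarrow> wfc b (pPasses zs)"
  by (induction zs) (auto simp: pPass_def pBrk_def wok_def vok_def)

lemma wfc_body: "70 \<le> b \<Longrightarrow> (\<And>z. z \<in> set ws \<union> set zs \<Longrightarrow> vok b z) \<Longrightarrow> wfc b (body ws zs)"
proof -
  assume b: "70 \<le> b" and z: "\<And>z. z \<in> set ws \<union> set zs \<Longrightarrow> vok b z"
  have 1: "wfc b (pU_inner ws)" using z b by (intro wfc_pU_inner) auto
  have 2: "wfc b (pPasses zs)" using z b by (intro wfc_pPasses) auto
  have 3: "wfc b (pU ws)" using 1 b wvars_pU_inner[of ws] by (auto simp: pU_def wok_def vok_def)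
  have 4: "wfc b pInit" "wfc b pThr" "wfc b pCopy" "wfc b pSave" "wfc b pMul_inner" "wfc b pF_inner" "wfc b pChk_inner"
    using b by (auto simp: pInit_def pThr_def pCopy_def pSave_def pMul_inner_def pF_inner_def pChk_inner_def wok_def vok_def)
  have 5: "wfc b pMul" "wfc b pF" "wfc b pChk" using b 4 by (auto simp: pMul_def pF_def pChk_def wok_def vok_def)
  have 6: "wfc b pPow" using b 4 5 by (auto simp: pPow_def wok_def vok_def)
  show ?thesis using b 1 2 3 4 5 6 by (auto simp: body_def pre_def pBest_def wok_def vok_def)
qed

lemma wfc_prog: "wfc (70 + t) (prog t)"
proof -
  have "wfc (70 + t) (body [70..<70 + t] codes)" by (rule wfc_body) (auto simp: vok_def)
  moreover have "set (guesses t) \<inter> ({4..19} \<union> {22, 23}) = {}" by (auto simp: guesses_def)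
  then have "set (guesses t) \<inter> wvars (body [70..<70 + t] codes) = {}" using wvars_body by blast
  ultimately have "wfc (70 + t) (search t)"
    unfolding search_def by (intro wfc_nest) (auto simp: guesses_def wok_def vok_def)
  then show ?thesis by (auto simp: prog_def pOut_def wok_def vok_def)
qed

text \<open>\<open>t\<close> seeds, the two vertices \<open>v\<close> and \<open>g\<close>, 40
  codes, and depth 3 for the power iteration inside.\<close>

lemma depth_prog: "depth (prog t) = t + 45"
proof -
  have p: "depth (pPasses zs) \<le> 2" for zs by (induction zs) (auto simp: pPass_def pBrk_def)
  have "depth (body ws zs) = 3" for ws zs
    using p[of zs] by (auto simp: body_def pre_def pU_def pInit_def pPow_def pMul_def pMul_inner_def pCopy_def pThr_def
        pF_def pF_inner_def pBest_def pChk_def pChk_inner_def pSave_def)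
  then show ?thesis by (simp add: prog_def search_def pOut_def depth_nest guesses_def)
qed

section \<open>The main theorem\<close>

lemma exists_max_clique: "\<exists>D. is_max_clique n G D"
proof -
  have "is_clique n G {}" by (simp add: is_clique_def)
  moreover have "\<forall>D. is_clique n G D \<longrightarrow> card D < Suc n"
  proof (intro allI impI)
    fix D assume "is_clique n G D"
    then have "card D \<le> card {..<n}" by (intro card_mono) (auto simp: is_clique_def)
    then show "card D < Suc n" by simp
  qed
  ultimately have "\<exists>D. is_clique n G D \<and> (\<forall>D'. is_clique n G D' \<longrightarrow> card D' \<le> card D)"
    by (rule ex_has_greatest_nat)
  then show ?thesis by (simp add: is_max_clique_def)
qed

text \<open>The deterministic core. The bound \<open>L1\<close> on the whole graph drives the choice
  of seeds and \<open>L\<close> on \<open>m\<close>-sparse vectors drives the power iteration. The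
  hypothesis on \<open>U\<close> links them, so that both ranges of \<open>k\<close> can be treated
  uniformly.\<close>

theorem prog_finds_max_clique:
  assumes K: "K \<subseteq> {..<n}" "card K = k" "0 < k"
    and op1: "opb n E (real n) L1" "0 < L1" and mu: "25 * L1\<^sup>2 \<le> mu * real k"
    and op2: "opb n E m L" "0 \<le> L" "80 * (2 * L + 1) \<le> real k"
    and U: "\<And>U. U \<subseteq> {..<n} \<Longrightarrow> K \<subseteq> U \<Longrightarrow> real (card (U - K)) \<le> max mu ((3 / 5) ^ t * real n) \<Longrightarrow> real (card U) \<le> m"
    and clq: "\<And>T. is_clique n E T \<Longrightarrow> 10 * card T \<le> k"
    and dsc: "disc n k (40 * q) E" and q: "2 ^ Suc q \<le> n"
  shows "is_max_clique n (plant E K) (outs (plant E K) (prog t) (start n k))"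
proof -
  let ?G = "plant E K"
  obtain us where us: "length us = t" "set us \<subseteq> K" "K \<subseteq> cnb n ?G us"
    "real (card (cnb n ?G us - K)) \<le> max mu ((3 / 5) ^ t * real n)"
    using exists_seeds[OF op1 K mu] by blast
  define W where "W = cnb n ?G us"
  have W: "W \<subseteq> {..<n}" "K \<subseteq> W" using us by (auto simp: W_def cnb_def)
  have mW: "real (card W) \<le> m" using U[OF W] us by (simp add: W_def)
  interpret it: power_iteration n k E K W "2 * L + 1"
  proof
    show "K \<subseteq> W" "W \<subseteq> {..<n}" "card K = k" "0 < k" "0 \<le> 2 * L + 1" "80 * (2 * L + 1) \<le> real k"
      using W K op2 by auto
    show "nrm n (\<lambda>i. mstep n ?G W x i - (\<Sum>h\<in>K. x h) * indicator K i) \<le> (2 * L + 1) * nrm n x"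
      if "\<And>i. i \<notin> W \<Longrightarrow> x i = 0" for x
      by (rule mstep_noise[OF W(2,1) op2(1) mW op2(2) that])
  qed
  obtain v g where v: "v \<in> K" "g < n" and ext: "let x = iter n ?G W v n; S = {h. h < n \<and> \<bar>x g\<bar> \<le> \<bar>x h\<bar>} in
     100 * card (K - S) \<le> k \<and> 100 * card (S - K) \<le> k"
    using it.extraction by blast
  define x where "x = iter n ?G W v n"
  define S where "S = {h. h < n \<and> \<bar>x g\<bar> \<le> \<bar>x h\<bar>}"
  have S: "100 * card (K - S) \<le> k" "100 * card (S - K) \<le> k"
    using ext unfolding Let_def x_def S_def by auto
  define F where "F = fset n k ?G x g"
  obtain D where D: "is_max_clique n ?G D" using exists_max_clique by blast
  have DF: "D \<subseteq> F" unfolding F_def by (rule max_clique_subset_fset[OF K(1,2) S_def S(1) D clq])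
  have KF: "K \<subseteq> F" unfolding F_def by (rule subset_fset[OF K(1,2) S_def S(1)])
  have FK: "card (F - K) < 40 * q" unfolding F_def by (rule card_fset_diff[OF K(1,2) S_def S(2) dsc])
  have Fn: "F \<subseteq> {..<n}" by (auto simp: F_def fset_def)
  then have fF: "finite F" using finite_subset by blast
  have fD: "finite D" "finite K" using DF KF fF finite_subset by blast+
  \<comment> \<open>A maximum clique is at least as large as \<open>K\<close>, and both lie in
    \<open>F\<close>; hence the bound on \<open>F - K\<close> carries over to \<open>F - D\<close>,
    the vertices to be deleted.\<close>
  have "card K \<le> card D" using D is_clique_plant[OF K(1)] by (auto simp: is_max_clique_def)
  then have "card (F - D) \<le> card (F - K)"
    using card_Diff_subset[OF fD(1) DF] card_Diff_subset[OF fD(2) KF] by simp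
  then have FD: "card (F - D) \<le> 40 * q" using FK by simp
  have nbD: "nb ?G u w" if "u \<in> D" "w \<in> D" for u w
    using D that by (auto simp: is_max_clique_def is_clique_def nb_def)
  obtain bs where bs: "length bs = 40" "\<forall>z\<in>set bs. z < n"
    "let F' = fold (pass n ?G) bs F in D \<subseteq> F' \<and> is_clique n ?G F'"
    using branching_codes[OF Fn DF nbD FD q] by blast
  define R where "R = fold (pass n ?G) bs F"
  have R: "D \<subseteq> R" "is_clique n ?G R" using bs(3) by (auto simp: R_def Let_def)
  have "finite R" using R(2) finite_subset unfolding is_clique_def by blast
  then have "card D \<le> card R" using R(1) by (intro card_mono)
  then have max: "card D' \<le> card R" if "is_clique n ?G D'" for D'
    using D that unfolding is_max_clique_def by (meson le_trans)
  have res: "result n k ?G us v g bs = R"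
    unfolding result_def R_def F_def x_def W_def ..
  show ?thesis
  proof (rule outs_prog[where us = us and v = v and g = g and bs = bs])
    show "length us = t" "length bs = 40" "g < n" "\<forall>z\<in>set bs. z < n" by fact+
    show "\<forall>u\<in>set us. u < n" "v < n" using us K v by auto
    show "is_clique n ?G (result n k ?G us v g bs)" unfolding res by (rule R(2))
    show "card D' \<le> card (result n k ?G us v g bs)" if "is_clique n ?G D'" for D'
      unfolding res using that by (rule max)
  qed
qed

text \<open>For q \<ge> 5, ln n \<le> q. With 40 q \<le> k the entropy (40 q + k) ln n is at most 2
  q k, while s = 40 q makes the tail exponent 40 * 36/625 * q k = 288/125 * q k, which exceeds
  it.\<close>

lemma prob_not_disc_log:
  assumes q: "q = floor_log n - 1" "5 \<le> q" and k: "40 * q \<le> k"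
  shows "measure_pmf.prob (gnp n (1/2)) {E. \<not> disc n k (40 * q) E} \<le> exp 2 / real n"
proof -
  have n: "0 < n" using q by (cases n) auto
  have fl: "floor_log n = q + 1" using q by simp
  have "real n < 2 ^ (q + 2)"
  proof -
    have "n < 2 * 2 ^ floor_log n" by (rule floor_log_exp2_gt)
    then have "real n < real (2 * 2 ^ (q + 1))" unfolding fl by (rule of_nat_less_iff[THEN iffD2])
    then show ?thesis by simp
  qed
  then have "ln (real n) \<le> ln (2 ^ (q + 2))" using n by simp
  also have "\<dots> = real (q + 2) * ln 2" by (rule ln_realpow)
  also have "\<dots> \<le> real (q + 2) * (25 / 36)" using ln2_le_25_over_36 by (intro mult_left_mono) auto
  finally have ln1: "ln (real n) \<le> (real q + 2) * (25 / 36)" by simp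
  define Q where "Q = real q"
  define x where "x = real k"
  have Q: "5 \<le> Q" "40 * Q \<le> x" using q k unfolding Q_def x_def by linarith+
  have lnQ: "ln (real n) \<le> Q" using ln1 Q(1) unfolding Q_def[symmetric] by simp
  have "measure_pmf.prob (gnp n (1/2)) {E. \<not> disc n k (40 * q) E}
     \<le> real n ^ (40 * q + k) * exp (- (36 / 625 * (real (40 * q) * real k)))"
    using q k by (intro prob_not_disc) auto
  also have "real n ^ (40 * q + k) = exp ((40 * Q + x) * ln (real n))"
  proof -
    have "exp ((40 * Q + x) * ln (real n)) = exp (real (40 * q + k) * ln (real n))" by (simp add: Q_def x_def)
    also have "\<dots> = exp (ln (real n)) ^ (40 * q + k)" by (rule exp_of_nat_mult)
    finally show ?thesis using n by simp
  qed
  also have "exp ((40 * Q + x) * ln (real n)) * exp (- (36 / 625 * (real (40 * q) * real k)))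
     = exp ((40 * Q + x) * ln (real n) - 288 / 125 * (Q * x))"
    by (simp add: exp_add[symmetric] Q_def x_def)
  also have "\<dots> \<le> exp (2 - ln (real n))"
  proof -
    have "(40 * Q + x) * ln (real n) \<le> (40 * Q + x) * Q" using lnQ Q by (intro mult_left_mono) auto
    also have "\<dots> = 40 * Q * Q + Q * x" by (simp add: algebra_simps)
    also have "40 * Q * Q \<le> x * Q" using Q by (intro mult_right_mono) auto
    finally have 1: "(40 * Q + x) * ln (real n) \<le> 2 * (Q * x)" by (simp add: mult_ac)
    have "40 * 5 \<le> x" using Q by linarith
    then have "Q * (40 * 5) \<le> Q * x" using Q by (intro mult_left_mono) auto
    then have 2: "Q \<le> 38 / 125 * (Q * x)" using Q by simp
    show ?thesis using 1 2 lnQ by simp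
  qed
  also have "\<dots> = exp 2 / real n" using n by (simp add: exp_diff)
  finally show ?thesis .
qed

lemma runs_within_mono: "runs_within P E n k T Y \<Longrightarrow> T \<le> T' \<Longrightarrow> runs_within P E n k T' Y"
  unfolding runs_within_def Let_def using order.trans by blast

text \<open>3/5 \<le> exp(-2/5) explains the 5/2 in \<open>t\<close>. The 92 is 2 * 45 + 1 from the
  cost bound plus 1 to absorb a constant factor; the size of 300000 stems from the crude estimate ln
  12800 \<le> 12800.\<close>

lemma seed_count:
  fixes \<epsilon> d :: real
  assumes e: "0 < \<epsilon>" and d: "d = min 1 (\<epsilon> / 12800)" and t: "t = nat \<lceil>5 / 2 * ln (2 / d ^ 4)\<rceil>"
  shows "(3 / 5) ^ t \<le> d ^ 4 / 2" "2 * real t + 92 \<le> 300000 * max 1 (ln (1 / \<epsilon>))"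
proof -
  have d0: "0 < d" "d \<le> 1" using e by (auto simp: d)
  have tl: "5 / 2 * ln (2 / d ^ 4) \<le> real t" unfolding t by linarith
  have "(3 / 5 :: real) \<le> exp (- (2 / 5))" using exp_ge_add_one_self[of "- (2 / 5) :: real"] by simp
  then have "(3 / 5 :: real) ^ t \<le> exp (- (2 / 5)) ^ t" by (intro power_mono) auto
  also have "\<dots> = exp (- (2 / 5 * real t))" by (simp add: exp_of_nat_mult[symmetric] mult_ac)
  also have "\<dots> \<le> exp (- ln (2 / d ^ 4))" using tl by simp
  also have "\<dots> = d ^ 4 / 2" using d0 by (simp add: exp_minus)
  finally show "(3 / 5) ^ t \<le> d ^ 4 / 2" .
  define M where "M = max 1 (ln (1 / \<epsilon>))"
  have M: "1 \<le> M" "ln (1 / \<epsilon>) \<le> M" by (auto simp: M_def)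
  have "- ln d \<le> 12800 + M"
  proof (cases "\<epsilon> / 12800 \<le> 1")
    case True
    then have "d = \<epsilon> / 12800" by (simp add: d)
    then have "- ln d = ln 12800 + ln (1 / \<epsilon>)" using e by (simp only: ln_div) (simp add: ln_div)
    moreover have "ln (12800 :: real) \<le> 12800" using ln_le_minus_one[of 12800] by simp
    ultimately show ?thesis using M by simp
  next
    case False
    then have "d = 1" by (simp add: d)
    then show ?thesis using M by simp
  qed
  then have nl: "- ln d \<le> 12801 * M" using M by simp
  have "ln (2 / d ^ 4) = ln 2 + 4 * (- ln d)" using d0 by (simp add: ln_div ln_realpow)
  moreover have "ln (2 :: real) \<le> 1" using ln2_le_25_over_36 by simp
  ultimately have l: "ln (2 / d ^ 4) \<le> 51205 * M" using nl M by simp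
  have "0 \<le> ln (2 / d ^ 4)" using d0 power_le_one[of d 4] by (intro ln_ge_zero) (simp add: field_simps)
  then have "real t \<le> 5 / 2 * ln (2 / d ^ 4) + 1" unfolding t by linarith
  then have "2 * real t + 92 \<le> 300000 * M" using l M by simp
  then show "2 * real t + 92 \<le> 300000 * max 1 (ln (1 / \<epsilon>))" unfolding M_def .
qed

text \<open>The constant 12800 is 2 * 80 * 2 * 40: it makes 80 * 2 * (40 d sqrt n) at most half of
  epsilon sqrt n, and the remaining 80 is covered by the other half for large n. The seeds are run
  down to m/2 outsiders, leaving room m/2 for \<open>K\<close>.\<close>

lemma search_succeeds:
  fixes \<epsilon> d :: real
  assumes e: "0 < \<epsilon>" and d: "d = min 1 (\<epsilon> / 12800)" and t: "(3 / 5) ^ t \<le> d ^ 4 / 2"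
    and k: "\<epsilon> * sqrt (real n) \<le> real k" and n: "0 < n"
    and n1: "80 \<le> \<epsilon> / 2 * sqrt (real n)" and n2: "40000 * real n \<le> d ^ 4 * real n / 2 * (\<epsilon> * sqrt (real n))"
    and n3: "80 * (2 * (40 * sqrt (real n)) + 1) \<le> d ^ 4 * real n / 2"
    and q: "2 ^ Suc q \<le> n"
    and op1: "opb n E (1 ^ 4 * real n) (40 * 1 * sqrt (real n))"
    and op2: "opb n E (d ^ 4 * real n) (40 * d * sqrt (real n))"
    and dsc: "disc n k (40 * q) E" and K: "K \<subseteq> {..<n}" "card K = k"
  shows "is_max_clique n (plant E K) (outs (plant E K) (prog t) (start n k))"
proof -
  define r where "r = sqrt (real n)"
  define m where "m = d ^ 4 * real n"
  have r: "0 < r" "r * r = real n" using n by (auto simp: r_def)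
  have d0: "0 < d" "d \<le> 1" "12800 * d \<le> \<epsilon>" using e by (auto simp: d)
  have dr: "12800 * (d * r) \<le> \<epsilon> * r" using d0(3) r by (simp add: mult.assoc[symmetric])
  have kr: "\<epsilon> * r \<le> real k" using k by (simp add: r_def)
  have er: "160 \<le> \<epsilon> * r" using n1 by (simp add: r_def)
  then have k0: "0 < k" using kr by (cases k) auto
  have op1': "opb n E (real n) (40 * r)" using op1 by (simp add: r_def)
  have op2': "opb n E m (40 * d * r)" using op2 by (simp add: m_def r_def)
  have kL: "80 * (2 * (40 * d * r) + 1) \<le> real k" using dr kr er by (simp add: algebra_simps)
  have mu: "25 * (40 * r)\<^sup>2 \<le> m / 2 * real k"
  proof -
    have "25 * (40 * r)\<^sup>2 = 40000 * real n" using r by (simp add: power2_eq_square)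
    also have "\<dots> \<le> m / 2 * (\<epsilon> * r)" using n2 by (simp add: m_def r_def)
    also have "\<dots> \<le> m / 2 * real k" using kr d0 by (intro mult_left_mono) (auto simp: m_def)
    finally show ?thesis .
  qed
  have t': "max (m / 2) ((3 / 5) ^ t * real n) = m / 2"
  proof -
    have "(3 / 5) ^ t * real n \<le> d ^ 4 / 2 * real n" using t by (rule mult_right_mono) simp
    then show ?thesis by (simp add: m_def)
  qed
  have mr: "80 * (2 * (40 * r) + 1) \<le> m / 2" using n3 by (simp add: m_def r_def)
  \<comment> \<open>Bootstrapping: the global norm bound shows the clique is small enough for the
    sparse bound to apply, and the latter brings its size below k/10.\<close>
  have clq: "10 * card T \<le> k" if T: "is_clique n E T" for T
  proof -
    have "card T \<le> card {..<n}" using T by (intro card_mono) (auto simp: is_clique_def)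
    then have "real (card T) \<le> 40 * r + 1" using r by (intro clique_bound[OF op1' T]) auto
    then have "real (card T) \<le> m" using mr r by simp
    then have "real (card T) \<le> 40 * d * r + 1" using r d0 by (intro clique_bound[OF op2' T]) auto
    then have "10 * real (card T) \<le> real k" using kL mult_pos_pos[OF d0(1) r(1)] by (simp add: algebra_simps)
    then show ?thesis by linarith
  qed
  have fK: "finite K" using K finite_subset by blast
  show ?thesis
  proof (cases "real k \<le> m / 2")
    \<comment> \<open>Here \<open>U\<close> has at most m/2 vertices outside \<open>K\<close> and at
      most m/2 inside, so the sparse norm bound applies to it.\<close>
    case True
    show ?thesis
    proof (rule prog_finds_max_clique[OF K k0 op1' _ mu op2' _ kL _ clq dsc q])
      fix U assume U: "U \<subseteq> {..<n}" "K \<subseteq> U" "real (card (U - K)) \<le> max (m / 2) ((3 / 5) ^ t * real n)"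
      have "card (U - K) = card U - card K" using fK U(2) by (rule card_Diff_subset)
      moreover have "card K \<le> card U" using U finite_subset by (intro card_mono) blast+
      ultimately have "real (card U) = real (card (U - K)) + real k" using K(2) by simp
      then show "real (card U) \<le> m" using U(3) True unfolding t' by simp
    qed (use r d0 in auto)
  next
    \<comment> \<open>\<open>k\<close> is linear in n and dominates even the noise of the whole
      matrix, so any \<open>U\<close> is acceptable.\<close>
    case False
    then have kL1: "80 * (2 * (40 * r) + 1) \<le> real k" using mr by simp
    show ?thesis
    proof (rule prog_finds_max_clique[OF K k0 op1' _ mu op1' _ kL1 _ clq dsc q])
      fix U :: "nat set" assume "U \<subseteq> {..<n}"
      then have "card U \<le> card {..<n}" by (intro card_mono) auto
      then show "real (card U) \<le> real n" by simp
    qed (use r in auto)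
  qed
qed

lemma tendsto_exp_decay: "0 < c \<Longrightarrow> (\<lambda>n. exp (- (c * real n))) \<longlonglongrightarrow> 0" for c :: real
  by real_asymp

lemma tendsto_exp_2_over: "(\<lambda>n. exp 2 / real n :: real) \<longlonglongrightarrow> 0"
  by real_asymp

lemma eventual_sizes:
  fixes \<epsilon> d :: real assumes "0 < \<epsilon>" "0 < d"
  shows "\<forall>\<^sub>F n in sequentially. 80 \<le> \<epsilon> / 2 * sqrt (real n)"
    "\<forall>\<^sub>F n in sequentially. 40000 * real n \<le> d ^ 4 * real n / 2 * (\<epsilon> * sqrt (real n))"
    "\<forall>\<^sub>F n in sequentially. 80 * (2 * (40 * sqrt (real n)) + 1) \<le> d ^ 4 * real n / 2"
    "\<forall>\<^sub>F n in sequentially. 40 * log 2 (real n) \<le> \<epsilon> * sqrt (real n)"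
  using assms by real_asymp+

theorem theorem1p1:
  shows "\<exists>C>0. \<forall>\<epsilon>>0. \<forall>k :: nat \<Rightarrow> nat.
     (\<forall>n. k n \<le> n) \<and> (\<forall>\<^sub>F n in sequentially. \<epsilon> * sqrt (real n) \<le> real (k n)) \<longrightarrow>
     (\<exists>P :: instr list.
        (\<forall>\<^sub>F n in sequentially. \<forall>E. E \<subseteq> vpairs n \<longrightarrow>
            (\<exists>Y. runs_within P E n (k n) (C * real n powr (C * max 1 (ln (1 / \<epsilon>)))) Y))
      \<and> (\<forall>s :: nat \<Rightarrow> (nat \<times> nat) set \<Rightarrow> nat set.
            (\<forall>n. planting_strategy n (k n) (s n)) \<longrightarrow>
            (\<lambda>n. measure_pmf.prob (gnp n (1/2))
                   {E. \<exists>T Y. runs_within P (plant E (s n E)) n (k n) T Y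
                              \<and> is_max_clique n (plant E (s n E)) Y})
            \<longlonglongrightarrow> 1))"
proof (rule exI[of _ 300000], intro conjI allI impI)
  show "(0 :: real) < 300000" by simp
  fix \<epsilon> :: real and k :: "nat \<Rightarrow> nat"
  assume e: "0 < \<epsilon>" and "(\<forall>n. k n \<le> n) \<and> (\<forall>\<^sub>F n in sequentially. \<epsilon> * sqrt (real n) \<le> real (k n))"
  then have kn: "\<And>n. k n \<le> n" and ke: "\<forall>\<^sub>F n in sequentially. \<epsilon> * sqrt (real n) \<le> real (k n)" by auto
  define d where "d = min 1 (\<epsilon> / 12800)"
  define t where "t = nat \<lceil>5 / 2 * ln (2 / d ^ 4)\<rceil>"
  define P where "P = code (70 + t) (prog t) 0"
  have d0: "0 < d" "d \<le> 1" using e by (auto simp: d_def)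
  note tt = seed_count[OF e d_def t_def]
  obtain W where W: "\<And>n k E. 1 \<le> n \<Longrightarrow> k \<le> n \<Longrightarrow>
      runs_within P E n k (real (W * n ^ (2 * depth (prog t) + 1))) (outs E (prog t) (start n k))"
  proof -
    have "4 \<le> 70 + t" by simp
    from compiled_run[OF wfc_prog this] that show ?thesis unfolding P_def by blast
  qed
  show "\<exists>P. (\<forall>\<^sub>F n in sequentially. \<forall>E. E \<subseteq> vpairs n \<longrightarrow>
            (\<exists>Y. runs_within P E n (k n) (300000 * real n powr (300000 * max 1 (ln (1 / \<epsilon>)))) Y))
      \<and> (\<forall>s. (\<forall>n. planting_strategy n (k n) (s n)) \<longrightarrow>
            (\<lambda>n. measure_pmf.prob (gnp n (1/2))
                   {E. \<exists>T Y. runs_within P (plant E (s n E)) n (k n) T Y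
                              \<and> is_max_clique n (plant E (s n E)) Y}) \<longlonglongrightarrow> 1)"
  proof (intro exI[of _ P] conjI allI impI)
    show "\<forall>\<^sub>F n in sequentially. \<forall>E. E \<subseteq> vpairs n \<longrightarrow>
            (\<exists>Y. runs_within P E n (k n) (300000 * real n powr (300000 * max 1 (ln (1 / \<epsilon>)))) Y)"
      using eventually_ge_at_top[of "max 1 W"]
    proof eventually_elim
      case (elim n)
      then have n: "1 \<le> n" "W \<le> n" by auto
      \<comment> \<open>For n \<ge> W the constant \<open>W\<close> is absorbed into one further
        power of n.\<close>
      have "W * n ^ (2 * depth (prog t) + 1) \<le> n * n ^ (2 * depth (prog t) + 1)" using n by (intro mult_le_mono1)
      also have "\<dots> = n ^ Suc (2 * depth (prog t) + 1)" by (simp only: power_Suc)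
      also have "Suc (2 * depth (prog t) + 1) = 2 * t + 92" by (simp add: depth_prog)
      finally have "real (W * n ^ (2 * depth (prog t) + 1)) \<le> real (n ^ (2 * t + 92))" by (rule of_nat_mono)
      also have "\<dots> = real n powr (2 * real t + 92)" using n by (simp add: powr_realpow[symmetric])
      also have "\<dots> \<le> real n powr (300000 * max 1 (ln (1 / \<epsilon>)))" using n tt(2) by (intro powr_mono) auto
      also have "\<dots> \<le> 300000 * real n powr (300000 * max 1 (ln (1 / \<epsilon>)))" by simp
      finally have T: "real (W * n ^ (2 * depth (prog t) + 1)) \<le> 300000 * real n powr (300000 * max 1 (ln (1 / \<epsilon>)))" .
      show ?case by (intro allI impI exI) (rule runs_within_mono[OF W[OF n(1) kn] T])
    qed
  next
    fix s assume s: "\<forall>n. planting_strategy n (k n) (s n)"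
    define X where "X n = {E. \<exists>T Y. runs_within P (plant E (s n E)) n (k n) T Y
                              \<and> is_max_clique n (plant E (s n E)) Y}" for n
    \<comment> \<open>The three failure probabilities: norm of the whole matrix (the case d = 1),
      norm on sparse vectors, and discrepancy.\<close>
    define h where "h n = exp (- (4 * 1\<^sup>2 * real n)) + exp (- (4 * d\<^sup>2 * real n)) + exp 2 / real n" for n
    have ev: "\<forall>\<^sub>F n in sequentially. 80 \<le> \<epsilon> / 2 * sqrt (real n)"
      "\<forall>\<^sub>F n in sequentially. 40000 * real n \<le> d ^ 4 * real n / 2 * (\<epsilon> * sqrt (real n))"
      "\<forall>\<^sub>F n in sequentially. 80 * (2 * (40 * sqrt (real n)) + 1) \<le> d ^ 4 * real n / 2"
      "\<forall>\<^sub>F n in sequentially. 40 * log 2 (real n) \<le> \<epsilon> * sqrt (real n)"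
      by (rule eventual_sizes[OF e d0(1)])+
    have "\<forall>\<^sub>F n in sequentially. 1 - h n \<le> measure_pmf.prob (gnp n (1/2)) (X n)"
      using ev ke eventually_ge_at_top[of "64 :: nat"]
    proof eventually_elim
      case (elim n)
      then have n: "0 < n" "64 \<le> n" by auto
      \<comment> \<open>One bit is given up to the leading marker 1, so that every code with
        \<open>q\<close> payload bits is below 2^(q+1) \<le> n.\<close>
      define q where "q = floor_log n - 1"
      have "floor_log (2 ^ 6) \<le> floor_log n" using n(2) by (intro floor_log_le_iff) simp
      moreover have "floor_log (2 ^ 6) = 6" by (rule floor_log_power)
      ultimately have q5: "5 \<le> q" by (simp add: q_def)
      have fl: "floor_log n = Suc q" using q5 by (simp add: q_def)
      have 2: "2 ^ Suc q \<le> n" using floor_log_exp2_le[OF n(1)] by (simp add: fl)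
      have "real (2 ^ Suc q) \<le> real n" using 2 by (rule of_nat_mono)
      then have "2 powr real (Suc q) \<le> real n" by (simp only: powr_realpow zero_less_numeral of_nat_power of_nat_numeral)
      then have "real (Suc q) \<le> log 2 (real n)" using n by (subst le_log_iff) auto
      then have "real (40 * q) \<le> real (k n)" using elim(4,5) by simp
      then have kq: "40 * q \<le> k n" by linarith
      define B1 where "B1 = {E. \<not> opb n E (1 ^ 4 * real n) (40 * 1 * sqrt (real n))}"
      define B2 where "B2 = {E. \<not> opb n E (d ^ 4 * real n) (40 * d * sqrt (real n))}"
      define B3 where "B3 = {E. \<not> disc n (k n) (40 * q) E}"
      let ?p = "measure_pmf.prob (gnp n (1/2))"
      have b1: "?p B1 \<le> exp (- (4 * 1\<^sup>2 * real n))"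
        unfolding B1_def by (rule prob_not_opb) (use n in simp_all)
      have b2: "?p B2 \<le> exp (- (4 * d\<^sup>2 * real n))"
        unfolding B2_def by (rule prob_not_opb[OF d0 n(1)])
      have b3: "?p B3 \<le> exp 2 / real n"
        unfolding B3_def by (rule prob_not_disc_log[OF q_def q5 kq])
      \<comment> \<open>Restriction to the support is essential: a planting strategy is constrained
        only on edge sets inside \<open>vpairs n\<close>.\<close>
      have sub: "- X n \<inter> set_pmf (gnp n (1/2)) \<subseteq> B1 \<union> (B2 \<union> B3)"
      proof
        fix E assume E: "E \<in> - X n \<inter> set_pmf (gnp n (1/2))"
        show "E \<in> B1 \<union> (B2 \<union> B3)"
        proof (rule ccontr)
          assume "E \<notin> B1 \<union> (B2 \<union> B3)"
          then have g: "opb n E (1 ^ 4 * real n) (40 * 1 * sqrt (real n))"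
            "opb n E (d ^ 4 * real n) (40 * d * sqrt (real n))" "disc n (k n) (40 * q) E"
            by (auto simp: B1_def B2_def B3_def)
          have "E \<subseteq> vpairs n" using E set_pmf_gnp[of n "1/2"] by auto
          then have K: "s n E \<subseteq> {..<n}" "card (s n E) = k n" using s by (auto simp: planting_strategy_def)
          have "is_max_clique n (plant E (s n E)) (outs (plant E (s n E)) (prog t) (start n (k n)))"
            by (rule search_succeeds[OF e d_def tt(1) elim(5) n(1) elim(1-3) 2 g K])
          moreover have "1 \<le> n" using n by simp
          moreover note W[OF \<open>1 \<le> n\<close> kn, of "plant E (s n E)"]
          ultimately have "E \<in> X n" unfolding X_def by blast
          then show False using E by simp
        qed
      qed
      have "?p (- X n) = ?p (- X n \<inter> set_pmf (gnp n (1/2)))" by (rule measure_Int_set_pmf[symmetric])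
      also have "\<dots> \<le> ?p (B1 \<union> (B2 \<union> B3))"
        by (rule measure_pmf.finite_measure_mono[OF sub]) simp
      also have "\<dots> \<le> ?p B1 + (?p B2 + ?p B3)"
      proof -
        have "?p (B1 \<union> (B2 \<union> B3)) \<le> ?p B1 + ?p (B2 \<union> B3)" by (rule measure_Un_le) simp_all
        also have "?p (B2 \<union> B3) \<le> ?p B2 + ?p B3" by (rule measure_Un_le) simp_all
        finally show ?thesis by simp
      qed
      also have "\<dots> \<le> h n" unfolding h_def using add_mono[OF b1 add_mono[OF b2 b3]] by (simp only: add.assoc)
      finally have "?p (- X n) \<le> h n" .
      moreover have "?p (- X n) = 1 - ?p (X n)"
        using measure_pmf.prob_compl[of "X n" "gnp n (1/2)"]
        by (simp only: Compl_eq_Diff_UNIV space_measure_pmf sets_measure_pmf UNIV_I)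
      ultimately show ?case by simp
    qed
    note lower = this
    have lim: "(\<lambda>n. 1 - h n) \<longlonglongrightarrow> 1"
    proof -
      have "0 < 4 * d\<^sup>2" using d0(1) by simp
      from tendsto_add[OF tendsto_add[OF tendsto_exp_decay[of "4 * 1\<^sup>2"] tendsto_exp_decay[OF this]] tendsto_exp_2_over]
      have "h \<longlonglongrightarrow> 0 + 0 + 0" unfolding h_def by simp
      then have "(\<lambda>n. 1 - h n) \<longlonglongrightarrow> 1 - (0 + 0 + 0)" by (intro tendsto_diff tendsto_const)
      then show ?thesis by simp
    qed
    have "(\<lambda>n. measure_pmf.prob (gnp n (1/2)) (X n)) \<longlonglongrightarrow> 1"
      by (rule tendsto_sandwich[OF lower _ lim tendsto_const]) simp
    then show "(\<lambda>n. measure_pmf.prob (gnp n (1/2)) {E. \<exists>T Y. runs_within P (plant E (s n E)) n (k n) T Y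
                              \<and> is_max_clique n (plant E (s n E)) Y}) \<longlonglongrightarrow> 1"
      unfolding X_def .
  qed
qed

end
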